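(* Let $\mathbb{K}$ be a field with $\mathrm{char}\,\mathbb{K}\neq 3$ containing an element $\theta$ with $\theta^3=1\neq\theta$. Let $$M=\{(a,b)\in\mathbb{K}^2:\ (a,b)\neq(0,0),\ (a+b)^3+1\neq 0,\ (a^3-1,b^3-1)\neq(0,0)\}.$$ If both $(a,b)$ and $(a',b')$ belong to $M$, then the Sklyanin algebras $Q^{a,b,1}$ and $Q^{a',b',1}$ are isomorphic if and only if $(a,b)$ and $(a',b')$ are in the same orbit of the group action on $M$ generated by the two maps $$(a,b)\mapsto(\theta a,\theta b)\quad\text{and}\quad (a,b)\mapsto\left(\frac{\theta a+\theta^2b+1}{a+b+1},\ \frac{\theta^2a+\theta b+1}{a+b+1}\right).$$ This group is finite, consists of $24$ elements (thus if $\mathbb{K}$ is infinite, for generic $(a,b)\in M$, there are exactly $23$ other elements of $M$ giving rise to an isomorphic Sklyanin algebra) and is isomorphic to $SL_2(\mathbb{Z}_3)$. The complete list of pairs $(a',b')\in M$ such that, for a given $(a,b)\in M$, $Q^{a,b,1}$ and $Q^{a',b',1}$ are isomorphic is as follows: (i) $(\theta^ja,\theta^jb)$ with $j\in\{0,1,2\}$; (ii) $(\theta^jb,\theta^ja)$ with $j\in\{0,1,2\}$; (iii) $\left(\dfrac{\theta^ja+\theta^kb+\theta^m}{a+b+\theta^n},\ \dfrac{\theta^ka+\theta^jb+\theta^m}{a+b+\theta^n}\right)$ with $n\in\{0,1,2\}$ and $\{j,k,m\}=\{0,1,2\}$. The last condition means that $(j,k,m)$ is a permutation of $(0,1,2)$.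 Each of the first two lines in this list provides $3$ pairs, while the last line yields $18$.
   Context: For $(p,q,r)\in\mathbb{K}^3$, the Sklyanin algebra $Q^{p,q,r}$ is the quadratic (associative, unital) $\mathbb{K}$-algebra with generators $x,y,z$ and the three relations $pyz+qzy+rxx=0$, $pzx+qxz+ryy=0$, $pxy+qyx+rzz=0$, graded by degree with $x,y,z$ in degree $1$. Isomorphic means isomorphic as graded $\mathbb{K}$-algebras, that is, via an invertible linear change of the variables $x,y,z$. $\mathbb{Z}_3$ is the field of integers modulo $3$, and $SL_2(\mathbb{Z}_3)$ is the group of $2\times 2$ matrices over it with determinant $1$. "Generic" is used in the usual algebraic-geometric sense.
   Formalization: In (iii) the numerators' constant θ^m is corrected to θ^(m+n) (as printed it fails, e.g. over F_7); the claims of 24 elements and SL_2(Z_3) assume M nonempty (M is empty for F_4); the counts 3, 3, 18 of distinct pairs are stated for generic (a,b) over infinite K. *)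

theory Defs
  imports
    "HOL-Library.Poly_Mapping"
    "HOL-Library.Numeral_Type"
    "HOL-Computational_Algebra.Polynomial"
    "HOL-Algebra.Algebra"
    "HOL-Analysis.Determinants"
begin

text \<open>
  The free algebra on \<open>x, y, z\<close> is the monoid algebra of the free monoid on three letters.
  The product on \<^typ>\<open>'m \<Rightarrow>\<^sub>0 'k\<close> convolves along addition of \<open>'m\<close>, so words are written additively:
  \<open>0\<close> is the empty word and \<open>+\<close> is concatenation (which is not commutative).
\<close>

datatype letter = Lx | Ly | Lz

datatype xyz_word = Word (letters: "letter list")

instantiation xyz_word :: monoid_add
begin

definition zero_xyz_word :: xyz_word where "0 = Word []"

definition plus_xyz_word :: "xyz_word \<Rightarrow> xyz_word \<Rightarrow> xyz_word" where
  "u + v = Word (letters u @ letters v)"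

instance
  by standard (simp_all add: zero_xyz_word_def plus_xyz_word_def)

end

type_synonym 'k free_alg = "xyz_word \<Rightarrow>\<^sub>0 'k"

definition gen :: "letter \<Rightarrow> 'k::field free_alg" where
  "gen l = Poly_Mapping.single (Word [l]) 1"

definition scal :: "'k::field \<Rightarrow> 'k free_alg" where
  "scal c = Poly_Mapping.single 0 c"

definition homogeneous :: "nat \<Rightarrow> 'k::field free_alg set" where
  "homogeneous n = {f. \<forall>w\<in>Poly_Mapping.keys f. length (letters w) = n}"

definition free_ring :: "'k::field free_alg ring" where
  "free_ring = \<lparr>carrier = UNIV, mult = (*), one = 1, ring.zero = 0, add = (+)\<rparr>"

definition sklyanin_relations :: "'k::field \<times> 'k \<times> 'k \<Rightarrow> 'k free_alg set" where
  "sklyanin_relations = (\<lambda>(p, q, r). let x = gen Lx; y = gen Ly; z = gen Lz in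
     {scal p * y * z + scal q * z * y + scal r * x * x,
      scal p * z * x + scal q * x * z + scal r * y * y,
      scal p * x * y + scal q * y * x + scal r * z * z})"

text \<open>\<^const>\<open>genideal\<close> is the two-sided ideal generated by a set.\<close>

definition sklyanin_ideal :: "'k::field \<times> 'k \<times> 'k \<Rightarrow> 'k free_alg set" where
  "sklyanin_ideal s = genideal free_ring (sklyanin_relations s)"

definition sklyanin :: "'k::field \<times> 'k \<times> 'k \<Rightarrow> 'k free_alg set ring" where
  "sklyanin s = free_ring Quot sklyanin_ideal s"

definition sklyanin_class :: "'k::field \<times> 'k \<times> 'k \<Rightarrow> 'k free_alg \<Rightarrow> 'k free_alg set" where
  "sklyanin_class s f = sklyanin_ideal s +>\<^bsub>free_ring\<^esub> f"

definition sklyanin_component :: "'k::field \<times> 'k \<times> 'k \<Rightarrow> nat \<Rightarrow> 'k free_alg set set" where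
  "sklyanin_component s n = sklyanin_class s ` homogeneous n"

text \<open>
  Isomorphism of graded algebras. A unital ring homomorphism is linear over the ground field
  exactly when it respects the structure maps \<open>c \<mapsto> c \<cdot> 1\<close>.
\<close>

definition sklyanin_isomorphic :: "'k::field \<times> 'k \<times> 'k \<Rightarrow> 'k \<times> 'k \<times> 'k \<Rightarrow> bool" where
  "sklyanin_isomorphic s t \<longleftrightarrow>
     (\<exists>\<phi> \<in> ring_iso (sklyanin s) (sklyanin t).
        (\<forall>c. \<phi> (sklyanin_class s (scal c)) = sklyanin_class t (scal c)) \<and>
        (\<forall>n. \<phi> ` sklyanin_component s n = sklyanin_component t n))"

definition paramM :: "('k::field \<times> 'k) set" where
  "paramM = {(a, b). (a, b) \<noteq> (0, 0) \<and> (a + b)^3 + 1 \<noteq> 0 \<and> (a^3 - 1, b^3 - 1) \<noteq> (0, 0)}"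

definition scale_map :: "'k::field \<Rightarrow> 'k \<times> 'k \<Rightarrow> 'k \<times> 'k" where
  "scale_map \<theta> = (\<lambda>(a, b) \<in> paramM. (\<theta> * a, \<theta> * b))"

definition fourier_map :: "'k::field \<Rightarrow> 'k \<times> 'k \<Rightarrow> 'k \<times> 'k" where
  "fourier_map \<theta> = (\<lambda>(a, b) \<in> paramM.
     ((\<theta> * a + \<theta>^2 * b + 1) / (a + b + 1), (\<theta>^2 * a + \<theta> * b + 1) / (a + b + 1)))"

text \<open>
  The group of permutations of \<^const>\<open>paramM\<close> generated by the two maps. Note that
  \<^const>\<open>subgroup_generated\<close> ignores generators outside the carrier of the ambient group, so it
  has the intended meaning only because the two maps are permutations of \<^const>\<open>paramM\<close>.
\<close>

definition sklyanin_group :: "'k::field \<Rightarrow> ('k \<times> 'k \<Rightarrow> 'k \<times> 'k) monoid" where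
  "sklyanin_group \<theta> = subgroup_generated (BijGroup paramM) {scale_map \<theta>, fourier_map \<theta>}"

text \<open>The numeral type \<^typ>\<open>3\<close> is the ring of integers modulo 3.\<close>

definition SL2_Z3 :: "(3^2^2) monoid" where
  "SL2_Z3 = \<lparr>carrier = {A. det A = 1}, mult = (**), one = mat 1\<rparr>"

text \<open>A polynomial in \<open>a, b\<close> is an element of \<open>K[a][b]\<close>.\<close>

definition poly2 :: "'k::field poly poly \<Rightarrow> 'k \<times> 'k \<Rightarrow> 'k" where
  "poly2 F = (\<lambda>(a, b). poly (poly F [:b:]) a)"

definition zariski_closed :: "('k::field \<times> 'k) set \<Rightarrow> bool" where
  "zariski_closed Z \<longleftrightarrow> (\<exists>I. Z = {u. \<forall>F\<in>I. poly2 F u = 0})"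

text \<open>
  Genericity on \<open>S\<close>: validity on a nonempty relatively Zariski open subset of \<open>S\<close>. This is the usual
  notion for irreducible \<open>S\<close>, where such subsets are dense. It is applied below to
  \<^const>\<open>paramM\<close> over an infinite field, which is a nonempty Zariski open subset of the irreducible
  affine plane.
\<close>

definition generic_on :: "('k::field \<times> 'k) set \<Rightarrow> ('k \<times> 'k \<Rightarrow> bool) \<Rightarrow> bool" where
  "generic_on S P \<longleftrightarrow> (\<exists>Z. zariski_closed Z \<and> S - Z \<noteq> {} \<and> (\<forall>u \<in> S - Z. P u))"

definition pairs_i :: "'k::field \<Rightarrow> 'k \<times> 'k \<Rightarrow> ('k \<times> 'k) set" where
  "pairs_i \<theta> = (\<lambda>(a, b). {(\<theta>^j * a, \<theta>^j * b) | j::nat. j \<in> {0, 1, 2}})"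

definition pairs_ii :: "'k::field \<Rightarrow> 'k \<times> 'k \<Rightarrow> ('k \<times> 'k) set" where
  "pairs_ii \<theta> = (\<lambda>(a, b). {(\<theta>^j * b, \<theta>^j * a) | j::nat. j \<in> {0, 1, 2}})"

text \<open>
  The constant term of the numerators has to be \<open>\<theta>\<^bsup>m+n\<^esup>\<close>. With \<open>\<theta>\<^bsup>m\<^esup>\<close> in its place the pairs
  with \<open>n \<noteq> 0\<close> are wrong: already applying \<^const>\<open>fourier_map\<close> after \<^const>\<open>scale_map\<close> gives the
  constant \<open>\<theta>\<^sup>2\<close> with \<open>j = 1\<close>, \<open>k = 2\<close>, \<open>n = 2\<close>, that is \<open>m = 0\<close>.
\<close>

definition pairs_iii :: "'k::field \<Rightarrow> 'k \<times> 'k \<Rightarrow> ('k \<times> 'k) set" where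
  "pairs_iii \<theta> = (\<lambda>(a, b).
     {((\<theta>^j * a + \<theta>^k * b + \<theta>^(m + n)) / (a + b + \<theta>^n),
       (\<theta>^k * a + \<theta>^j * b + \<theta>^(m + n)) / (a + b + \<theta>^n))
      | j k m n :: nat. n \<in> {0, 1, 2} \<and> {j, k, m} = {0, 1, 2}})"

end

theory Submission
  imports Defs
begin

text \<open>
  A graded isomorphism is a linear substitution \<open>g\<close> that maps the space of relations \<open>R\<close> of one
  algebra onto that of the other; let \<open>V\<close> be the span of \<open>x, y, z\<close>. The tensors in
  \<open>V \<otimes> R \<inter> R \<otimes> V\<close> are the multiples of the potential when the parameters lie in \<open>M\<close>, so \<open>g\<close> maps
  one potential to a multiple of the other. Then \<open>g\<close> preserves up to scalars two cubics: the
  symmetrised potential \<open>x\<^sup>3 + y\<^sup>3 + z\<^sup>3 + 3 (a + b) xyz\<close> and the determinant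
  \<open>(1 + a\<^sup>3 + b\<^sup>3) xyz - ab (x\<^sup>3 + y\<^sup>3 + z\<^sup>3)\<close>. They are linearly independent exactly because
  \<open>(a + b)\<^sup>3 + 1 \<noteq> 0\<close>, hence \<open>g\<close> preserves the Hesse pencil and maps the triangle \<open>xyz\<close> to one of
  the triangles of the pencil. This leaves finitely many \<open>g\<close> up to scalars, which give precisely
  the listed pairs.

  For the group, an explicit action of \<open>SL\<^sub>2(\<int>\<^sub>3)\<close> sends two generators to the two given maps. A
  point \<open>(a, b)\<close> of \<open>M\<close> with \<open>a \<noteq> b\<close> has trivial stabiliser, which yields both faithfulness and
  the generic count \<open>24\<close>.
\<close>

section \<open>The trilinear form of the potential\<close>

text \<open>Contracting the first slot of the trilinear form with a vector u leaves a 3x3 matrix on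
  which g acts by congruence. Its determinant is therefore a second cubic covariant, with multiplier
  \<open>det3 g ^ 2\<close>; this is the origin of the cubic with coefficients 1 + a^3 + b^3 and
  -ab. With respect to x^3 + y^3 + z^3 and xyz the two cubics have determinant 1 + a^3 + b^3 + 3 a b
  (a + b) = (a + b)^3 + 1. The field may be finite and need not be algebraically closed. Triangles
  of the pencil are therefore recognised by restriction to the coordinate lines, where only cubics
  in one variable are compared. A triangle other than xyz makes g a discrete Fourier matrix up to
  diagonal factors, which explains the fractional maps; the triangle xyz makes g monomial, which
  explains dilations and the swap. All parameters that arise are cube roots of unity; they are later
  read as elements of Z_3 and as the exponents of the list. Over the field with four elements M is
  empty, so the order of the group is computed for nonempty M.\<close>

lemma UNIV_letter: "UNIV = {Lx, Ly, Lz}"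
  using letter.exhaust by auto

instance letter :: finite
  by standard (simp add: UNIV_letter)

lemma sum_letter: "(\<Sum>i\<in>UNIV. f i) = f Lx + f Ly + f Lz"
  for f :: "letter \<Rightarrow> 'a::comm_monoid_add"
  by (simp add: UNIV_letter add.assoc)

definition delta :: "letter \<Rightarrow> letter \<Rightarrow> 'k::field" where
  "delta i j = (if i = j then 1 else 0)"

text \<open>
  \<open>trilin a b\<close> is the cyclically invariant tensor
  \<open>a (xyz + yzx + zxy) + b (xzy + zyx + yxz) + xxx + yyy + zzz\<close>; the defining relations of
  \<open>Q\<^bsup>a,b,1\<^esup>\<close> are its three slices \<open>potential a b p\<close>.
\<close>

definition trilin :: "'k \<Rightarrow> 'k \<Rightarrow> (letter \<Rightarrow> 'k) \<Rightarrow> (letter \<Rightarrow> 'k) \<Rightarrow> (letter \<Rightarrow> 'k::field) \<Rightarrow> 'k" where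
  "trilin a b u v w = u Lx * v Lx * w Lx + u Ly * v Ly * w Ly + u Lz * v Lz * w Lz
     + a * (u Lx * v Ly * w Lz + u Ly * v Lz * w Lx + u Lz * v Lx * w Ly)
     + b * (u Lx * v Lz * w Ly + u Lz * v Ly * w Lx + u Ly * v Lx * w Lz)"

definition potential :: "'k \<Rightarrow> 'k \<Rightarrow> letter \<Rightarrow> letter \<Rightarrow> letter \<Rightarrow> 'k::field" where
  "potential a b i j k = trilin a b (delta i) (delta j) (delta k)"

definition mat_vec :: "(letter \<Rightarrow> letter \<Rightarrow> 'k) \<Rightarrow> (letter \<Rightarrow> 'k) \<Rightarrow> letter \<Rightarrow> 'k::field" where
  "mat_vec g u i = (\<Sum>j\<in>UNIV. g i j * u j)"

definition mat_mat :: "(letter \<Rightarrow> letter \<Rightarrow> 'k) \<Rightarrow> (letter \<Rightarrow> letter \<Rightarrow> 'k) \<Rightarrow> letter \<Rightarrow> letter \<Rightarrow> 'k::field" where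
  "mat_mat g h i k = (\<Sum>j\<in>UNIV. g i j * h j k)"

definition det3 :: "(letter \<Rightarrow> letter \<Rightarrow> 'k::field) \<Rightarrow> 'k" where
  "det3 m = m Lx Lx * (m Ly Ly * m Lz Lz - m Ly Lz * m Lz Ly)
          - m Lx Ly * (m Ly Lx * m Lz Lz - m Ly Lz * m Lz Lx)
          + m Lx Lz * (m Ly Lx * m Lz Ly - m Ly Ly * m Lz Lx)"

lemma det3_mat_mat: "det3 (mat_mat g h) = det3 g * det3 h"
  unfolding det3_def mat_mat_def sum_letter by (simp add: algebra_simps)

lemma det3_transpose: "det3 (\<lambda>i j. g j i) = det3 g"
  unfolding det3_def by (simp add: algebra_simps power3_eq_cube)

lemma det3_delta: "det3 delta = 1"
  by (simp add: det3_def delta_def)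

lemma det3_scale: "det3 (\<lambda>i j. c * g i j) = c ^ 3 * det3 g"
  unfolding det3_def by (simp add: algebra_simps power3_eq_cube)

lemma trilin_expand:
  "trilin a b u v w = (\<Sum>i\<in>UNIV. \<Sum>j\<in>UNIV. \<Sum>k\<in>UNIV. u i * v j * w k * potential a b i j k)"
  unfolding sum_letter potential_def by (simp add: trilin_def delta_def algebra_simps)

lemma trilin_mat_vec:
  "trilin a b (mat_vec g u) v w = (\<Sum>i\<in>UNIV. u i * trilin a b (\<lambda>k. g k i) v w)"
  unfolding sum_letter mat_vec_def trilin_def by (simp add: algebra_simps)

text \<open>The columns of \<open>g\<close> are the images of the basis vectors, so the hypothesis
  compares the two forms on basis vectors; trilinearity does the rest.\<close>

lemma trilin_mat_vec_all:
  assumes "\<And>p q r. trilin a b (\<lambda>i. g i p) (\<lambda>i. g i q) (\<lambda>i. g i r) = l * potential a' b' p q r"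
  shows "trilin a b (mat_vec g u) (mat_vec g v) (mat_vec g w) = l * trilin a' b' u v w"
proof -
  have 1: "trilin a b (mat_vec g u) (mat_vec g v) (mat_vec g w) =
    (\<Sum>i\<in>UNIV. \<Sum>j\<in>UNIV. \<Sum>k\<in>UNIV. u i * v j * w k * trilin a b (\<lambda>m. g m i) (\<lambda>m. g m j) (\<lambda>m. g m k))"
    unfolding sum_letter mat_vec_def trilin_def by (simp add: algebra_simps)
  show ?thesis
    unfolding 1 assms by (simp add: trilin_expand sum_distrib_left mult_ac)
qed

lemma det3_trilin:
  "det3 (\<lambda>j k. trilin a b u (delta j) (delta k)) =
     (1 + a ^ 3 + b ^ 3) * (u Lx * u Ly * u Lz) - a * b * (u Lx ^ 3 + u Ly ^ 3 + u Lz ^ 3)"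
  by (simp add: det3_def trilin_def delta_def algebra_simps power3_eq_cube)

lemma trilin_congruence:
  "(\<lambda>j k. trilin a b u (\<lambda>i. g i j) (\<lambda>i. g i k)) =
     mat_mat (\<lambda>i j. g j i) (mat_mat (\<lambda>j k. trilin a b u (delta j) (delta k)) g)"
  unfolding mat_mat_def sum_letter by (intro ext) (simp add: trilin_def delta_def algebra_simps)

definition cubes_sum :: "(letter \<Rightarrow> 'k::field) \<Rightarrow> 'k" where
  "cubes_sum u = u Lx ^ 3 + u Ly ^ 3 + u Lz ^ 3"

definition coords_prod :: "(letter \<Rightarrow> 'k::field) \<Rightarrow> 'k" where
  "coords_prod u = u Lx * u Ly * u Lz"

lemma trilin_diag: "trilin a b u u u = cubes_sum u + 3 * (a + b) * coords_prod u"
  by (simp add: trilin_def cubes_sum_def coords_prod_def algebra_simps power3_eq_cube)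

text \<open>Both covariants, evaluated at the image of u, give two linear equations for its
  \<open>cubes_sum\<close> and \<open>coords_prod\<close>; their determinant is (a + b)^3 +
  1.\<close>

lemma pencil_preserved:
  fixes g :: "letter \<Rightarrow> letter \<Rightarrow> 'k::field"
  assumes T: "\<And>p q r. trilin a b (\<lambda>i. g i p) (\<lambda>i. g i q) (\<lambda>i. g i r) = l * potential a' b' p q r"
    and ab: "(a + b) ^ 3 + 1 \<noteq> 0" and g: "det3 g \<noteq> 0"
  shows "\<exists>\<alpha> \<beta>. \<forall>u. coords_prod (mat_vec g u) = \<alpha> * cubes_sum u + \<beta> * coords_prod u" (is ?X)
    and "\<exists>\<alpha> \<beta>. \<forall>u. cubes_sum (mat_vec g u) = \<alpha> * cubes_sum u + \<beta> * coords_prod u" (is ?C)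
proof -
  define d where "d = det3 g ^ 2"
  have d: "d \<noteq> 0" using g by (simp add: d_def)
  define s where "s = (a + b) ^ 3 + 1"
  have F: "cubes_sum (mat_vec g u) + 3 * (a + b) * coords_prod (mat_vec g u) = l * (cubes_sum u + 3 * (a' + b') * coords_prod u)" for u
    using trilin_mat_vec_all[of a b g, OF T, of u u u] by (simp add: trilin_diag)
  have D: "d * ((1 + a ^ 3 + b ^ 3) * coords_prod (mat_vec g u) - a * b * cubes_sum (mat_vec g u)) =
      l ^ 3 * ((1 + a' ^ 3 + b' ^ 3) * coords_prod u - a' * b' * cubes_sum u)" for u
  proof -
    have "trilin a b (mat_vec g u) (\<lambda>i. g i j) (\<lambda>i. g i k) = l * trilin a' b' u (delta j) (delta k)" for j k
    proof -
      have "mat_vec g (delta m) = (\<lambda>i. g i m)" for m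
        by (cases m) (simp_all add: mat_vec_def sum_letter delta_def fun_eq_iff)
      then show ?thesis
        using trilin_mat_vec_all[of a b g, OF T, of u "delta j" "delta k"] by simp
    qed
    then have "mat_mat (\<lambda>i j. g j i) (mat_mat (\<lambda>j k. trilin a b (mat_vec g u) (delta j) (delta k)) g) =
        (\<lambda>j k. l * trilin a' b' u (delta j) (delta k))"
      by (simp flip: trilin_congruence)
    then have "det3 (mat_mat (\<lambda>i j. g j i) (mat_mat (\<lambda>j k. trilin a b (mat_vec g u) (delta j) (delta k)) g)) =
        det3 (\<lambda>j k. l * trilin a' b' u (delta j) (delta k))"
      by (rule arg_cong)
    then have "det3 g * (((1 + a ^ 3 + b ^ 3) * coords_prod (mat_vec g u) - a * b * cubes_sum (mat_vec g u)) * det3 g) =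
      l ^ 3 * ((1 + a' ^ 3 + b' ^ 3) * coords_prod u - a' * b' * cubes_sum u)"
      unfolding det3_mat_mat det3_transpose[of g] det3_scale det3_trilin cubes_sum_def coords_prod_def .
    then show ?thesis
      by (simp only: d_def power2_eq_square mult_ac)
  qed
  have X: "coords_prod (mat_vec g u) =
      ((a * b * l - l ^ 3 / d * (a' * b')) / s) * cubes_sum u
      + ((l ^ 3 / d * (1 + a' ^ 3 + b' ^ 3) + a * b * (l * (3 * (a' + b')))) / s) * coords_prod u" for u
  proof -
    define x where "x = coords_prod (mat_vec g u)"
    define c where "c = cubes_sum (mat_vec g u)"
    define p where "p = l ^ 3 / d * ((1 + a' ^ 3 + b' ^ 3) * coords_prod u - a' * b' * cubes_sum u)"
    define q where "q = l * (cubes_sum u + 3 * (a' + b') * coords_prod u)"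
    have "p = (1 + a ^ 3 + b ^ 3) * x - a * b * c"
      using D[of u] d unfolding x_def c_def p_def by (simp add: field_simps)
    moreover have "q = c + 3 * (a + b) * x"
      using F[of u] unfolding x_def c_def q_def by simp
    \<comment> \<open>Cramer's rule: after elimination of c the coefficient of x is 1 + a^3 + b^3 +
      3 a b (a + b).\<close>
    ultimately have "s * x = p + a * b * q"
      unfolding s_def by (simp add: algebra_simps power3_eq_cube)
    then have "x = (p + a * b * q) / s"
      using ab by (metis nonzero_mult_div_cancel_left s_def)
    then show ?thesis unfolding x_def p_def q_def
      by (simp add: add_divide_distrib diff_divide_distrib algebra_simps)
  qed
  then show ?X by blast
  then obtain \<alpha> \<beta> where "\<And>u. coords_prod (mat_vec g u) = \<alpha> * cubes_sum u + \<beta> * coords_prod u" by blast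
  then have "cubes_sum (mat_vec g u) = (l - 3 * (a + b) * \<alpha>) * cubes_sum u
      + (l * 3 * (a' + b') - 3 * (a + b) * \<beta>) * coords_prod u" for u
    using F[of u] by (simp add: algebra_simps)
  then show ?C by blast
qed

section \<open>Linear maps between potentials\<close>

locale cube_root =
  fixes \<theta> :: "'k::field"
  assumes char: "CHAR('k) \<noteq> 3" and cube: "\<theta> ^ 3 = 1" and ne1: "1 \<noteq> \<theta>"
begin

lemma three_ne_0: "(3::'k) \<noteq> 0"
proof
  assume "(3::'k) = 0"
  then have "CHAR('k) dvd 3" using of_nat_eq_0_iff_char_dvd[where 'a='k, of 3] by simp
  moreover have "CHAR('k) \<noteq> 1" by simp
  moreover have "Factorial_Ring.prime (3::nat)" by simp
  ultimately show False using char by (metis prime_nat_iff)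
qed

lemma theta_sum: "\<theta> ^ 2 + \<theta> + 1 = 0"
proof -
  have "(\<theta> - 1) * (\<theta> ^ 2 + \<theta> + 1) = 0"
    using cube by (simp add: algebra_simps power2_eq_square power3_eq_cube)
  then show ?thesis using ne1 by simp
qed

lemma theta_ne_0: "\<theta> \<noteq> 0"
  using cube by auto

lemma cube_root_cases:
  assumes "x ^ 3 = 1"
  obtains "x = 1" | "x = \<theta>" | "x = \<theta> ^ 2"
proof -
  have "(x - 1) * (x - \<theta>) * (x - \<theta> ^ 2) = x ^ 3 - 1"
    using theta_sum by Groebner_Basis.algebra
  then have "(x - 1) * (x - \<theta>) * (x - \<theta> ^ 2) = 0" using assms by simp
  then show ?thesis using that by auto
qed

lemma primitive_cases:
  assumes "x ^ 3 = 1" "x \<noteq> 1"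
  obtains "x = \<theta>" | "x = \<theta> ^ 2"
  using assms cube_root_cases by metis

text \<open>Conjugation symmetry: facts about \<theta> can be instantiated with the other primitive
  cube root.\<close>

lemma cube_root_pow2: "cube_root (\<theta> ^ 2)"
proof
  have "(\<theta> ^ 2) ^ 3 = (\<theta> ^ 3) ^ 2" by (simp flip: power_mult)
  then show "(\<theta> ^ 2) ^ 3 = 1" using cube by simp
  show "1 \<noteq> \<theta> ^ 2" using cube ne1 by (auto simp: power3_eq_cube power2_eq_square)
qed (rule char)

text \<open>The hypotheses say that the discrete Fourier transform of (x, y, z) vanishes; it is
  invertible because 3 is nonzero and \<theta> is primitive.\<close>

lemma vandermonde:
  assumes "x + y + z = 0" "x + \<theta> * y + \<theta> ^ 2 * z = 0" "x + \<theta> ^ 2 * y + \<theta> * z = 0"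
  shows "x = 0 \<and> y = 0 \<and> z = 0"
proof -
  have t: "1 + \<theta> + \<theta> ^ 2 = 0" using theta_sum by (simp add: algebra_simps)
  have "3 * x = (x + y + z) + (x + \<theta> * y + \<theta> ^ 2 * z) + (x + \<theta> ^ 2 * y + \<theta> * z)
       - (y + z) * (1 + \<theta> + \<theta> ^ 2)"
    by (simp add: algebra_simps)
  then have x: "x = 0" using assms t three_ne_0 by simp
  have z: "z = - y" using assms(1) x by (simp add: add_eq_0_iff)
  have "\<theta> * ((1 - \<theta>) * y) = 0"
    using assms(2) x z by (simp add: algebra_simps power2_eq_square)
  then have "(1 - \<theta>) * y = 0" using theta_ne_0 by simp
  then have y: "y = 0" using ne1 by simp
  then show ?thesis using x z by simp
qed

end

section \<open>Cubics on coordinate lines and the triangles of the Hesse pencil\<close>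

context cube_root
begin

text \<open>
  \<open>0, 1, \<theta>, \<theta>\<^sup>2\<close> are four distinct points, so a cubic polynomial that vanishes as a function is zero
  even when the field is finite; identities between polynomial functions therefore suffice below.
\<close>

lemma cubic_coeffs:
  fixes c0 c1 c2 c3 :: 'k
  assumes "\<And>t. c0 + c1 * t + c2 * t ^ 2 + c3 * t ^ 3 = 0"
  shows "c0 = 0" "c1 = 0" "c2 = 0" "c3 = 0"
proof -
  show c0: "c0 = 0" using assms[of 0] by simp
  have "c3 + c1 + c2 = 0" using assms[of 1] c0 by (simp add: algebra_simps)
  moreover have "c3 + \<theta> * c1 + \<theta> ^ 2 * c2 = 0"
    using assms[of \<theta>] c0 cube by (simp add: algebra_simps)
  moreover have "c3 + \<theta> ^ 2 * c1 + \<theta> * c2 = 0"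
    using assms[of "\<theta> ^ 2"] c0 cube by Groebner_Basis.algebra
  ultimately have "c3 = 0 \<and> c1 = 0 \<and> c2 = 0" by (rule vandermonde)
  then show "c1 = 0" "c2 = 0" "c3 = 0" by auto
qed

lemma linear_product_coeffs:
  fixes p1 q1 p2 q2 p3 q3 \<alpha> :: 'k
  assumes "\<And>t. (p1 + q1 * t) * (p2 + q2 * t) * (p3 + q3 * t) = \<alpha> * (1 + t ^ 3)"
  shows "p1 * p2 * p3 = \<alpha>" "q1 * q2 * q3 = \<alpha>"
    "p1 * p2 * q3 + p1 * q2 * p3 + q1 * p2 * p3 = 0"
    "p1 * q2 * q3 + q1 * p2 * q3 + q1 * q2 * p3 = 0"
proof -
  have *: "(p1 * p2 * p3 - \<alpha>) + (p1 * p2 * q3 + p1 * q2 * p3 + q1 * p2 * p3) * t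
      + (p1 * q2 * q3 + q1 * p2 * q3 + q1 * q2 * p3) * t ^ 2 + (q1 * q2 * q3 - \<alpha>) * t ^ 3 = 0" for t
    using assms[of t] by (simp add: algebra_simps power2_eq_square power3_eq_cube)
  note c = cubic_coeffs[OF *]
  show "p1 * p2 * p3 = \<alpha>" using c(1) by simp
  show "q1 * q2 * q3 = \<alpha>" using c(4) by simp
  show "p1 * p2 * q3 + p1 * q2 * p3 + q1 * p2 * p3 = 0" by (fact c(2))
  show "p1 * q2 * q3 + q1 * p2 * q3 + q1 * q2 * p3 = 0" by (fact c(3))
qed

lemma linear_product_zero:
  fixes p1 q1 p2 q2 p3 q3 :: 'k
  assumes "\<And>t. (p1 + q1 * t) * (p2 + q2 * t) * (p3 + q3 * t) = 0"
  shows "(p1 = 0 \<and> q1 = 0) \<or> (p2 = 0 \<and> q2 = 0) \<or> (p3 = 0 \<and> q3 = 0)"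
  using linear_product_coeffs[of p1 q1 p2 q2 p3 q3 0] assms by auto

text \<open>Dividing by the product of the p's leaves factors 1 + m t, 1 + m' t, 1 + m'' t with
  product 1 + t^3. The elementary symmetric functions of m, m', m'' are thus 0, 0, 1, so these are
  the three cube roots of unity, and \<omega> records their order.\<close>

lemma linear_product_ratios:
  fixes p1 q1 p2 q2 p3 q3 \<alpha> :: 'k
  assumes "\<And>t. (p1 + q1 * t) * (p2 + q2 * t) * (p3 + q3 * t) = \<alpha> * (1 + t ^ 3)" and "\<alpha> \<noteq> 0"
  obtains m \<omega> where "m ^ 3 = 1" "\<omega> ^ 3 = 1" "\<omega> \<noteq> 1"
    "q1 = p1 * m" "q2 = p2 * (m * \<omega>)" "q3 = p3 * (m * \<omega> ^ 2)"
proof -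
  note c = linear_product_coeffs[OF assms(1)]
  have nz: "p1 \<noteq> 0" "p2 \<noteq> 0" "p3 \<noteq> 0" using c(1) assms(2) by auto
  define m where "m = q1 / p1"
  define m' where "m' = q2 / p2"
  define m'' where "m'' = q3 / p3"
  have q: "q1 = p1 * m" "q2 = p2 * m'" "q3 = p3 * m''"
    using nz by (simp_all add: m_def m'_def m''_def)
  have "\<alpha> * (m + m' + m'') = 0" "\<alpha> * (m * m' + m * m'' + m' * m'') = 0" "\<alpha> * (m * m' * m'' - 1) = 0"
    using c(3,4,2) unfolding c(1)[symmetric] q by (simp_all add: algebra_simps)
  then have e: "m + m' + m'' = 0" "m * m' + m * m'' + m' * m'' = 0" "m * m' * m'' = 1"
    using assms(2) by simp_all
  have m3: "m ^ 3 = 1" using e by Groebner_Basis.algebra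
  have m'3: "m' ^ 3 = 1" using e by Groebner_Basis.algebra
  have m0: "m \<noteq> 0" using e(3) by auto
  define \<omega> where "\<omega> = m' / m"
  have w: "m' = m * \<omega>" using m0 by (simp add: \<omega>_def)
  have "m ^ 2 * (1 + \<omega> + \<omega> ^ 2) = 0" using e(1,2) unfolding w by Groebner_Basis.algebra
  then have w2: "1 + \<omega> + \<omega> ^ 2 = 0" using m0 by simp
  have "\<omega> ^ 3 = 1" using w2 by Groebner_Basis.algebra
  moreover have "\<omega> \<noteq> 1" using w2 three_ne_0 by auto
  moreover have "m'' = m * \<omega> ^ 2" using e(1) w w2 by Groebner_Basis.algebra
  ultimately show ?thesis using that m3 q w by blast
qed

lemma omega_sum:
  assumes "\<omega> ^ 3 = (1::'k)" "\<omega> \<noteq> 1"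
  shows "1 + \<omega> + \<omega> ^ 2 = 0"
proof -
  have "(\<omega> - 1) * (1 + \<omega> + \<omega> ^ 2) = 0"
    using assms(1) by (simp add: algebra_simps power2_eq_square power3_eq_cube)
  then show ?thesis using assms(2) by simp
qed

text \<open>
  The three rows of \<open>g\<close> are the sides of a triangle in the Hesse pencil; for \<open>\<alpha> \<noteq> 0\<close> it is not the
  coordinate triangle, and every restriction to a coordinate line is a multiple of \<open>1 + t\<^sup>3\<close>.
\<close>

lemma hesse_triangle:
  fixes g :: "letter \<Rightarrow> letter \<Rightarrow> 'k"
  assumes X: "\<And>u. coords_prod (mat_vec g u) = \<alpha> * cubes_sum u + \<beta> * coords_prod u" and "\<alpha> \<noteq> 0"
  obtains m n \<omega> where "m ^ 3 = 1" "n ^ 3 = 1" "\<omega> ^ 3 = 1" "\<omega> \<noteq> 1" "g Lx Lx * g Ly Lx * g Lz Lx = \<alpha>"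
    "g Lx Ly = g Lx Lx * m" "g Ly Ly = g Ly Lx * (m * \<omega>)" "g Lz Ly = g Lz Lx * (m * \<omega> ^ 2)"
    "g Lx Lz = g Lx Lx * n" "g Ly Lz = g Ly Lx * (n * \<omega> ^ 2)" "g Lz Lz = g Lz Lx * (n * \<omega>)"
proof -
  have xy: "(g Lx Lx + g Lx Ly * t) * (g Ly Lx + g Ly Ly * t) * (g Lz Lx + g Lz Ly * t) = \<alpha> * (1 + t ^ 3)" for t
    using X[of "\<lambda>i. case i of Lx \<Rightarrow> 1 | Ly \<Rightarrow> t | Lz \<Rightarrow> 0"]
    by (simp add: coords_prod_def cubes_sum_def mat_vec_def sum_letter)
  have xz: "(g Lx Lx + g Lx Lz * t) * (g Ly Lx + g Ly Lz * t) * (g Lz Lx + g Lz Lz * t) = \<alpha> * (1 + t ^ 3)" for t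
    using X[of "\<lambda>i. case i of Lx \<Rightarrow> 1 | Ly \<Rightarrow> 0 | Lz \<Rightarrow> t"]
    by (simp add: coords_prod_def cubes_sum_def mat_vec_def sum_letter)
  have yz: "(g Lx Ly + g Lx Lz * t) * (g Ly Ly + g Ly Lz * t) * (g Lz Ly + g Lz Lz * t) = \<alpha> * (1 + t ^ 3)" for t
    using X[of "\<lambda>i. case i of Lx \<Rightarrow> 0 | Ly \<Rightarrow> 1 | Lz \<Rightarrow> t"]
    by (simp add: coords_prod_def cubes_sum_def mat_vec_def sum_letter)
  from linear_product_ratios[OF xy \<open>\<alpha> \<noteq> 0\<close>] obtain m \<omega> where m: "m ^ 3 = 1" "\<omega> ^ 3 = 1" "\<omega> \<noteq> 1"
    "g Lx Ly = g Lx Lx * m" "g Ly Ly = g Ly Lx * (m * \<omega>)" "g Lz Ly = g Lz Lx * (m * \<omega> ^ 2)" .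
  from linear_product_ratios[OF xz \<open>\<alpha> \<noteq> 0\<close>] obtain n \<upsilon> where n: "n ^ 3 = 1" "\<upsilon> ^ 3 = 1" "\<upsilon> \<noteq> 1"
    "g Lx Lz = g Lx Lx * n" "g Ly Lz = g Ly Lx * (n * \<upsilon>)" "g Lz Lz = g Lz Lx * (n * \<upsilon> ^ 2)" .
  from linear_product_ratios[OF yz \<open>\<alpha> \<noteq> 0\<close>] obtain k \<rho> where k: "k ^ 3 = 1" "\<rho> ^ 3 = 1" "\<rho> \<noteq> 1"
    "g Lx Lz = g Lx Ly * k" "g Ly Lz = g Ly Ly * (k * \<rho>)" "g Lz Lz = g Lz Ly * (k * \<rho> ^ 2)" .
  have \<alpha>: "g Lx Lx * g Ly Lx * g Lz Lx = \<alpha>" using linear_product_coeffs(1)[OF xy] .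
  then have nz: "g Lx Lx \<noteq> 0" "g Ly Lx \<noteq> 0" "g Lz Lx \<noteq> 0" using \<open>\<alpha> \<noteq> 0\<close> by auto
  have nz': "m \<noteq> 0" "k \<noteq> 0" "\<omega> \<noteq> 0" using m(1,2) k(1) by auto
  have nmk: "n = m * k" using n(4) k(4) m(4) nz by simp
  have "n * \<upsilon> = m * \<omega> * (k * \<rho>)" using n(5) k(5) m(5) nz by (simp add: mult.assoc)
  \<comment> \<open>Passing from column y to column z multiplies the row ratios by k, k\<rho>,
    k\<rho>^2. Since \<rho> \<noteq> 1, column z cannot carry the same \<omega> as column y, and the
    only other primitive cube root is \<omega>^2.\<close>
  then have "\<upsilon> = \<omega> * \<rho>" using nmk nz' by (simp add: algebra_simps)
  moreover have "1 + \<omega> + \<omega> ^ 2 = 0" "1 + \<rho> + \<rho> ^ 2 = 0" using m k omega_sum by auto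
  ultimately have "\<upsilon> \<noteq> \<omega>" "(\<upsilon> - \<omega>) * (\<upsilon> - \<omega> ^ 2) = 0" using k(3) nz'
    n(2,3) omega_sum[of \<upsilon>] m(2) by (simp, Groebner_Basis.algebra)
  then have "\<upsilon> = \<omega> ^ 2" by simp
  moreover have "(\<omega> ^ 2) ^ 2 = \<omega>" using m(2) by Groebner_Basis.algebra
  ultimately show ?thesis using that[of m n \<omega>] m n \<alpha> by simp
qed

text \<open>Both nontrivial Fourier coefficients of (x, y, z) vanish, so the triple is
  constant.\<close>

lemma equal_cubes:
  assumes "\<omega> ^ 3 = (1::'k)" "\<omega> \<noteq> 1" "x + \<omega> * y + \<omega> ^ 2 * z = 0" "x + \<omega> ^ 2 * y + \<omega> * z = 0"
  shows "x = y" "y = z"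
proof -
  have s: "1 + \<omega> + \<omega> ^ 2 = 0" using assms omega_sum by blast
  have "\<omega> \<noteq> 0" using assms(1) by auto
  have "\<omega> * (1 - \<omega>) * (y - z) = 0" using assms(3,4) by Groebner_Basis.algebra
  then show "y = z" using assms(2) \<open>\<omega> \<noteq> 0\<close> by simp
  then have "x - y = (x + \<omega> * y + \<omega> ^ 2 * z) - (1 + \<omega> + \<omega> ^ 2) * y"
    by (simp add: algebra_simps)
  then have "x - y = 0" unfolding assms(3) s by simp
  then show "x = y" by simp
qed

end

text \<open>The meeting point of the three descriptions: the linear algebra ends in this relation,
  and the group orbit and the explicit list are each compared with it. It uses arbitrary cube roots
  of unity because these are what the matrices g produce.\<close>

definition equivalent_params :: "'k::field \<times> 'k \<Rightarrow> 'k \<times> 'k \<Rightarrow> bool" where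
  "equivalent_params = (\<lambda>(a, b) (a', b').
     (\<exists>\<epsilon>. \<epsilon> ^ 3 = 1 \<and> ((a', b') = (\<epsilon> * a, \<epsilon> * b) \<or> (a', b') = (\<epsilon> * b, \<epsilon> * a))) \<or>
     (\<exists>\<kappa> \<eta> \<omega>. \<kappa> ^ 3 = 1 \<and> \<eta> ^ 3 = 1 \<and> \<omega> ^ 3 = 1 \<and> \<omega> \<noteq> 1 \<and>
        a' = \<kappa> * (\<omega> * a + \<omega> ^ 2 * b + \<eta>) / (a + b + \<eta>) \<and>
        b' = \<kappa> * (\<omega> ^ 2 * a + \<omega> * b + \<eta>) / (a + b + \<eta>)))"

section \<open>From a map of trilinear forms to the relation between the parameters\<close>

context cube_root
begin

text \<open>The triangle determines g up to the scalars c, c', c'' of its rows, and preservation of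
  the pencil forces these to have equal cubes. Evaluating the trilinear form on the columns of g
  then gives l, l a' and l b'.\<close>

lemma equivalent_params_triangle:
  fixes g :: "letter \<Rightarrow> letter \<Rightarrow> 'k"
  assumes T: "\<And>p q r. trilin a b (\<lambda>i. g i p) (\<lambda>i. g i q) (\<lambda>i. g i r) = l * potential a' b' p q r"
    and ab: "(a + b) ^ 3 + 1 \<noteq> 0"
    and X: "\<And>u. coords_prod (mat_vec g u) = \<alpha> * cubes_sum u + \<beta> * coords_prod u" and "\<alpha> \<noteq> 0"
    and C: "\<And>u. cubes_sum (mat_vec g u) = \<gamma> * cubes_sum u + \<delta> * coords_prod u"
  shows "equivalent_params (a, b) (a', b')"
proof -
  from hesse_triangle[OF X \<open>\<alpha> \<noteq> 0\<close>] obtain m n \<omega> where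
    r: "m ^ 3 = 1" "n ^ 3 = 1" "\<omega> ^ 3 = 1" "\<omega> \<noteq> 1" "g Lx Lx * g Ly Lx * g Lz Lx = \<alpha>"
    and g: "g Lx Ly = g Lx Lx * m" "g Ly Ly = g Ly Lx * (m * \<omega>)" "g Lz Ly = g Lz Lx * (m * \<omega> ^ 2)"
    "g Lx Lz = g Lx Lx * n" "g Ly Lz = g Ly Lx * (n * \<omega> ^ 2)" "g Lz Lz = g Lz Lx * (n * \<omega>)" .
  define c where "c = g Lx Lx"
  define c' where "c' = g Ly Lx"
  define c'' where "c'' = g Lz Lx"
  have nz: "c \<noteq> 0" "c' \<noteq> 0" "c'' \<noteq> 0" using r(5) \<open>\<alpha> \<noteq> 0\<close> unfolding c_def c'_def c''_def by auto
  note g' = g[folded c_def c'_def c''_def]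
  have w: "1 + \<omega> + \<omega> ^ 2 = 0" using r omega_sum by blast
  have m0: "m \<noteq> 0" "n \<noteq> 0" "\<omega> \<noteq> 0" using r by auto
  have C1: "(c + c * m * t) ^ 3 + (c' + c' * (m * \<omega>) * t) ^ 3 + (c'' + c'' * (m * \<omega> ^ 2) * t) ^ 3 = \<gamma> * (1 + t ^ 3)" for t
    using C[of "\<lambda>i. case i of Lx \<Rightarrow> 1 | Ly \<Rightarrow> t | Lz \<Rightarrow> 0"]
    by (simp add: coords_prod_def cubes_sum_def mat_vec_def sum_letter g c_def c'_def c''_def)
  have w6: "\<omega> ^ 4 = \<omega>" "\<omega> ^ 6 = 1" using r(3) by Groebner_Basis.algebra+
  have expand: "(x + x * y * t) ^ 3 = x ^ 3 + 3 * y * x ^ 3 * t + 3 * y ^ 2 * x ^ 3 * t ^ 2 + y ^ 3 * x ^ 3 * t ^ 3"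
    for x y t :: 'k
    by Groebner_Basis.algebra
  \<comment> \<open>The coefficients of t and t^2 contain the two nontrivial Fourier sums of the
    cubes of the row scalars; they vanish because 1 + t^3 has neither term.\<close>
  have C2: "(c ^ 3 + c' ^ 3 + c'' ^ 3 - \<gamma>) + (3 * m * (c ^ 3 + \<omega> * c' ^ 3 + \<omega> ^ 2 * c'' ^ 3)) * t
     + (3 * m ^ 2 * (c ^ 3 + \<omega> ^ 2 * c' ^ 3 + \<omega> * c'' ^ 3)) * t ^ 2
     + (c ^ 3 + c' ^ 3 + c'' ^ 3 - \<gamma>) * t ^ 3 = 0" for t
    using C1[of t] w6 r(1,3) unfolding expand
    by (simp add: power_mult_distrib flip: power_mult) (simp add: algebra_simps)
  have "c ^ 3 + \<omega> * c' ^ 3 + \<omega> ^ 2 * c'' ^ 3 = 0" "c ^ 3 + \<omega> ^ 2 * c' ^ 3 + \<omega> * c'' ^ 3 = 0"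
    using cubic_coeffs(2,3)[OF C2] three_ne_0 m0 by auto
  from equal_cubes[OF r(3,4) this] have cc: "c' ^ 3 = c ^ 3" "c'' ^ 3 = c ^ 3" by auto
  \<comment> \<open>Both c'/c and c''/c are cube roots of unity, so c c' c'' is c^3 up to a cube
    root of unity \<epsilon>. Its inverse \<eta> becomes the constant in the denominator of the new
    parameters.\<close>
  define \<epsilon> where "\<epsilon> = c * c' * c'' / c ^ 3"
  define \<eta> where "\<eta> = \<epsilon> ^ 2"
  have e: "c * c' * c'' = c ^ 3 * \<epsilon>" using nz by (simp add: \<epsilon>_def)
  have "(c * c' * c'') ^ 3 = (c ^ 3) ^ 3" unfolding power_mult_distrib cc by (simp add: power3_eq_cube)
  then have e3: "\<epsilon> ^ 3 = 1" using nz by (simp add: \<epsilon>_def power_divide)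
  then have eta: "\<eta> ^ 3 = 1" "\<epsilon> * \<eta> = 1" unfolding \<eta>_def by Groebner_Basis.algebra+
  have e0: "\<epsilon> \<noteq> 0" using e3 by auto
  have l: "l = c ^ 3 * 3 * \<epsilon> * (a + b + \<eta>)"
  proof -
    have "l = c ^ 3 + c' ^ 3 + c'' ^ 3 + 3 * (a + b) * (c * c' * c'')"
      using T[of Lx Lx Lx] unfolding potential_def trilin_diag by (simp add: cubes_sum_def coords_prod_def delta_def c_def c'_def c''_def)
    then show ?thesis unfolding cc e using eta(2) by Groebner_Basis.algebra
  qed
  have a': "l * a' = m * n * (c ^ 3 * 3 * \<epsilon>) * (\<omega> ^ 2 * a + \<omega> * b + \<eta>)"
  proof -
    have Ta: "l * a' = trilin a b (\<lambda>i. g i Lx) (\<lambda>i. g i Ly) (\<lambda>i. g i Lz)"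
      unfolding T by (simp add: potential_def trilin_def delta_def)
    have "l * a' = m * n * (c ^ 3 + c' ^ 3 * \<omega> ^ 3 + c'' ^ 3 * \<omega> ^ 3
         + (c * c' * c'') * (3 * a * \<omega> ^ 2 + b * (2 * \<omega> + \<omega> ^ 4)))"
      unfolding Ta trilin_def g' c_def[symmetric] c'_def[symmetric] c''_def[symmetric]
      by (simp add: algebra_simps eval_nat_numeral)
    then show ?thesis unfolding cc e using eta(2) r(3) by Groebner_Basis.algebra
  qed
  have b': "l * b' = m * n * (c ^ 3 * 3 * \<epsilon>) * (\<omega> * a + \<omega> ^ 2 * b + \<eta>)"
  proof -
    have Tb: "l * b' = trilin a b (\<lambda>i. g i Lx) (\<lambda>i. g i Lz) (\<lambda>i. g i Ly)"
      unfolding T by (simp add: potential_def trilin_def delta_def)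
    have "l * b' = m * n * (c ^ 3 + c' ^ 3 * \<omega> ^ 3 + c'' ^ 3 * \<omega> ^ 3
         + (c * c' * c'') * (3 * b * \<omega> ^ 2 + a * (2 * \<omega> + \<omega> ^ 4)))"
      unfolding Tb trilin_def g' c_def[symmetric] c'_def[symmetric] c''_def[symmetric]
      by (simp add: algebra_simps eval_nat_numeral)
    then show ?thesis unfolding cc e using eta(2) r(3) by Groebner_Basis.algebra
  qed
  have d0: "a + b + \<eta> \<noteq> 0"
  proof
    assume "a + b + \<eta> = 0"
    then have "(a + b) ^ 3 = - (\<eta> ^ 3)" by Groebner_Basis.algebra
    then show False using ab eta by simp
  qed
  let ?K = "c ^ 3 * 3 * \<epsilon>"
  have K0: "?K \<noteq> 0" using nz three_ne_0 e0 by simp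
  have "?K * ((a + b + \<eta>) * a') = ?K * (m * n * (\<omega> ^ 2 * a + \<omega> * b + \<eta>))"
    using a' unfolding l by (simp only: mult_ac)
  then have A: "a' = m * n * (\<omega> ^ 2 * a + \<omega> * b + \<eta>) / (a + b + \<eta>)"
    using K0 d0 by (metis mult_cancel_left nonzero_mult_div_cancel_left)
  have "?K * ((a + b + \<eta>) * b') = ?K * (m * n * (\<omega> * a + \<omega> ^ 2 * b + \<eta>))"
    using b' unfolding l by (simp only: mult_ac)
  then have B: "b' = m * n * (\<omega> * a + \<omega> ^ 2 * b + \<eta>) / (a + b + \<eta>)"
    using K0 d0 by (metis mult_cancel_left nonzero_mult_div_cancel_left)
  \<comment> \<open>The computed numerators have \<omega> and \<omega>^2 in the opposite places to
    \<open>equivalent_params\<close>, so the witness is \<omega>^2.\<close>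
  have w3: "(\<omega> ^ 2) ^ 3 = 1" "(\<omega> ^ 2) ^ 2 = \<omega>" using r(3) by Groebner_Basis.algebra+
  moreover have "\<omega> ^ 2 \<noteq> 1" using w3(2) r(4) by (metis one_power2)
  moreover have "(m * n) ^ 3 = 1" using r by (simp add: power_mult_distrib)
  ultimately have "\<exists>\<kappa> \<eta> \<omega>. \<kappa> ^ 3 = 1 \<and> \<eta> ^ 3 = 1 \<and> \<omega> ^ 3 = 1 \<and> \<omega> \<noteq> 1 \<and>
        a' = \<kappa> * (\<omega> * a + \<omega> ^ 2 * b + \<eta>) / (a + b + \<eta>) \<and>
        b' = \<kappa> * (\<omega> ^ 2 * a + \<omega> * b + \<eta>) / (a + b + \<eta>)"
    using A B eta(1) by (intro exI[of _ "m * n"] exI[of _ \<eta>] exI[of _ "\<omega> ^ 2"]) simp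
  then show ?thesis unfolding equivalent_params_def by simp
qed

text \<open>Here g preserves the triangle xyz: on each coordinate line the product of the three rows
  vanishes, hence one row does, which makes g a monomial matrix.\<close>

lemma equivalent_params_monomial:
  fixes g :: "letter \<Rightarrow> letter \<Rightarrow> 'k"
  assumes T: "\<And>p q r. trilin a b (\<lambda>i. g i p) (\<lambda>i. g i q) (\<lambda>i. g i r) = l * potential a' b' p q r"
    and g: "det3 g \<noteq> 0"
    and X: "\<And>u. coords_prod (mat_vec g u) = \<beta> * coords_prod u"
    and C: "\<And>u. cubes_sum (mat_vec g u) = \<gamma> * cubes_sum u + \<delta> * coords_prod u"
  shows "equivalent_params (a, b) (a', b')"
proof -
  have xy: "\<exists>i. g i Lx = 0 \<and> g i Ly = 0"
    using linear_product_zero[of "g Lx Lx" "g Lx Ly" "g Ly Lx" "g Ly Ly" "g Lz Lx" "g Lz Ly"]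
      X[of "\<lambda>i. case i of Lx \<Rightarrow> 1 | Ly \<Rightarrow> t | Lz \<Rightarrow> 0" for t]
    by (auto simp: coords_prod_def mat_vec_def sum_letter)
  have xz: "\<exists>i. g i Lx = 0 \<and> g i Lz = 0"
    using linear_product_zero[of "g Lx Lx" "g Lx Lz" "g Ly Lx" "g Ly Lz" "g Lz Lx" "g Lz Lz"]
      X[of "\<lambda>i. case i of Lx \<Rightarrow> 1 | Ly \<Rightarrow> 0 | Lz \<Rightarrow> t" for t]
    by (auto simp: coords_prod_def mat_vec_def sum_letter)
  have yz: "\<exists>i. g i Ly = 0 \<and> g i Lz = 0"
    using linear_product_zero[of "g Lx Ly" "g Lx Lz" "g Ly Ly" "g Ly Lz" "g Lz Ly" "g Lz Lz"]
      X[of "\<lambda>i. case i of Lx \<Rightarrow> 0 | Ly \<Rightarrow> 1 | Lz \<Rightarrow> t" for t]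
    by (auto simp: coords_prod_def mat_vec_def sum_letter)
  have C1: "g Lx j ^ 3 + g Ly j ^ 3 + g Lz j ^ 3 = \<gamma>" for j
    using C[of "delta j"] by (cases j) (simp_all add: coords_prod_def cubes_sum_def mat_vec_def sum_letter delta_def)
  have l: "l = trilin a b (\<lambda>i. g i Lx) (\<lambda>i. g i Lx) (\<lambda>i. g i Lx)"
    unfolding T by (simp add: potential_def trilin_def delta_def)
  have a': "l * a' = trilin a b (\<lambda>i. g i Lx) (\<lambda>i. g i Ly) (\<lambda>i. g i Lz)"
    unfolding T by (simp add: potential_def trilin_def delta_def)
  have b': "l * b' = trilin a b (\<lambda>i. g i Lx) (\<lambda>i. g i Lz) (\<lambda>i. g i Ly)"
    unfolding T by (simp add: potential_def trilin_def delta_def)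
  \<comment> \<open>d1, d2, d3 are the nonzero entries of columns x, y, z. Their cubes agree, so
    their product divided by l = d1^3 is a cube root of unity. An even permutation keeps a and b in
    place, an odd one exchanges them.\<close>
  have fin: "equivalent_params (a, b) (a', b')"
    if d: "d1 \<noteq> 0" "d1 ^ 3 = \<gamma>" "d2 ^ 3 = \<gamma>" "d3 ^ 3 = \<gamma>" "l = d1 ^ 3"
      and *: "l * a' = d1 * d2 * d3 * a \<and> l * b' = d1 * d2 * d3 * b \<or>
          l * a' = d1 * d2 * d3 * b \<and> l * b' = d1 * d2 * d3 * a" for d1 d2 d3
  proof -
    define \<epsilon> where "\<epsilon> = d1 * d2 * d3 / l"
    have l0: "l \<noteq> 0" unfolding d(5) using d(1) by simp
    have "(d1 * d2 * d3) ^ 3 = l ^ 3"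
      unfolding power_mult_distrib d(5) d(2-4) by (simp add: power3_eq_cube)
    then have "\<epsilon> ^ 3 = 1" using l0 by (simp add: \<epsilon>_def power_divide)
    moreover have "(a', b') = (\<epsilon> * a, \<epsilon> * b) \<or> (a', b') = (\<epsilon> * b, \<epsilon> * a)"
      using * l0 by (auto simp: \<epsilon>_def field_simps)
    ultimately show ?thesis unfolding equivalent_params_def by auto
  qed
  \<comment> \<open>Row i vanishes on z = 0, row j on y = 0 and row k on x = 0, so their only
    possible nonzero entries are in columns z, y and x; invertibility makes the rows
    distinct.\<close>
  obtain i j k where z: "g i Lx = 0" "g i Ly = 0" "g j Lx = 0" "g j Lz = 0" "g k Ly = 0" "g k Lz = 0"
    using xy xz yz by blast
  consider "(k, j, i) = (Lx, Ly, Lz)" | "(k, j, i) = (Ly, Lz, Lx)" | "(k, j, i) = (Lz, Lx, Ly)"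
    | "(k, j, i) = (Lx, Lz, Ly)" | "(k, j, i) = (Ly, Lx, Lz)" | "(k, j, i) = (Lz, Ly, Lx)"
    using z g by (cases i; cases j; cases k) (simp_all add: det3_def)
  then show ?thesis
  proof cases
    case 1
    then show ?thesis
      using z g C1[of Lx] C1[of Ly] C1[of Lz] l a' b'
      by (intro fin[of "g Lx Lx" "g Ly Ly" "g Lz Lz"]) (auto simp: det3_def trilin_def power3_eq_cube)
  next
    case 2
    then show ?thesis
      using z g C1[of Lx] C1[of Ly] C1[of Lz] l a' b'
      by (intro fin[of "g Ly Lx" "g Lz Ly" "g Lx Lz"]) (auto simp: det3_def trilin_def power3_eq_cube)
  next
    case 3
    then show ?thesis
      using z g C1[of Lx] C1[of Ly] C1[of Lz] l a' b'
      by (intro fin[of "g Lz Lx" "g Lx Ly" "g Ly Lz"]) (auto simp: det3_def trilin_def power3_eq_cube)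
  next
    case 4
    then show ?thesis
      using z g C1[of Lx] C1[of Ly] C1[of Lz] l a' b'
      by (intro fin[of "g Lx Lx" "g Lz Ly" "g Ly Lz"]) (auto simp: det3_def trilin_def power3_eq_cube)
  next
    case 5
    then show ?thesis
      using z g C1[of Lx] C1[of Ly] C1[of Lz] l a' b'
      by (intro fin[of "g Ly Lx" "g Lx Ly" "g Lz Lz"]) (auto simp: det3_def trilin_def power3_eq_cube)
  next
    case 6
    then show ?thesis
      using z g C1[of Lx] C1[of Ly] C1[of Lz] l a' b'
      by (intro fin[of "g Lz Lx" "g Ly Ly" "g Lx Lz"]) (auto simp: det3_def trilin_def power3_eq_cube)
  qed
qed

lemma equivalent_params_if_trilin:
  fixes g :: "letter \<Rightarrow> letter \<Rightarrow> 'k"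
  assumes T: "\<And>p q r. trilin a b (\<lambda>i. g i p) (\<lambda>i. g i q) (\<lambda>i. g i r) = l * potential a' b' p q r"
    and ab: "(a + b) ^ 3 + 1 \<noteq> 0" and g: "det3 g \<noteq> 0"
  shows "equivalent_params (a, b) (a', b')"
proof -
  from pencil_preserved(1)[of a b g, OF T ab g] obtain \<alpha> \<beta> where
    X: "\<And>u. coords_prod (mat_vec g u) = \<alpha> * cubes_sum u + \<beta> * coords_prod u" by blast
  from pencil_preserved(2)[of a b g, OF T ab g] obtain \<gamma> \<delta> where
    C: "\<And>u. cubes_sum (mat_vec g u) = \<gamma> * cubes_sum u + \<delta> * coords_prod u" by blast
  show ?thesis
  proof (cases "\<alpha> = 0")
    case True
    then show ?thesis using equivalent_params_monomial[of a b g l a' b' \<beta>, OF T g _ C] X by simp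
  next
    case False
    then show ?thesis using equivalent_params_triangle[of a b g, OF T ab X _ C] by blast
  qed
qed

end

section \<open>Substitutions in the free algebra\<close>

lemma letters_plus: "letters (u + w) = letters u @ letters w"
  by (simp add: plus_xyz_word_def)

lemma letters_zero: "letters 0 = []"
  by (simp add: zero_xyz_word_def)

lemma free_alg_decompose:
  "f = (\<Sum>w\<in>Poly_Mapping.keys f. Poly_Mapping.single w (Poly_Mapping.lookup f w))"
  for f :: "'k::field free_alg"
  by (rule poly_mapping_eqI)
    (auto simp: lookup_sum lookup_single when_def sum.delta in_keys_iff)

text \<open>Zero needs no case of its own: it is a monomial with coefficient 0.\<close>

lemma free_alg_induct [case_names single add]:
  fixes f :: "'k::field free_alg"
  assumes s: "\<And>w c. P (Poly_Mapping.single w c)" and a: "\<And>f g. P f \<Longrightarrow> P g \<Longrightarrow> P (f + g)"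
  shows "P f"
proof -
  have "P (\<Sum>w\<in>S. Poly_Mapping.single w (Poly_Mapping.lookup f w))" if "finite S" for S
    using that
  proof (induction S)
    case empty
    then show ?case using s[of 0 0] by simp
  next
    case (insert x S)
    then show ?case using s a by simp
  qed
  then show ?thesis using free_alg_decompose[of f] by (metis finite_keys)
qed

lemma scal_simps:
  "scal 0 = 0" "scal 1 = 1" "scal (c + d) = scal c + scal d" "scal (c * d) = scal c * scal d"
  by (simp_all add: scal_def single_add mult_single)

lemma scal_commute: "f * scal c = scal c * f" for f :: "'k::field free_alg"
  by (induction f rule: free_alg_induct)
    (simp_all add: scal_def mult_single distrib_left distrib_right mult.commute)

lemma single_eq: "Poly_Mapping.single w c = scal c * prod_list (map gen (letters w))"
proof (cases w)
  case (Word ls)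
  have "Poly_Mapping.single (Word ls) (1::'a) = prod_list (map gen ls)"
  proof (induction ls)
    case Nil
    then show ?case by (simp flip: zero_xyz_word_def)
  next
    case (Cons l ls)
    have "Word (l # ls) = Word [l] + Word ls" by (simp add: plus_xyz_word_def)
    then have "Poly_Mapping.single (Word (l # ls)) (1::'a) = gen l * Poly_Mapping.single (Word ls) 1"
      by (simp add: gen_def mult_single)
    then show ?case using Cons by simp
  qed
  then have "Poly_Mapping.single w (1::'a) = prod_list (map gen (letters w))" using Word by simp
  moreover have "Poly_Mapping.single w c = scal c * Poly_Mapping.single w 1"
    by (simp add: scal_def mult_single)
  ultimately show ?thesis by simp
qed

definition substitute :: "(letter \<Rightarrow> 'k free_alg) \<Rightarrow> 'k::field free_alg \<Rightarrow> 'k free_alg" where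
  "substitute v f = (\<Sum>w\<in>Poly_Mapping.keys f. scal (Poly_Mapping.lookup f w) * prod_list (map v (letters w)))"

text \<open>Cancellation can remove keys from f + g; summation over a common finite set makes
  additivity a termwise matter.\<close>

lemma substitute_superset:
  assumes "finite S" "Poly_Mapping.keys f \<subseteq> S"
  shows "substitute v f = (\<Sum>w\<in>S. scal (Poly_Mapping.lookup f w) * prod_list (map v (letters w)))"
  unfolding substitute_def using assms
  by (intro sum.mono_neutral_left) (auto simp: in_keys_iff scal_simps)

lemma substitute_add: "substitute v (f + g) = substitute v f + substitute v g"
proof -
  have fin: "finite (Poly_Mapping.keys f \<union> Poly_Mapping.keys g)" by simp
  show ?thesis
    using substitute_superset[OF fin, of f v] substitute_superset[OF fin, of g v]
      substitute_superset[OF fin Poly_Mapping.keys_add[of f g], of v]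
    by (simp add: lookup_add scal_simps distrib_right sum.distrib)
qed

lemma substitute_single: "substitute v (Poly_Mapping.single w c) = scal c * prod_list (map v (letters w))"
  using substitute_superset[of "{w}" "Poly_Mapping.single w c"] by simp

lemma substitute_mult: "substitute v (f * g) = substitute v f * substitute v g"
proof (induction f rule: free_alg_induct)
  case (single u c)
  show ?case
  proof (induction g rule: free_alg_induct)
    case (single w d)
    have "prod_list (map v (letters u)) * (scal d * x) = scal d * (prod_list (map v (letters u)) * x)" for x
      by (metis mult.assoc scal_commute)
    then show ?case by (simp add: mult_single substitute_single letters_plus scal_simps mult.assoc)
  qed (simp add: substitute_add distrib_left)
qed (simp add: substitute_add distrib_right)

lemma substitute_scal: "substitute v (scal c) = scal c"
  unfolding scal_def by (subst substitute_single) (simp add: letters_zero scal_def)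

lemma substitute_gen: "substitute v (gen l) = v l"
  unfolding gen_def by (subst substitute_single) (simp add: scal_simps)

lemma free_ring_simps [simp]:
  "carrier free_ring = UNIV" "x \<otimes>\<^bsub>free_ring\<^esub> y = x * y" "\<one>\<^bsub>free_ring\<^esub> = 1"
  "\<zero>\<^bsub>free_ring\<^esub> = 0" "x \<oplus>\<^bsub>free_ring\<^esub> y = x + y"
  by (simp_all add: free_ring_def)

lemma ring_free_ring: "ring (free_ring :: 'k::field free_alg ring)"
proof (rule ringI)
  show "abelian_group (free_ring :: 'k free_alg ring)"
    by (rule abelian_groupI) (auto simp: add.assoc add.commute intro: exI[of _ "- _"] left_minus)
  show "Group.monoid (free_ring :: 'k free_alg ring)"
    by (rule monoidI) (auto simp: mult.assoc)
qed (auto simp: distrib_left distrib_right)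

lemma free_ring_minus: "x \<ominus>\<^bsub>free_ring\<^esub> y = x - (y :: 'k::field free_alg)"
proof -
  interpret ring "free_ring :: 'k free_alg ring" by (rule ring_free_ring)
  have "\<ominus>\<^bsub>free_ring\<^esub> y = - y" by (rule minus_equality) simp_all
  then show ?thesis by (simp add: a_minus_def)
qed

lemma substitute_ring_hom: "substitute v \<in> ring_hom free_ring free_ring"
  using substitute_scal[of v 1] by (auto intro!: ring_hom_memI simp: substitute_add substitute_mult scal_simps)

text \<open>The uniqueness half of the universal property: every element is a sum of scalars times
  products of generators. Identities between maps out of the free algebra are reduced to generators
  by it.\<close>

lemma free_ring_hom_eq:
  fixes h1 h2 :: "'k::field free_alg \<Rightarrow> 'b"
  assumes h: "h1 \<in> ring_hom free_ring R" "h2 \<in> ring_hom free_ring R"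
    and s: "\<And>c. h1 (scal c) = h2 (scal c)" and g: "\<And>l. h1 (gen l) = h2 (gen l)"
  shows "h1 f = h2 f"
proof (induction f rule: free_alg_induct)
  case (single w c)
  have "h1 (prod_list (map gen ls)) = h2 (prod_list (map gen ls))" for ls
  proof (induction ls)
    case Nil
    then show ?case using ring_hom_one[OF h(1)] ring_hom_one[OF h(2)] by simp
  next
    case (Cons l ls)
    then show ?case using ring_hom_mult[OF h(1)] ring_hom_mult[OF h(2)] g by simp
  qed
  then show ?case
    unfolding single_eq using ring_hom_mult[OF h(1)] ring_hom_mult[OF h(2)] s by simp
next
  case (add f g)
  then show ?case using ring_hom_add[OF h(1)] ring_hom_add[OF h(2)] by simp
qed

lemma substitute_gens: "substitute gen f = f"
proof -
  have "id \<in> ring_hom free_ring (free_ring :: 'a free_alg ring)" by (rule ring_hom_memI) auto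
  from free_ring_hom_eq[OF substitute_ring_hom this] show ?thesis by (simp add: substitute_scal substitute_gen)
qed

lemma substitute_substitute: "substitute v (substitute u f) = substitute (\<lambda>l. substitute v (u l)) f"
proof -
  have "substitute v \<circ> substitute u \<in> ring_hom free_ring free_ring"
    by (rule ring_hom_trans[OF substitute_ring_hom substitute_ring_hom])
  from free_ring_hom_eq[OF this substitute_ring_hom[of "\<lambda>l. substitute v (u l)"]] show ?thesis
    by (simp add: substitute_scal substitute_gen)
qed

definition linear_form :: "(letter \<Rightarrow> letter \<Rightarrow> 'k) \<Rightarrow> letter \<Rightarrow> 'k::field free_alg" where
  "linear_form g l = (\<Sum>j\<in>UNIV. Poly_Mapping.single (Word [j]) (g l j))"

definition quadratic_form :: "(letter \<Rightarrow> letter \<Rightarrow> 'k) \<Rightarrow> 'k::field free_alg" where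
  "quadratic_form q = (\<Sum>i\<in>UNIV. \<Sum>j\<in>UNIV. Poly_Mapping.single (Word [i, j]) (q i j))"

lemma linear_form_delta: "linear_form delta = gen"
  by (rule ext, rename_tac l, case_tac l) (simp_all add: linear_form_def gen_def sum_letter delta_def)

lemma scal_single: "scal c * Poly_Mapping.single w d = Poly_Mapping.single w (c * d)"
  by (simp add: scal_def mult_single)

lemma linear_form_mult: "linear_form g i * linear_form h j = quadratic_form (\<lambda>k l. g i k * h j l)"
  unfolding linear_form_def quadratic_form_def by (simp add: sum_product mult_single plus_xyz_word_def)

lemma substitute_sum: "finite S \<Longrightarrow> substitute v (sum f S) = (\<Sum>i\<in>S. substitute v (f i))"
proof (induction S rule: finite_induct)
  case empty
  then show ?case by (simp add: substitute_def)
qed (simp add: substitute_add)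

text \<open>Row l of a matrix is the image of generator l, so substitution by g acts on coefficient
  rows from the right.\<close>

lemma substitute_linear_form: "substitute (linear_form g) (linear_form h l) = linear_form (mat_mat h g) l"
  unfolding linear_form_def[of h]
  by (simp add: substitute_sum substitute_single linear_form_def sum_distrib_left scal_single mat_mat_def)
     (simp add: sum_letter single_add)

lemma quadratic_form_add: "quadratic_form (\<lambda>i j. p i j + q i j) = quadratic_form p + quadratic_form q"
  by (simp add: quadratic_form_def single_add sum.distrib)

lemma quadratic_form_scal: "scal c * quadratic_form q = quadratic_form (\<lambda>i j. c * q i j)"
  by (simp add: quadratic_form_def sum_distrib_left scal_single)

lemma quadratic_form_sum: "finite S \<Longrightarrow> quadratic_form (\<lambda>i j. \<Sum>x\<in>S. q x i j) = (\<Sum>x\<in>S. quadratic_form (q x))"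
proof (induction S rule: finite_induct)
  case empty
  then show ?case by (simp add: quadratic_form_def)
qed (simp add: quadratic_form_add)

lemma substitute_quadratic_form:
  "substitute (linear_form g) (quadratic_form q) = quadratic_form (\<lambda>k l. \<Sum>i\<in>UNIV. \<Sum>j\<in>UNIV. q i j * (g i k * g j l))"
proof -
  have "substitute (linear_form g) (quadratic_form q) = (\<Sum>i\<in>UNIV. \<Sum>j\<in>UNIV. scal (q i j) * (linear_form g i * linear_form g j))"
    unfolding quadratic_form_def by (simp add: substitute_sum substitute_single)
  then show ?thesis by (simp add: linear_form_mult quadratic_form_scal quadratic_form_sum)
qed

lemma lookup_linear_form: "Poly_Mapping.lookup (linear_form g l) (Word [i]) = g l i"
  by (cases i) (simp_all add: linear_form_def sum_letter lookup_add lookup_single when_def)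

lemma lookup_quadratic_form: "Poly_Mapping.lookup (quadratic_form q) (Word [i, j]) = q i j"
  by (cases i; cases j) (simp_all add: quadratic_form_def sum_letter lookup_add lookup_single when_def)

lemma lookup_quadratic_form_low:
  "Poly_Mapping.lookup (quadratic_form q) (Word []) = 0" "Poly_Mapping.lookup (quadratic_form q) (Word [i]) = 0"
  by (simp_all add: quadratic_form_def sum_letter lookup_add lookup_single when_def)

lemma homogeneous_add: "f \<in> homogeneous n \<Longrightarrow> g \<in> homogeneous n \<Longrightarrow> f + g \<in> homogeneous n"
  using Poly_Mapping.keys_add[of f g] by (auto simp: homogeneous_def)

lemma homogeneous_mult: "f \<in> homogeneous m \<Longrightarrow> g \<in> homogeneous n \<Longrightarrow> f * g \<in> homogeneous (m + n)"
  using Poly_Mapping.keys_mult[of f g] by (fastforce simp: homogeneous_def letters_plus)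

lemma homogeneous_single: "Poly_Mapping.single w c \<in> homogeneous (length (letters w))"
  by (simp add: homogeneous_def)

lemma homogeneous_sum:
  assumes "finite S" "\<And>x. x \<in> S \<Longrightarrow> f x \<in> homogeneous n"
  shows "sum f S \<in> homogeneous n"
  using assms
proof (induction S rule: finite_induct)
  case empty
  then show ?case by (simp add: homogeneous_def)
qed (simp add: homogeneous_add)

lemma linear_form_homogeneous: "linear_form g l \<in> homogeneous 1"
  unfolding linear_form_def
proof (rule homogeneous_sum)
  fix j show "Poly_Mapping.single (Word [j]) (g l j) \<in> homogeneous 1"
    using homogeneous_single[of "Word [j]"] by simp
qed simp

lemma substitute_homogeneous:
  assumes "f \<in> homogeneous n"
  shows "substitute (linear_form g) f \<in> homogeneous n"
  unfolding substitute_def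
proof (rule homogeneous_sum)
  fix w assume "w \<in> Poly_Mapping.keys f"
  then have w: "length (letters w) = n" using assms by (simp add: homogeneous_def)
  have "prod_list (map (linear_form g) ls) \<in> homogeneous (length ls)" for ls
  proof (induction ls)
    case Nil
    then show ?case by (simp add: homogeneous_def letters_zero)
  next
    case (Cons l ls)
    then show ?case using homogeneous_mult[OF linear_form_homogeneous[of g l]] by simp
  qed
  then have "prod_list (map (linear_form g) (letters w)) \<in> homogeneous n" using w by metis
  moreover have "scal c \<in> homogeneous 0" for c :: 'a
    using homogeneous_single[of 0] by (simp add: scal_def letters_zero)
  ultimately show "scal (Poly_Mapping.lookup f w) * prod_list (map (linear_form g) (letters w)) \<in> homogeneous n"
    using homogeneous_mult by fastforce
qed simp

text \<open>The matrix has constant rows, so l is a dummy index that only fits a single linear form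
  into the format of \<open>linear_form\<close>.\<close>

lemma homogeneous_1_linear_form:
  assumes "f \<in> homogeneous 1"
  shows "f = linear_form (\<lambda>_ j. Poly_Mapping.lookup f (Word [j])) l"
proof (rule poly_mapping_eqI)
  fix w
  obtain ls where w: "w = Word ls" by (cases w)
  show "Poly_Mapping.lookup f w = Poly_Mapping.lookup (linear_form (\<lambda>_ j. Poly_Mapping.lookup f (Word [j])) l) w"
  proof (cases "\<exists>i. ls = [i]")
    case True
    then show ?thesis using w by (auto simp: lookup_linear_form)
  next
    case False
    then have "length (letters w) \<noteq> 1" using w by (auto simp: length_Suc_conv)
    then show ?thesis
      using assms linear_form_homogeneous[of "\<lambda>_ j. Poly_Mapping.lookup f (Word [j])" l]
      by (metis (mono_tags, lifting) homogeneous_def in_keys_iff mem_Collect_eq)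
  qed
qed

section \<open>Sklyanin ideals and graded isomorphisms\<close>

lemma scal_gen_gen: "scal c * gen i * gen j = Poly_Mapping.single (Word [i, j]) c"
  by (simp add: scal_def gen_def mult_single plus_xyz_word_def letters_zero)

lemma sklyanin_relations_eq: "sklyanin_relations (a, b, 1) = range (\<lambda>p. quadratic_form (potential a b p))"
proof -
  have "quadratic_form (potential a b Lx) = scal a * gen Ly * gen Lz + scal b * gen Lz * gen Ly + scal 1 * gen Lx * gen Lx"
    "quadratic_form (potential a b Ly) = scal a * gen Lz * gen Lx + scal b * gen Lx * gen Lz + scal 1 * gen Ly * gen Ly"
    "quadratic_form (potential a b Lz) = scal a * gen Lx * gen Ly + scal b * gen Ly * gen Lx + scal 1 * gen Lz * gen Lz"
    unfolding scal_gen_gen quadratic_form_def sum_letter potential_def by (simp_all add: trilin_def delta_def ac_simps)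
  then show ?thesis unfolding sklyanin_relations_def Let_def UNIV_letter by auto
qed

lemma ideal_sklyanin: "ideal (sklyanin_ideal s) free_ring"
  unfolding sklyanin_ideal_def by (rule ring.genideal_ideal[OF ring_free_ring]) simp

lemma relation_mem_ideal: "quadratic_form (potential a b p) \<in> sklyanin_ideal (a, b, 1)"
proof -
  have "sklyanin_relations (a, b, 1) \<subseteq> sklyanin_ideal (a, b, 1)"
    unfolding sklyanin_ideal_def by (rule ring.genideal_self[OF ring_free_ring]) simp
  then show ?thesis unfolding sklyanin_relations_eq by blast
qed

lemma ideal_minimal:
  assumes "ideal J free_ring" "\<And>p. quadratic_form (potential a b p) \<in> J"
  shows "sklyanin_ideal (a, b, 1) \<subseteq> J"
  unfolding sklyanin_ideal_def
proof (rule ring.genideal_minimal[OF ring_free_ring assms(1)])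
  show "sklyanin_relations (a, b, 1) \<subseteq> J" unfolding sklyanin_relations_eq using assms(2) by blast
qed

lemma ring_sklyanin: "ring (sklyanin s)"
  unfolding sklyanin_def by (rule ideal.quotient_is_ring[OF ideal_sklyanin])

lemma sklyanin_class_hom: "sklyanin_class s \<in> ring_hom free_ring (sklyanin s)"
  unfolding sklyanin_def sklyanin_class_def using ideal.rcos_ring_hom[OF ideal_sklyanin] .

lemma carrier_sklyanin: "carrier (sklyanin s) = range (sklyanin_class s)"
  unfolding sklyanin_def sklyanin_class_def by (auto simp: FactRing_def A_RCOSETS_def')

lemma sklyanin_class_eq_iff: "sklyanin_class s f = sklyanin_class s g \<longleftrightarrow> f - g \<in> sklyanin_ideal s"
  using ring.quotient_eq_iff_same_a_r_cos[OF ring_free_ring ideal_sklyanin, of f g s]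
  by (simp add: sklyanin_class_def free_ring_minus)

lemma sklyanin_class_zero: "sklyanin_class s 0 = \<zero>\<^bsub>sklyanin s\<^esub>"
proof -
  interpret h: ring_hom_ring free_ring "sklyanin s" "sklyanin_class s"
    by (rule ring_hom_ringI2[OF ring_free_ring ring_sklyanin sklyanin_class_hom])
  show ?thesis using h.hom_zero by simp
qed

lemma ideal_closed:
  assumes "ideal J (free_ring :: 'k::field free_alg ring)"
  shows "0 \<in> J" "f \<in> J \<Longrightarrow> g \<in> J \<Longrightarrow> f + g \<in> J" "f \<in> J \<Longrightarrow> h * f \<in> J" "f \<in> J \<Longrightarrow> f * h \<in> J"
proof -
  interpret ideal J free_ring by (rule assms)
  show "0 \<in> J" using additive_subgroup.zero_closed[OF is_additive_subgroup] by simp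
  show "f \<in> J \<Longrightarrow> g \<in> J \<Longrightarrow> f + g \<in> J" using additive_subgroup.a_closed[OF is_additive_subgroup, of f g] by simp
  show "f \<in> J \<Longrightarrow> h * f \<in> J" "f \<in> J \<Longrightarrow> f * h \<in> J"
    using I_l_closed[of f h] I_r_closed[of f h] by simp_all
qed

lemma ideal_sum:
  assumes "ideal J (free_ring :: 'k::field free_alg ring)" "finite S" "\<And>x. x \<in> S \<Longrightarrow> f x \<in> J"
  shows "sum f S \<in> J"
  using assms(2,3) by (induction S rule: finite_induct) (auto simp: ideal_closed[OF assms(1)])

section \<open>The ideal in degrees at most two\<close>

lemma lookup_gen_mult:
  "Poly_Mapping.lookup (gen l * f) (Word []) = 0"
  "Poly_Mapping.lookup (gen l * f) (Word (i # is)) = (if i = l then Poly_Mapping.lookup f (Word is) else 0)"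
proof -
  show "Poly_Mapping.lookup (gen l * f) (Word []) = 0"
    by (induction f rule: free_alg_induct)
      (simp_all add: gen_def mult_single lookup_single plus_xyz_word_def distrib_left lookup_add)
  show "Poly_Mapping.lookup (gen l * f) (Word (i # is)) = (if i = l then Poly_Mapping.lookup f (Word is) else 0)"
  proof (induction f rule: free_alg_induct)
    case (single w c)
    then show ?case
      by (cases w) (auto simp: gen_def mult_single lookup_single plus_xyz_word_def when_def)
  qed (simp add: distrib_left lookup_add)
qed

lemma lookup_mult_gen:
  "Poly_Mapping.lookup (f * gen l) (Word []) = 0"
  "Poly_Mapping.lookup (f * gen l) (Word (is @ [i])) = (if i = l then Poly_Mapping.lookup f (Word is) else 0)"
proof -
  show "Poly_Mapping.lookup (f * gen l) (Word []) = 0"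
    by (induction f rule: free_alg_induct)
      (simp_all add: gen_def mult_single lookup_single plus_xyz_word_def distrib_right lookup_add)
  show "Poly_Mapping.lookup (f * gen l) (Word (is @ [i])) = (if i = l then Poly_Mapping.lookup f (Word is) else 0)"
  proof (induction f rule: free_alg_induct)
    case (single w c)
    then show ?case
      by (cases w) (auto simp: gen_def mult_single lookup_single plus_xyz_word_def when_def)
  qed (simp add: distrib_right lookup_add)
qed

lemma lookup_scal_mult: "Poly_Mapping.lookup (scal c * f) w = c * Poly_Mapping.lookup f w"
  by (induction f rule: free_alg_induct)
    (auto simp: scal_single lookup_single when_def distrib_left lookup_add)

text \<open>An ideal that contains \<open>sklyanin_ideal (a, b, 1)\<close> and constrains only
  degrees 0, 1 and 2. Membership in it bounds the quadratic part of the Sklyanin ideal by the span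
  of the relations without a description of the higher degrees.\<close>

definition low_degree_ideal :: "'k \<Rightarrow> 'k \<Rightarrow> 'k::field free_alg set" where
  "low_degree_ideal a b = {f. Poly_Mapping.lookup f (Word []) = 0 \<and> (\<forall>i. Poly_Mapping.lookup f (Word [i]) = 0) \<and>
     (\<exists>h. \<forall>i j. Poly_Mapping.lookup f (Word [i, j]) = (\<Sum>p\<in>UNIV. h p * potential a b p i j))}"

lemma low_degree_ideal_add: 
  assumes "f \<in> low_degree_ideal a b" "g \<in> low_degree_ideal a b"
  shows "f + g \<in> low_degree_ideal a b"
proof -
  obtain h h' where "\<forall>i j. Poly_Mapping.lookup f (Word [i, j]) = (\<Sum>p\<in>UNIV. h p * potential a b p i j)"
    "\<forall>i j. Poly_Mapping.lookup g (Word [i, j]) = (\<Sum>p\<in>UNIV. h' p * potential a b p i j)"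
    using assms unfolding low_degree_ideal_def by blast
  then have "\<forall>i j. Poly_Mapping.lookup (f + g) (Word [i, j]) = (\<Sum>p\<in>UNIV. (h p + h' p) * potential a b p i j)"
    by (simp add: lookup_add distrib_right sum.distrib)
  then show ?thesis using assms unfolding low_degree_ideal_def by (auto simp: lookup_add)
qed

lemma low_degree_ideal_scal:
  assumes "f \<in> low_degree_ideal a b"
  shows "scal c * f \<in> low_degree_ideal a b"
proof -
  obtain h where "\<forall>i j. Poly_Mapping.lookup f (Word [i, j]) = (\<Sum>p\<in>UNIV. h p * potential a b p i j)"
    using assms unfolding low_degree_ideal_def by blast
  then have "\<forall>i j. Poly_Mapping.lookup (scal c * f) (Word [i, j]) = (\<Sum>p\<in>UNIV. (c * h p) * potential a b p i j)"
    by (simp add: lookup_scal_mult sum_distrib_left mult.assoc)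
  then show ?thesis using assms unfolding low_degree_ideal_def by (auto simp: lookup_scal_mult)
qed

text \<open>An element of the set has no terms of degree below 2, so its product with a generator
  starts in degree 3 and its quadratic part is the zero combination of relations.\<close>

lemma low_degree_ideal_gen:
  assumes "f \<in> low_degree_ideal a b"
  shows "gen l * f \<in> low_degree_ideal a b" "f * gen l \<in> low_degree_ideal a b"
proof -
  have f: "Poly_Mapping.lookup f (Word []) = 0" "Poly_Mapping.lookup f (Word [i]) = 0" for i
    using assms by (auto simp: low_degree_ideal_def)
  show "gen l * f \<in> low_degree_ideal a b"
    by (auto simp: low_degree_ideal_def lookup_gen_mult f intro!: exI[of _ "\<lambda>_. 0"])
  have "Poly_Mapping.lookup (f * gen l) (Word [i]) = 0" "Poly_Mapping.lookup (f * gen l) (Word [i, j]) = 0" for i j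
    using lookup_mult_gen(2)[of f l "[]" i] lookup_mult_gen(2)[of f l "[i]" j] f by simp_all
  then show "f * gen l \<in> low_degree_ideal a b"
    by (auto simp: low_degree_ideal_def lookup_mult_gen intro!: exI[of _ "\<lambda>_. 0"])
qed

lemma low_degree_ideal_mult:
  assumes "f \<in> low_degree_ideal a b"
  shows "g * f \<in> low_degree_ideal a b" "f * g \<in> low_degree_ideal a b"
proof -
  show "g * f \<in> low_degree_ideal a b"
  proof (induction g rule: free_alg_induct)
    case (single w c)
    have "prod_list (map gen ls) * f \<in> low_degree_ideal a b" for ls
      by (induction ls) (auto simp: assms low_degree_ideal_gen mult.assoc)
    then show ?case by (simp add: single_eq low_degree_ideal_scal mult.assoc)
  qed (simp add: low_degree_ideal_add distrib_right)
  show "f * g \<in> low_degree_ideal a b"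
  proof (induction g rule: free_alg_induct)
    case (single w c)
    have "h * prod_list (map gen ls) \<in> low_degree_ideal a b" if "h \<in> low_degree_ideal a b" for h ls
      using that by (induction ls arbitrary: h) (auto simp: low_degree_ideal_gen simp flip: mult.assoc)
    then show ?case using assms by (simp add: single_eq low_degree_ideal_scal scal_commute flip: mult.assoc)
  qed (simp add: low_degree_ideal_add distrib_left)
qed

lemma sklyanin_ideal_subset_low_degree: "sklyanin_ideal (a, b, 1) \<subseteq> low_degree_ideal a b"
proof (rule ideal_minimal)
  interpret ring "free_ring :: 'a free_alg ring" by (rule ring_free_ring)
  have zero: "0 \<in> low_degree_ideal a b"
    by (auto simp: low_degree_ideal_def intro: exI[of _ "\<lambda>_. 0"])
  have uminus: "\<ominus>\<^bsub>free_ring\<^esub> f \<in> low_degree_ideal a b" if "f \<in> low_degree_ideal a b" for f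
  proof -
    have "\<ominus>\<^bsub>free_ring\<^esub> f = scal (- 1) * f"
    proof (rule minus_equality)
      have "scal (- 1) * f + f = scal (- 1 + 1) * f" unfolding scal_simps(3) by (simp add: distrib_right scal_simps)
      then show "scal (- 1) * f \<oplus>\<^bsub>free_ring\<^esub> f = \<zero>\<^bsub>free_ring\<^esub>" by (simp add: scal_simps)
    qed simp_all
    then show ?thesis using low_degree_ideal_scal that by simp
  qed
  show "ideal (low_degree_ideal a b) free_ring"
  proof (rule idealI)
    show "subgroup (low_degree_ideal a b) (add_monoid free_ring)"
      by (rule add.subgroupI) (use zero low_degree_ideal_add uminus in auto)
  qed (use low_degree_ideal_mult ring_free_ring in auto)
  show "quadratic_form (potential a b p) \<in> low_degree_ideal a b" for p
  proof -
    have "\<forall>i j. Poly_Mapping.lookup (quadratic_form (potential a b p)) (Word [i, j]) = (\<Sum>q\<in>UNIV. delta p q * potential a b q i j)"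
      by (cases p) (simp_all add: lookup_quadratic_form delta_def sum_letter)
    then show ?thesis unfolding low_degree_ideal_def using lookup_quadratic_form_low by blast
  qed
qed

lemma sklyanin_ideal_quadratic_form:
  assumes "quadratic_form q \<in> sklyanin_ideal (a, b, 1)"
  shows "\<exists>h. \<forall>i j. q i j = (\<Sum>p\<in>UNIV. h p * potential a b p i j)"
proof -
  have "quadratic_form q \<in> low_degree_ideal a b" using assms sklyanin_ideal_subset_low_degree by blast
  then show ?thesis unfolding low_degree_ideal_def by (simp add: lookup_quadratic_form)
qed

text \<open>The relations have degree two, so linear forms embed into the quotient; this lets matrix
  identities be read off from identities of classes.\<close>

lemma sklyanin_ideal_linear:
  assumes "f - g \<in> sklyanin_ideal (a, b, 1)" "f \<in> homogeneous 1" "g \<in> homogeneous 1"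
  shows "f = g"
proof -
  have "Poly_Mapping.lookup f (Word [i]) = Poly_Mapping.lookup g (Word [i])" for i
    using assms(1) sklyanin_ideal_subset_low_degree[of a b] unfolding low_degree_ideal_def by (auto simp: lookup_minus)
  then show ?thesis
    using homogeneous_1_linear_form[OF assms(2), of Lx] homogeneous_1_linear_form[OF assms(3), of Lx] by simp
qed

section \<open>Graded isomorphisms and linear substitutions\<close>

lemma class_substitute_hom: "sklyanin_class t \<circ> substitute v \<in> ring_hom free_ring (sklyanin t)"
  by (rule ring_hom_trans[OF substitute_ring_hom sklyanin_class_hom])

text \<open>The preimage of the target ideal is the kernel of a ring homomorphism, hence an ideal,
  so it suffices to test the three relations.\<close>

lemma substitute_mem_ideal:
  assumes "\<And>p. substitute v (quadratic_form (potential a b p)) \<in> sklyanin_ideal t" and "f \<in> sklyanin_ideal (a, b, 1)"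
  shows "substitute v f \<in> sklyanin_ideal t"
proof -
  have mem: "g \<in> a_kernel free_ring (sklyanin t) (sklyanin_class t \<circ> substitute v) \<longleftrightarrow> substitute v g \<in> sklyanin_ideal t" for g
    using sklyanin_class_eq_iff[of t "substitute v g" 0]
    by (simp add: a_kernel_def' sklyanin_class_zero)
  have "ideal (a_kernel free_ring (sklyanin t) (sklyanin_class t \<circ> substitute v)) free_ring"
    by (rule ring_hom_ring.kernel_is_ideal[OF ring_hom_ringI2[OF ring_free_ring ring_sklyanin class_substitute_hom]])
  from ideal_minimal[OF this] show ?thesis using mem assms by blast
qed

text \<open>The two substitutions are inverse and carry each ideal into the other, so the kernel of
  \<open>H\<close> is exactly the source ideal and the first isomorphism theorem applies. Linear
  substitutions keep degrees.\<close>

lemma sklyanin_isomorphic_substitution: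
  fixes g h :: "letter \<Rightarrow> letter \<Rightarrow> 'k::field"
  assumes gh: "mat_mat g h = delta" "mat_mat h g = delta"
    and st: "\<And>p. substitute (linear_form g) (quadratic_form (potential a b p)) \<in> sklyanin_ideal (a', b', 1)"
    and ts: "\<And>p. substitute (linear_form h) (quadratic_form (potential a' b' p)) \<in> sklyanin_ideal (a, b, 1)"
  shows "sklyanin_isomorphic (a, b, 1) (a', b', 1)"
proof -
  define s t where "s = (a, b, 1 :: 'k)" and "t = (a', b', 1 :: 'k)"
  define H where "H = sklyanin_class t \<circ> substitute (linear_form g)"
  have inv: "substitute (linear_form g) (substitute (linear_form h) f) = f" "substitute (linear_form h) (substitute (linear_form g) f) = f" for f
    by (simp_all add: substitute_substitute substitute_linear_form gh linear_form_delta substitute_gens)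
  have hom: "H \<in> ring_hom free_ring (sklyanin t)" unfolding H_def by (rule class_substitute_hom)
  interpret h: ring_hom_ring free_ring "sklyanin t" H
    by (rule ring_hom_ringI2[OF ring_free_ring ring_sklyanin hom])
  have "a_kernel free_ring (sklyanin t) H = {f. substitute (linear_form g) f \<in> sklyanin_ideal t}"
    using sklyanin_class_eq_iff[of t _ 0] by (auto simp: a_kernel_def' H_def sklyanin_class_zero[symmetric])
  also have "\<dots> = sklyanin_ideal s"
  proof (intro Set.set_eqI iffI)
    fix f assume "f \<in> {f. substitute (linear_form g) f \<in> sklyanin_ideal t}"
    then have "substitute (linear_form h) (substitute (linear_form g) f) \<in> sklyanin_ideal s"
      using substitute_mem_ideal[OF ts] unfolding s_def t_def by blast
    then show "f \<in> sklyanin_ideal s" by (simp add: inv)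
  next
    fix f assume "f \<in> sklyanin_ideal s"
    then show "f \<in> {f. substitute (linear_form g) f \<in> sklyanin_ideal t}"
      using substitute_mem_ideal[OF st] unfolding s_def t_def by blast
  qed
  finally have ker: "a_kernel free_ring (sklyanin t) H = sklyanin_ideal s" .
  have surj: "H ` carrier free_ring = carrier (sklyanin t)"
    unfolding carrier_sklyanin H_def free_ring_simps image_comp[symmetric] surjI[of "substitute (linear_form g)", OF inv(1)] ..
  \<comment> \<open>\<open>H\<close> is constant on every coset of its kernel, so the image of a
    coset is a singleton.\<close>
  define \<phi> where "\<phi> = (\<lambda>C. the_elem (H ` C))"
  have iso: "\<phi> \<in> ring_iso (sklyanin s) (sklyanin t)"
    using h.FactRing_iso_set[OF surj] unfolding ker \<phi>_def sklyanin_def[of s] .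
  have val: "\<phi> (sklyanin_class s f) = sklyanin_class t (substitute (linear_form g) f)" for f
    using h.the_elem_simp[of f] unfolding ker \<phi>_def sklyanin_class_def[of s] by (simp add: H_def)
  have "\<phi> ` sklyanin_component s n = sklyanin_component t n" for n
  proof -
    have "substitute (linear_form g) ` homogeneous n = homogeneous n"
    proof (intro Set.equalityI subsetI)
      fix f :: "'k free_alg" assume "f \<in> homogeneous n"
      then have "substitute (linear_form h) f \<in> homogeneous n" by (rule substitute_homogeneous)
      then show "f \<in> substitute (linear_form g) ` homogeneous n" using inv(1)[of f] by (metis image_eqI)
    qed (use substitute_homogeneous in blast)
    then show ?thesis
      unfolding sklyanin_component_def image_image val by (metis image_image)
  qed
  moreover have "\<phi> (sklyanin_class s (scal c)) = sklyanin_class t (scal c)" for c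
    by (simp add: val substitute_scal)
  ultimately show ?thesis
    unfolding sklyanin_isomorphic_def s_def[symmetric] t_def[symmetric] using iso by blast
qed

lemma sklyanin_isomorphic_refl: "sklyanin_isomorphic s s"
  unfolding sklyanin_isomorphic_def by (rule bexI[OF _ ring_iso_set_refl]) simp

lemma sklyanin_isomorphic_trans:
  assumes "sklyanin_isomorphic s t" "sklyanin_isomorphic t r"
  shows "sklyanin_isomorphic s r"
proof -
  obtain \<phi> where f: "\<phi> \<in> ring_iso (sklyanin s) (sklyanin t)"
    "\<And>c. \<phi> (sklyanin_class s (scal c)) = sklyanin_class t (scal c)"
    "\<And>n. \<phi> ` sklyanin_component s n = sklyanin_component t n"
    using assms(1) unfolding sklyanin_isomorphic_def by auto
  obtain \<psi> where g: "\<psi> \<in> ring_iso (sklyanin t) (sklyanin r)"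
    "\<And>c. \<psi> (sklyanin_class t (scal c)) = sklyanin_class r (scal c)"
    "\<And>n. \<psi> ` sklyanin_component t n = sklyanin_component r n"
    using assms(2) unfolding sklyanin_isomorphic_def by auto
  have "(\<psi> \<circ> \<phi>) ` sklyanin_component s n = sklyanin_component r n" for n
    unfolding image_comp[symmetric] f(3) g(3) ..
  then show ?thesis
    unfolding sklyanin_isomorphic_def
    by (intro bexI[OF _ ring_iso_set_trans[OF f(1) g(1)]]) (simp add: f(2) g(2))
qed

lemma mat_mat_delta_column:
  assumes "mat_mat g h = delta"
  shows "mat_vec g (\<lambda>i. h i p) = delta p"
  using fun_cong[OF fun_cong[OF assms]] by (auto simp: fun_eq_iff mat_vec_def mat_mat_def delta_def)

text \<open>Basis vector p is the image under g of column p of h. Inserting this into the first slot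
  expresses the transformed relation p by the relations of the target, with coefficients l times
  column p of h.\<close>

lemma sklyanin_isomorphic_trilin:
  fixes g h :: "letter \<Rightarrow> letter \<Rightarrow> 'k::field"
  assumes gh: "mat_mat g h = delta" "mat_mat h g = delta" and l: "l \<noteq> 0"
    and T: "\<And>p q r. trilin a b (\<lambda>i. g i p) (\<lambda>i. g i q) (\<lambda>i. g i r) = l * potential a' b' p q r"
  shows "sklyanin_isomorphic (a, b, 1) (a', b', 1)"
proof -
  \<comment> \<open>Generalised over all data because it is used for g with l and for h with
    1/l.\<close>
  have maps: "substitute (linear_form g) (quadratic_form (potential a b p)) \<in> sklyanin_ideal (a', b', 1)"
    if gh: "mat_mat g h = delta"
      and T: "\<And>p q r. trilin a b (\<lambda>i. g i p) (\<lambda>i. g i q) (\<lambda>i. g i r) = l * potential a' b' p q r"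
    for a b a' b' l p and g h :: "letter \<Rightarrow> letter \<Rightarrow> 'k"
  proof -
    have "(\<Sum>i\<in>UNIV. \<Sum>j\<in>UNIV. potential a b p i j * (g i k * g j m)) = (\<Sum>x\<in>UNIV. (l * h x p) * potential a' b' x k m)" for k m
    proof -
      have "(\<Sum>i\<in>UNIV. \<Sum>j\<in>UNIV. potential a b p i j * (g i k * g j m)) = trilin a b (delta p) (\<lambda>i. g i k) (\<lambda>i. g i m)"
        by (cases p) (simp_all add: potential_def sum_letter trilin_def delta_def algebra_simps)
      also have "\<dots> = trilin a b (mat_vec g (\<lambda>i. h i p)) (\<lambda>i. g i k) (\<lambda>i. g i m)"
        by (simp add: mat_mat_delta_column[OF gh])
      also have "\<dots> = (\<Sum>x\<in>UNIV. (l * h x p) * potential a' b' x k m)"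
        unfolding trilin_mat_vec T by (simp add: mult_ac)
      finally show ?thesis .
    qed
    then have "substitute (linear_form g) (quadratic_form (potential a b p)) = (\<Sum>x\<in>UNIV. scal (l * h x p) * quadratic_form (potential a' b' x))"
      unfolding substitute_quadratic_form by (simp add: quadratic_form_sum quadratic_form_scal)
    also have "\<dots> \<in> sklyanin_ideal (a', b', 1)"
      by (intro ideal_sum ideal_closed(3) ideal_sklyanin relation_mem_ideal) simp_all
    finally show ?thesis .
  qed
  have T': "trilin a' b' (\<lambda>i. h i p) (\<lambda>i. h i q) (\<lambda>i. h i r) = inverse l * potential a b p q r" for p q r
    using trilin_mat_vec_all[of a b g, OF T, of "\<lambda>i. h i p" "\<lambda>i. h i q" "\<lambda>i. h i r"] l
    by (simp add: mat_mat_delta_column[OF gh(1)] potential_def field_simps)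
  show ?thesis
    using sklyanin_isomorphic_substitution[OF gh] maps[OF gh(1) T] maps[OF gh(2) T'] by blast
qed

text \<open>Preservation of the component of degree one provides linear representatives g for the
  images of the generators and h for their preimages. The composite is the identity on generators
  modulo the ideal, hence exactly, since linear forms embed.\<close>

lemma sklyanin_isomorphic_linear:
  fixes a b a' b' :: "'k::field"
  assumes "sklyanin_isomorphic (a, b, 1) (a', b', 1)"
  obtains g h where "mat_mat h g = delta"
    "\<And>p. substitute (linear_form g) (quadratic_form (potential a b p)) \<in> sklyanin_ideal (a', b', 1)"
proof -
  define s t where "s = (a, b, 1 :: 'k)" and "t = (a', b', 1 :: 'k)"
  obtain \<phi> where iso: "\<phi> \<in> ring_iso (sklyanin s) (sklyanin t)"
    and sc: "\<And>c. \<phi> (sklyanin_class s (scal c)) = sklyanin_class t (scal c)"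
    and comp: "\<And>n. \<phi> ` sklyanin_component s n = sklyanin_component t n"
    using assms unfolding sklyanin_isomorphic_def s_def t_def by blast
  have gen1: "gen l \<in> homogeneous 1" for l :: letter
    using linear_form_homogeneous[of delta l] by (simp add: linear_form_delta)
  have "\<exists>u. u \<in> homogeneous 1 \<and> \<phi> (sklyanin_class s (gen l)) = sklyanin_class t u" for l
  proof -
    have "\<phi> (sklyanin_class s (gen l)) \<in> sklyanin_component t 1"
      using comp[of 1] gen1 unfolding sklyanin_component_def by blast
    then show ?thesis unfolding sklyanin_component_def by blast
  qed
  then obtain v where v: "\<And>l. v l \<in> homogeneous 1" "\<And>l. \<phi> (sklyanin_class s (gen l)) = sklyanin_class t (v l)"
    by metis
  define g where "g = (\<lambda>l j. Poly_Mapping.lookup (v l) (Word [j]))"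
  have vg: "v = linear_form g"
    using homogeneous_1_linear_form[OF v(1)] unfolding g_def linear_form_def by (intro ext) blast
  have "\<exists>u. u \<in> homogeneous 1 \<and> \<phi> (sklyanin_class s u) = sklyanin_class t (gen l)" for l
  proof -
    have "sklyanin_class t (gen l) \<in> \<phi> ` sklyanin_component s 1"
      unfolding comp using gen1 unfolding sklyanin_component_def by blast
    then show ?thesis unfolding sklyanin_component_def by auto
  qed
  then obtain u where u: "\<And>l. u l \<in> homogeneous 1" "\<And>l. \<phi> (sklyanin_class s (u l)) = sklyanin_class t (gen l)"
    by metis
  define h where "h = (\<lambda>l j. Poly_Mapping.lookup (u l) (Word [j]))"
  have uh: "u = linear_form h"
    using homogeneous_1_linear_form[OF u(1)] unfolding h_def linear_form_def by (intro ext) blast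
  have "\<phi> \<in> ring_hom (sklyanin s) (sklyanin t)" using iso by (simp add: ring_iso_def)
  then have "\<phi> \<circ> sklyanin_class s \<in> ring_hom free_ring (sklyanin t)"
    using ring_hom_trans[OF sklyanin_class_hom] by blast
  from free_ring_hom_eq[OF this class_substitute_hom[of t "linear_form g"]]
  have val: "\<phi> (sklyanin_class s f) = sklyanin_class t (substitute (linear_form g) f)" for f
    by (simp add: sc substitute_scal substitute_gen v(2) vg)
  have "mat_mat h g = delta"
  proof (intro ext)
    fix l j
    have "sklyanin_class t (substitute (linear_form g) (linear_form h l)) = sklyanin_class t (gen l)"
      using u(2)[of l] val uh by simp
    then have "linear_form (mat_mat h g) l - gen l \<in> sklyanin_ideal t"
      by (simp add: sklyanin_class_eq_iff substitute_linear_form)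
    then have "linear_form (mat_mat h g) l = linear_form delta l"
      unfolding t_def linear_form_delta using sklyanin_ideal_linear linear_form_homogeneous gen1 by blast
    then show "mat_mat h g l j = delta l j" by (metis lookup_linear_form)
  qed
  moreover have "substitute (linear_form g) (quadratic_form (potential a b p)) \<in> sklyanin_ideal t" for p
  proof -
    have "sklyanin_class s (quadratic_form (potential a b p)) = sklyanin_class s 0"
      using relation_mem_ideal[of a b p] by (simp add: sklyanin_class_eq_iff s_def)
    then have "sklyanin_class t (substitute (linear_form g) (quadratic_form (potential a b p))) = sklyanin_class t (substitute (linear_form g) 0)"
      using val by metis
    then show ?thesis by (simp add: sklyanin_class_eq_iff substitute_def)
  qed
  ultimately show ?thesis using that unfolding t_def by blast
qed

lemma trilin_cyclic: "trilin a b u v w = trilin a b v w u"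
  by (simp add: trilin_def algebra_simps)

text \<open>
  \<open>V \<otimes> R \<inter> R \<otimes> V\<close> is spanned by the potential, where \<open>R\<close> is the space of relations. For the
  tensors that occur here cyclic invariance makes the two coefficient matrices transposes of each other.
\<close>

lemma scalar_of_cyclic:
  fixes P :: "letter \<Rightarrow> letter \<Rightarrow> 'k::field"
  assumes M: "(a, b) \<noteq> (0, 0)" "(a ^ 3 - 1, b ^ 3 - 1) \<noteq> (0, 0)"
    and E: "\<And>m j k. (\<Sum>q\<in>UNIV. P m q * potential a b q j k) = (\<Sum>q\<in>UNIV. P k q * potential a b q m j)"
  obtains l where "P = (\<lambda>i j. l * delta i j)"
proof -
  have E': "P m Lx * potential a b Lx j k + P m Ly * potential a b Ly j k + P m Lz * potential a b Lz j k =
      P k Lx * potential a b Lx m j + P k Ly * potential a b Ly m j + P k Lz * potential a b Lz m j" for m j k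
    using E[of m j k] unfolding sum_letter .
  note potential_values = potential_def trilin_def delta_def
  \<comment> \<open>Index triples with three distinct letters link the diagonal entries of P; those
    with a repeated letter link the off-diagonal ones.\<close>
  have diag: "a * P Lx Lx = a * P Lz Lz" "a * P Ly Ly = a * P Lx Lx" "a * P Lz Lz = a * P Ly Ly"
    "b * P Lx Lx = b * P Ly Ly" "b * P Ly Ly = b * P Lz Lz" "b * P Lz Lz = b * P Lx Lx"
    using E'[of Lx Ly Lz] E'[of Ly Lz Lx] E'[of Lz Lx Ly] E'[of Lx Lz Ly] E'[of Ly Lx Lz] E'[of Lz Ly Lx]
    by (simp_all add: potential_values mult.commute)
  have upper: "P Lx Ly = a * P Ly Lz" "P Ly Lz = a * P Lz Lx" "P Lz Lx = a * P Lx Ly"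
    "a * P Lx Ly = b * P Lx Ly" "a * P Ly Lz = b * P Ly Lz" "a * P Lz Lx = b * P Lz Lx"
    using E'[of Lx Ly Ly] E'[of Ly Lz Lz] E'[of Lz Lx Lx] E'[of Lx Lz Lx] E'[of Ly Lx Ly] E'[of Lz Ly Lz]
    by (simp_all add: potential_values mult.commute)
  have lower: "a * P Lx Lz = P Ly Lx" "a * P Ly Lx = P Lz Ly" "a * P Lz Ly = P Lx Lz"
    "b * P Lx Lz = a * P Lx Lz" "b * P Ly Lx = a * P Ly Lx" "b * P Lz Ly = a * P Lz Ly"
    using E'[of Lx Lx Ly] E'[of Ly Ly Lz] E'[of Lz Lz Lx] E'[of Lx Ly Lx] E'[of Ly Lz Ly] E'[of Lz Lx Lz]
    by (simp_all add: potential_values mult.commute)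
  \<comment> \<open>Going once around a cycle of three off-diagonal entries multiplies an entry by
    a^3. A nonzero entry would thus give a^3 = 1 and a = b, which is the excluded case a^3 = b^3 =
    1.\<close>
  have vanish: "p = 0" if "p = a ^ 3 * p" "a * p = b * p" for p
  proof (rule ccontr)
    assume "p \<noteq> 0"
    then have "a ^ 3 = 1" "a = b" using that by auto
    then show False using M(2) by simp
  qed
  have "P Lx Ly = a ^ 3 * P Lx Ly" "P Ly Lz = a ^ 3 * P Ly Lz" "P Lz Lx = a ^ 3 * P Lz Lx"
    using upper(1-3) by (simp_all add: power3_eq_cube mult.assoc)
  then have "P Lx Ly = 0" "P Ly Lz = 0" "P Lz Lx = 0" using upper(4-6) vanish by blast+
  moreover have "P Lx Lz = a ^ 3 * P Lx Lz" "P Ly Lx = a ^ 3 * P Ly Lx" "P Lz Ly = a ^ 3 * P Lz Ly"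
    using lower(1-3) by (simp_all add: power3_eq_cube mult.assoc)
  then have "P Lx Lz = 0" "P Ly Lx = 0" "P Lz Ly = 0" using lower(4-6)[symmetric] vanish by blast+
  \<comment> \<open>One of a and b is nonzero and can be cancelled in \<open>diag\<close>.\<close>
  moreover have "P Ly Ly = P Lx Lx" "P Lz Lz = P Lx Lx" using diag M(1) by auto
  ultimately have "P i j = P Lx Lx * delta i j" for i j
    by (cases i; cases j) (simp_all add: delta_def)
  then show ?thesis using that by blast
qed

text \<open>Each transformed relation is a combination H of target relations. Contracting the
  remaining slot with g turns H into P, the product of the transpose of g with H, and cyclic
  invariance of the source form makes P scalar.\<close>

lemma trilin_if_isomorphic:
  fixes a b a' b' :: "'k::field"
  assumes iso: "sklyanin_isomorphic (a, b, 1) (a', b', 1)"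
    and M: "(a', b') \<noteq> (0, 0)" "(a' ^ 3 - 1, b' ^ 3 - 1) \<noteq> (0, 0)"
  obtains g l where "det3 g \<noteq> 0"
    "\<And>p q r. trilin a b (\<lambda>i. g i p) (\<lambda>i. g i q) (\<lambda>i. g i r) = l * potential a' b' p q r"
proof -
  obtain g h where gh: "mat_mat h g = delta"
    and mem: "\<And>p. substitute (linear_form g) (quadratic_form (potential a b p)) \<in> sklyanin_ideal (a', b', 1)"
    using sklyanin_isomorphic_linear[OF iso] by blast
  have "det3 h * det3 g = 1" using arg_cong[OF gh, of det3] by (simp add: det3_mat_mat det3_delta)
  then have det: "det3 g \<noteq> 0" by auto
  have "\<exists>H. \<forall>k m. (\<Sum>i\<in>UNIV. \<Sum>j\<in>UNIV. potential a b p i j * (g i k * g j m)) = (\<Sum>q\<in>UNIV. H q * potential a' b' q k m)" for p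
    using sklyanin_ideal_quadratic_form[OF mem[of p, unfolded substitute_quadratic_form]] .
  then obtain H where H: "\<And>p k m. (\<Sum>i\<in>UNIV. \<Sum>j\<in>UNIV. potential a b p i j * (g i k * g j m)) = (\<Sum>q\<in>UNIV. H p q * potential a' b' q k m)"
    by metis
  define P where "P = (\<lambda>m q. \<Sum>i\<in>UNIV. g i m * H i q)"
  have T: "trilin a b (\<lambda>i. g i m) (\<lambda>i. g i j) (\<lambda>i. g i k) = (\<Sum>q\<in>UNIV. P m q * potential a' b' q j k)" for m j k
  proof -
    have "trilin a b (\<lambda>i. g i m) (\<lambda>i. g i j) (\<lambda>i. g i k) =
        (\<Sum>p\<in>UNIV. g p m * (\<Sum>i\<in>UNIV. \<Sum>i'\<in>UNIV. potential a b p i i' * (g i j * g i' k)))"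
      by (simp add: trilin_expand sum_distrib_left mult_ac)
    then show ?thesis unfolding H P_def by (simp add: sum_letter algebra_simps)
  qed
  have "(\<Sum>q\<in>UNIV. P m q * potential a' b' q j k) = (\<Sum>q\<in>UNIV. P k q * potential a' b' q m j)" for m j k
    using T[of m j k] T[of k m j] trilin_cyclic by metis
  then obtain l where "P = (\<lambda>i j. l * delta i j)" using scalar_of_cyclic[OF M] by blast
  then have "trilin a b (\<lambda>i. g i p) (\<lambda>i. g i q) (\<lambda>i. g i r) = l * potential a' b' p q r" for p q r
    unfolding T by (cases p) (simp_all add: sum_letter delta_def)
  then show ?thesis using that det by blast
qed

section \<open>The action of the special linear group\<close>

lemma cases_3:
  fixes x :: 3
  obtains "x = 0" | "x = 1" | "x = 2"
proof -
  have "x = 1 \<or> x = 2 \<or> x = 3" by (rule exhaust_3)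
  moreover have "(3::3) = 0" by simp
  ultimately show ?thesis using that by auto
qed

lemma numerals_mod_3: "(3::3) = 0" "(4::3) = 1"
  by simp_all

context cube_root
begin

text \<open>The isomorphism of the additive group of Z_3 with the cube roots of unity; through it
  matrix entries act as exponents of \<theta>.\<close>

definition zeta :: "3 \<Rightarrow> 'k" where
  "zeta x = (if x = 0 then 1 else if x = 1 then \<theta> else \<theta> ^ 2)"

lemma zeta_simps [simp]: "zeta 0 = 1" "zeta 1 = \<theta>" "zeta 2 = \<theta> ^ 2"
  by (simp_all add: zeta_def)

lemma theta4: "\<theta> ^ 4 = \<theta>"
  using cube by Groebner_Basis.algebra

text \<open>Rewrite rules that bring polynomials in \<omega> to degree at most one. The third is the
  second with a trailing factor, as it occurs in products nested to the right.\<close>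

lemma omega_reduce:
  assumes "\<omega> ^ 3 = (1::'k)" "\<omega> \<noteq> 1"
  shows "\<omega> ^ 2 = - \<omega> - 1" "\<omega> * \<omega> = - \<omega> - 1" "\<omega> * (\<omega> * x) = - (\<omega> * x) - x"
proof -
  show 2: "\<omega> ^ 2 = - \<omega> - 1" using omega_sum[OF assms] by Groebner_Basis.algebra
  then show *: "\<omega> * \<omega> = - \<omega> - 1" by (simp add: power2_eq_square)
  have "\<omega> * (\<omega> * x) = (\<omega> * \<omega>) * x" by (simp only: mult.assoc)
  also have "\<dots> = - (\<omega> * x) - x" unfolding * by (simp add: algebra_simps)
  finally show "\<omega> * (\<omega> * x) = - (\<omega> * x) - x" .
qed

lemmas theta_reduce = omega_reduce[OF cube ne1[symmetric]]

lemma theta_ne: "\<theta> \<noteq> 1" "\<theta> ^ 2 \<noteq> 1" "\<theta> ^ 2 \<noteq> \<theta>"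
  using ne1 cube_root.ne1[OF cube_root_pow2] theta_ne_0 by (auto simp: power2_eq_square)

lemma zeta_add: "zeta (x + y) = zeta x * zeta y"
proof -
  have "\<theta> * \<theta> ^ 2 = 1" "\<theta> ^ 2 * \<theta> = 1" "\<theta> ^ 2 * \<theta> ^ 2 = \<theta>"
    using cube by Groebner_Basis.algebra+
  moreover have "\<theta> * \<theta> = \<theta> ^ 2" by (simp add: power2_eq_square)
  ultimately show ?thesis
    by (cases x rule: cases_3; cases y rule: cases_3) (simp_all add: numerals_mod_3)
qed

lemma zeta_cube: "zeta x ^ 3 = 1"
  using cube cube_root.cube[OF cube_root_pow2] by (cases x rule: cases_3) simp_all

lemma zeta_ne_0: "zeta x \<noteq> 0"
  using zeta_cube[of x] by auto

lemma zeta_inject [simp]: "zeta x = zeta y \<longleftrightarrow> x = y"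
  using theta_ne theta_ne[symmetric] by (cases x rule: cases_3; cases y rule: cases_3) simp_all

lemma zeta_surj:
  assumes "x ^ 3 = 1"
  obtains j where "x = zeta j"
  using cube_root_cases[OF assms] zeta_simps by metis

text \<open>For \<kappa> = \<eta> = 1 and \<omega> = \<theta> this is the formula of
  \<open>fourier_map\<close>. In general \<kappa> is a dilation performed afterwards and, for a cube
  root of unity \<eta>, 1/\<eta> is a dilation performed before.\<close>

definition rot :: "'k \<Rightarrow> 'k \<Rightarrow> 'k \<Rightarrow> 'k \<times> 'k \<Rightarrow> 'k \<times> 'k" where
  "rot \<kappa> \<eta> \<omega> = (\<lambda>(a, b).
     (\<kappa> * (\<omega> * a + \<omega> ^ 2 * b + \<eta>) / (a + b + \<eta>), \<kappa> * (\<omega> ^ 2 * a + \<omega> * b + \<eta>) / (a + b + \<eta>)))"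

definition dilate :: "'k \<Rightarrow> 'k \<times> 'k \<Rightarrow> 'k \<times> 'k" where
  "dilate \<epsilon> = (\<lambda>(a, b). (\<epsilon> * a, \<epsilon> * b))"

lemma paramM_denom:
  assumes "(a, b) \<in> paramM" "\<eta> ^ 3 = (1::'k)"
  shows "a + b + \<eta> \<noteq> 0"
proof
  assume "a + b + \<eta> = 0"
  then have "(a + b) ^ 3 = - (\<eta> ^ 3)" by Groebner_Basis.algebra
  then show False using assms by (simp add: paramM_def)
qed

text \<open>The factor \<epsilon> cancels from numerator and denominator and leaves its inverse
  \<epsilon>^2 as constant; the swap exchanges \<theta> and \<theta>^2.\<close>

lemma fourier_dilate:
  assumes "\<epsilon> ^ 3 = (1::'k)" "u \<in> paramM"
  shows "rot 1 1 \<theta> (dilate \<epsilon> u) = rot 1 (\<epsilon> ^ 2) \<theta> u"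
    and "rot 1 1 \<theta> (dilate \<epsilon> (prod.swap u)) = rot 1 (\<epsilon> ^ 2) (\<theta> ^ 2) u"
proof -
  obtain a b where u: "u = (a, b)" by fastforce
  have e0: "\<epsilon> \<noteq> 0" using assms by auto
  have "(\<epsilon> ^ 2) ^ 3 = 1" using assms(1) by Groebner_Basis.algebra
  then have d: "a + b + \<epsilon> ^ 2 \<noteq> 0" using paramM_denom assms u by blast
  have "\<epsilon> * (a + b + \<epsilon> ^ 2) = \<epsilon> * a + \<epsilon> * b + 1" "\<epsilon> * (a + b + \<epsilon> ^ 2) = \<epsilon> * b + \<epsilon> * a + 1"
    using assms(1) by Groebner_Basis.algebra+
  then have *: "\<epsilon> * a + \<epsilon> * b + 1 = \<epsilon> * (a + b + \<epsilon> ^ 2)" "\<epsilon> * b + \<epsilon> * a + 1 = \<epsilon> * (a + b + \<epsilon> ^ 2)"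
    by simp_all
  have **: "x * (\<epsilon> * a) + y * (\<epsilon> * b) + 1 = \<epsilon> * (x * a + y * b + \<epsilon> ^ 2)"
    "x * (\<epsilon> * b) + y * (\<epsilon> * a) + 1 = \<epsilon> * (y * a + x * b + \<epsilon> ^ 2)" for x y
    using assms(1) by Groebner_Basis.algebra+
  have t: "(\<theta> ^ 2) ^ 2 = \<theta>" using cube by Groebner_Basis.algebra
  show "rot 1 1 \<theta> (dilate \<epsilon> u) = rot 1 (\<epsilon> ^ 2) \<theta> u"
    "rot 1 1 \<theta> (dilate \<epsilon> (prod.swap u)) = rot 1 (\<epsilon> ^ 2) (\<theta> ^ 2) u"
    using d e0 by (simp_all add: u rot_def dilate_def * ** theta4)
qed

text \<open>Composition of two fractional maps: the inner denominator cancels, and c is the constant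
  that the new numerators and denominator still share, namely 3 or 1 - \<kappa> below.\<close>

lemma rot_rot:
  assumes "(a, b) \<in> paramM" "\<eta> ^ 3 = (1::'k)"
    and d: "\<kappa> * (\<omega> * a + \<omega> ^ 2 * b + \<eta>) + \<kappa> * (\<omega> ^ 2 * a + \<omega> * b + \<eta>) + (a + b + \<eta>) = c * d'"
    and n: "\<theta> * (\<kappa> * (\<omega> * a + \<omega> ^ 2 * b + \<eta>)) + \<theta> ^ 2 * (\<kappa> * (\<omega> ^ 2 * a + \<omega> * b + \<eta>)) + (a + b + \<eta>) = c * n1"
      "\<theta> ^ 2 * (\<kappa> * (\<omega> * a + \<omega> ^ 2 * b + \<eta>)) + \<theta> * (\<kappa> * (\<omega> ^ 2 * a + \<omega> * b + \<eta>)) + (a + b + \<eta>) = c * n2"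
    and "c \<noteq> 0"
  shows "rot 1 1 \<theta> (rot \<kappa> \<eta> \<omega> (a, b)) = (n1 / d', n2 / d')"
proof -
  have D: "a + b + \<eta> \<noteq> 0" using paramM_denom assms(1,2) by blast
  have *: "x * (p / D) + y * (q / D) + 1 = (x * p + y * q + D) / D"
      "p / D + q / D + 1 = (p + q + D) / D" if "D \<noteq> 0" for x y p q D :: 'k
    using that by (simp_all add: field_simps)
  show ?thesis
    unfolding rot_def prod.case mult_1 power_one
    using D \<open>c \<noteq> 0\<close> by (simp only: *[OF D] n d) simp
qed

text \<open>For \<kappa> = 1 the sums over cube roots of unity reduce the denominator to 3\<eta>, so
  a dilation remains. The swap in the first case reflects that the discrete Fourier transform
  applied twice is a reflection.\<close>

lemma fourier_rot_1:
  assumes "\<eta> ^ 3 = (1::'k)" "u \<in> paramM"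
  shows "rot 1 1 \<theta> (rot 1 \<eta> \<theta> u) = dilate (\<eta> ^ 2) (prod.swap u)"
    and "rot 1 1 \<theta> (rot 1 \<eta> (\<theta> ^ 2) u) = dilate (\<eta> ^ 2) u"
proof -
  obtain a b where u: "u = (a, b)" by fastforce
  have e0: "\<eta> \<noteq> 0" using assms by auto
  have inv: "x / \<eta> = \<eta> ^ 2 * x" for x
    using assms(1) e0 by (simp add: field_simps power2_eq_square power3_eq_cube)
  have "rot 1 1 \<theta> (rot 1 \<eta> \<theta> u) = (b / \<eta>, a / \<eta>)"
    unfolding u
    by (rule rot_rot[where c = 3])
      (use assms u three_ne_0 in \<open>simp_all add: theta_reduce power2_eq_square algebra_simps\<close>)
  then show "rot 1 1 \<theta> (rot 1 \<eta> \<theta> u) = dilate (\<eta> ^ 2) (prod.swap u)"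
    by (simp add: dilate_def u inv)
  have "rot 1 1 \<theta> (rot 1 \<eta> (\<theta> ^ 2) u) = (a / \<eta>, b / \<eta>)"
    unfolding u
    by (rule rot_rot[where c = 3])
      (use assms u three_ne_0 in \<open>simp_all add: theta_reduce power2_eq_square algebra_simps\<close>)
  then show "rot 1 1 \<theta> (rot 1 \<eta> (\<theta> ^ 2) u) = dilate (\<eta> ^ 2) u"
    by (simp add: dilate_def u inv)
qed

text \<open>For \<kappa> \<noteq> 1 the new denominator is (1 - \<kappa>)(a + b) + (1 +
  2\<kappa>)\<eta>, and 1 + 2\<kappa> = \<kappa>(1 - \<kappa>). The common factor 1 - \<kappa>
  cancels and the result is again a fractional map.\<close>

lemma fourier_rot_2:
  assumes "\<eta> ^ 3 = (1::'k)" "u \<in> paramM" "\<kappa> ^ 3 = 1" "\<kappa> \<noteq> 1"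
  shows "rot 1 1 \<theta> (rot \<kappa> \<eta> \<theta> u) = rot (\<kappa> ^ 2) (\<kappa> * \<eta>) \<kappa> u"
    and "rot 1 1 \<theta> (rot \<kappa> \<eta> (\<theta> ^ 2) u) = rot (\<kappa> ^ 2) (\<kappa> * \<eta>) (\<kappa> ^ 2) u"
proof -
  obtain a b where u: "u = (a, b)" by fastforce
  have c: "1 - \<kappa> \<noteq> 0" using assms by simp
  have "rot 1 1 \<theta> (rot \<kappa> \<eta> \<theta> u) = ((\<kappa> ^ 2 * (\<kappa> * a + \<kappa> ^ 2 * b + \<kappa> * \<eta>)) / (a + b + \<kappa> * \<eta>),
     (\<kappa> ^ 2 * (\<kappa> ^ 2 * a + \<kappa> * b + \<kappa> * \<eta>)) / (a + b + \<kappa> * \<eta>))"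
    unfolding u by (rule rot_rot[where c = "1 - \<kappa>"])
      (use assms u c in \<open>simp_all add: theta_reduce omega_reduce[OF assms(3,4)] power2_eq_square algebra_simps\<close>)
  then show "rot 1 1 \<theta> (rot \<kappa> \<eta> \<theta> u) = rot (\<kappa> ^ 2) (\<kappa> * \<eta>) \<kappa> u"
    by (simp add: rot_def u)
  have k4: "\<kappa> ^ 4 = \<kappa>" using assms(3) by Groebner_Basis.algebra
  have "rot 1 1 \<theta> (rot \<kappa> \<eta> (\<theta> ^ 2) u) = ((\<kappa> ^ 2 * (\<kappa> ^ 2 * a + \<kappa> * b + \<kappa> * \<eta>)) / (a + b + \<kappa> * \<eta>),
     (\<kappa> ^ 2 * (\<kappa> * a + \<kappa> ^ 2 * b + \<kappa> * \<eta>)) / (a + b + \<kappa> * \<eta>))"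
    unfolding u by (rule rot_rot[where c = "1 - \<kappa>"])
      (use assms u c in \<open>simp_all add: theta_reduce omega_reduce[OF assms(3,4)] power2_eq_square algebra_simps\<close>)
  then show "rot 1 1 \<theta> (rot \<kappa> \<eta> (\<theta> ^ 2) u) = rot (\<kappa> ^ 2) (\<kappa> * \<eta>) (\<kappa> ^ 2) u"
    by (simp add: rot_def u k4)
qed

text \<open>
  The map induced by the matrix with rows \<open>(\<alpha>, \<beta>)\<close> and \<open>(\<gamma>, \<delta>)\<close>. The formula is read off the Bruhat
  decomposition: for \<open>\<gamma> = 1\<close> the matrix is \<open>S\<^sup>\<alpha> F S\<^sup>\<delta>\<close> with \<open>S\<close> acting as \<^const>\<open>scale_map\<close> and \<open>F\<close> as
  \<^const>\<open>fourier_map\<close>, and \<open>-1\<close> acts as the swap \<open>(a, b) \<mapsto> (b, a)\<close>.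
\<close>

definition act4 :: "3 \<Rightarrow> 3 \<Rightarrow> 3 \<Rightarrow> 3 \<Rightarrow> 'k \<times> 'k \<Rightarrow> 'k \<times> 'k" where
  "act4 \<alpha> \<beta> \<gamma> \<delta> u =
     (if \<gamma> = 0 then dilate (zeta (\<alpha> * \<beta>)) (if \<alpha> = 1 then u else prod.swap u)
      else rot (zeta (\<gamma> * \<alpha>)) (zeta (- \<gamma> * \<delta>)) (zeta \<gamma>) u)"

text \<open>Left multiplication by S adds the second row to the first. Only the dilation factor
  feels this, and it gains exactly \<theta>: for \<gamma> \<noteq> 0 because \<gamma>^2 = 1, for
  \<gamma> = 0 because \<alpha>\<delta> = 1.\<close>

lemma act4_scale:
  assumes "\<alpha> * \<delta> - \<beta> * \<gamma> = 1"
  shows "act4 (\<alpha> + \<gamma>) (\<beta> + \<delta>) \<gamma> \<delta> u = dilate \<theta> (act4 \<alpha> \<beta> \<gamma> \<delta> u)"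
proof (cases "\<gamma> = 0")
  case True
  then have "zeta (\<alpha> * (\<beta> + \<delta>)) = \<theta> * zeta (\<alpha> * \<beta>)"
    using assms by (simp add: distrib_left zeta_add mult.commute)
  then show ?thesis using True by (cases u) (simp add: act4_def dilate_def mult.assoc)
next
  case False
  then have "\<gamma> * \<gamma> = 1" by (cases \<gamma> rule: cases_3) simp_all
  then have "zeta (\<gamma> * (\<alpha> + \<gamma>)) = \<theta> * zeta (\<gamma> * \<alpha>)"
    by (simp add: distrib_left zeta_add mult.commute)
  then show ?thesis using False by (cases u) (simp add: act4_def dilate_def rot_def mult.assoc)
qed

lemma zeta_uminus: "zeta (- x) = zeta x ^ 2"
proof -
  have "zeta (- x) * zeta x = 1" by (simp flip: zeta_add)
  moreover have "zeta x ^ 2 * zeta x = 1" using zeta_cube[of x] by (simp add: power2_eq_square power3_eq_cube)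
  ultimately show ?thesis using zeta_ne_0[of x] by (metis mult_right_cancel)
qed

lemma act4_fourier:
  assumes det: "\<alpha> * \<delta> - \<beta> * \<gamma> = 1" and u: "u \<in> paramM"
  shows "act4 (- \<gamma>) (- \<delta>) \<alpha> \<beta> u = rot 1 1 \<theta> (act4 \<alpha> \<beta> \<gamma> \<delta> u)"
proof -
  \<comment> \<open>Left multiplication by F makes \<alpha> the lower left entry. Cases 1 and 2
    leave the triangular matrices, 3 and 4 enter them, and in 5 and 6 neither matrix is
    triangular.\<close>
  consider "\<gamma> = 0" "\<alpha> = 1" | "\<gamma> = 0" "\<alpha> = 2" | "\<gamma> = 1" "\<alpha> = 0" | "\<gamma> = 2" "\<alpha> = 0"
    | "\<gamma> = 1" "\<alpha> \<noteq> 0" | "\<gamma> = 2" "\<alpha> \<noteq> 0"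
    using det by (cases \<alpha> rule: cases_3; cases \<gamma> rule: cases_3) simp_all
  then show ?thesis
  proof cases
    case 1
    then show ?thesis using fourier_dilate(1)[OF zeta_cube u, of \<beta>] by (simp add: act4_def zeta_uminus)
  next
    case 2
    then show ?thesis using fourier_dilate(2)[OF zeta_cube u, of "2 * \<beta>"]
      by (simp add: act4_def zeta_uminus)
  next
    case 3
    then show ?thesis using fourier_rot_1(1)[OF zeta_cube u, of "- \<delta>"]
      by (simp add: act4_def flip: zeta_uminus)
  next
    case 4
    then show ?thesis using fourier_rot_1(2)[OF zeta_cube u, of "- 2 * \<delta>"]
      by (simp add: act4_def flip: zeta_uminus)
  next
    case 5
    \<comment> \<open>With \<gamma> = 1 the determinant gives \<beta> = \<alpha>\<delta> - 1, and
      \<alpha>^2 = 1.\<close>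
    then have "- (\<alpha> * \<beta>) = \<alpha> - \<delta>"
      using det by (cases \<alpha> rule: cases_3; cases \<beta> rule: cases_3; cases \<delta> rule: cases_3) simp_all
    moreover have "zeta \<alpha> \<noteq> 1" using 5 zeta_inject[of \<alpha> 0] by simp
    ultimately show ?thesis using 5 fourier_rot_2(1)[OF zeta_cube[of "- \<delta>"] u zeta_cube[of \<alpha>]]
      by (simp add: act4_def flip: zeta_add zeta_uminus)
  next
    case 6
    have mod3: "\<gamma> * \<alpha> = - \<alpha>" "- \<gamma> * \<delta> = \<delta>" "\<alpha> * - \<gamma> = \<alpha>" "- \<alpha> * \<beta> = - \<alpha> + \<delta>"
      using det 6
      by (cases \<alpha> rule: cases_3; cases \<beta> rule: cases_3; cases \<delta> rule: cases_3; simp)+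
    have "zeta (- \<alpha>) \<noteq> 1" using 6 zeta_inject[of "- \<alpha>" 0] by simp
    moreover have "(zeta (- \<alpha>)) ^ 2 = zeta \<alpha>" by (simp flip: zeta_uminus)
    moreover have "zeta (- \<alpha>) * zeta \<delta> = zeta (\<delta> - \<alpha>)" by (simp flip: zeta_add)
    moreover have "\<gamma> \<noteq> 0" "zeta \<gamma> = \<theta> ^ 2" using 6 by simp_all
    ultimately show ?thesis
      using fourier_rot_2(2)[OF zeta_cube[of \<delta>] u zeta_cube[of "- \<alpha>"]] 6(2)
      unfolding act4_def mod3 by simp
  qed
qed

lemma dilate_paramM:
  assumes "u \<in> paramM" "\<epsilon> ^ 3 = (1::'k)"
  shows "dilate \<epsilon> u \<in> paramM"
proof -
  obtain a b where u: "u = (a, b)" by fastforce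
  have "\<epsilon> \<noteq> 0" using assms by auto
  moreover have "(\<epsilon> * a + \<epsilon> * b) ^ 3 = (a + b) ^ 3" "(\<epsilon> * a) ^ 3 = a ^ 3" "(\<epsilon> * b) ^ 3 = b ^ 3"
    using assms(2) by (simp_all add: power_mult_distrib flip: distrib_left)
  ultimately show ?thesis using assms(1) by (simp add: u dilate_def paramM_def)
qed

text \<open>The identities N1 + N2 + D = 3 and N1 - N2 = (\<theta> - \<theta>^2)(a - b) turn each
  excluded case for the image into an excluded case for (a, b).\<close>

lemma fourier_paramM:
  assumes "u \<in> paramM"
  shows "rot 1 1 \<theta> u \<in> paramM"
proof -
  obtain a b where u: "u = (a, b)" by fastforce
  define N1 N2 D where "N1 = \<theta> * a + \<theta> ^ 2 * b + 1" and "N2 = \<theta> ^ 2 * a + \<theta> * b + 1" and "D = a + b + 1"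
  have D: "D \<noteq> 0" using paramM_denom[of a b 1] assms by (simp add: u D_def)
  have r: "rot 1 1 \<theta> u = (N1 / D, N2 / D)" by (simp add: u rot_def N1_def N2_def D_def)
  have dd: "D ^ 3 \<noteq> 0" using D by simp
  have "(N1 + N2) ^ 3 + D ^ 3 \<noteq> 0"
  proof -
    have s: "N1 + N2 = 3 - D" unfolding N1_def N2_def D_def
      by (simp add: theta_reduce algebra_simps)
    \<comment> \<open>The cubic terms of (3 - D)^3 + D^3 cancel; what remains is 9 times the
      cofactor of a + b + 1 in (a + b)^3 + 1.\<close>
    have "(N1 + N2) ^ 3 + D ^ 3 = 9 * ((a + b) ^ 2 - (a + b) + 1)"
      unfolding s D_def by (simp add: algebra_simps power2_eq_square power3_eq_cube)
    moreover have "((a + b) ^ 2 - (a + b) + 1) * (a + b + 1) = (a + b) ^ 3 + 1"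
      by (simp add: algebra_simps power2_eq_square power3_eq_cube)
    then have "(a + b) ^ 2 - (a + b) + 1 \<noteq> 0" using assms by (auto simp: u paramM_def)
    moreover have "(9::'k) = 3 * 3" by simp
    then have "(9::'k) \<noteq> 0" using three_ne_0 by (metis mult_eq_0_iff)
    ultimately show ?thesis by (metis mult_eq_0_iff)
  qed
  then have 1: "(N1 / D + N2 / D) ^ 3 + 1 \<noteq> 0"
    using D dd by (simp add: power_divide flip: add_divide_distrib) (simp add: field_simps)
  have 2: "\<not> (N1 = 0 \<and> N2 = 0)"
  proof
    assume *: "N1 = 0 \<and> N2 = 0"
    then have "N1 + N2 = 0" "N1 - N2 = 0" by simp_all
    then have "a + b = 2" "(\<theta> - \<theta> ^ 2) * (a - b) = 0"
      unfolding N1_def N2_def by (simp_all add: theta_reduce algebra_simps) 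
    then have "a = b" "2 * a = 2" using theta_ne by auto
    have "\<theta> * a + \<theta> ^ 2 * a + 1 = 0" using * \<open>a = b\<close> by (simp add: N1_def)
    then have "a = 1" by (simp add: theta_reduce algebra_simps)
    then show False using assms \<open>a = b\<close> by (simp add: u paramM_def)
  qed
  have 3: "\<not> ((N1 / D) ^ 3 = 1 \<and> (N2 / D) ^ 3 = 1)"
  proof
    assume *: "(N1 / D) ^ 3 = 1 \<and> (N2 / D) ^ 3 = 1"
    then obtain i j where ij: "N1 = zeta i * D" "N2 = zeta j * D"
      using zeta_surj D by (metis nonzero_divide_eq_eq)
    have n: "N1 + N2 + D = 3" unfolding N1_def N2_def D_def by (simp add: theta_reduce algebra_simps)
    have "zeta i + zeta j + 1 \<noteq> 0" using n ij three_ne_0 by (metis add.commute distrib_right mult_1 mult_zero_left)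
    \<comment> \<open>For distinct i and j: if neither is 0, the two roots and 1 add up to 0; if one
      is 0, the two roots add up to minus the third one, whose cube is -1.\<close>
    then have "i = j \<or> (zeta i + zeta j) ^ 3 + 1 = 0"
      using cube theta_sum
      by (cases i rule: cases_3; cases j rule: cases_3)
         (simp_all add: theta_reduce power2_eq_square power3_eq_cube algebra_simps)
    moreover have "(zeta i + zeta j) ^ 3 + 1 \<noteq> 0"
    proof
      assume "(zeta i + zeta j) ^ 3 + 1 = 0"
      moreover have "N1 / D + N2 / D = zeta i + zeta j" using ij D by simp
      ultimately show False using 1 by simp
    qed
    ultimately have "N1 = N2" using ij by simp
    moreover have "N1 - N2 = (\<theta> - \<theta> ^ 2) * (a - b)" by (simp add: N1_def N2_def algebra_simps)
    ultimately have ab: "a = b" using theta_ne by auto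
    have "1 - a = zeta i * (2 * a + 1)"
      using ij(1) unfolding N1_def D_def ab by (simp add: theta_reduce algebra_simps)
    \<comment> \<open>For a primitive root \<open>zeta i\<close> the equation becomes
      \<open>zeta i * a = 1\<close>; for the root 1 it reads 3 a = 0. Both are excluded when a =
      b.\<close>
    moreover have "zeta i = 1 \<or> 2 * zeta i + 1 = zeta i * (1 - zeta i)"
      by (cases i rule: cases_3) (simp_all add: theta_reduce power2_eq_square algebra_simps)
    moreover have "(1 - zeta i) * (zeta i * a - 1) = (2 * zeta i + 1) * a - (1 - zeta i)" if "2 * zeta i + 1 = zeta i * (1 - zeta i)"
      unfolding that by (simp add: algebra_simps)
    ultimately have "3 * a = 0 \<or> (1 - zeta i) * (zeta i * a - 1) = 0 \<and> zeta i \<noteq> 1"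
      by (cases "zeta i = 1") (auto simp: algebra_simps)
    then have "a = 0 \<or> zeta i * a = 1" using three_ne_0 by auto
    moreover have "a ^ 3 = 1" if "zeta i * a = 1"
      using that zeta_cube[of i] by (metis mult_1 power_mult_distrib power_one)
    ultimately show False using assms ab by (auto simp: u paramM_def)
  qed
  show ?thesis unfolding r paramM_def using 1 2 3 D by auto
qed

end

section \<open>Matrices over Z_3 as words in two generators\<close>

definition mat22 :: "3 \<Rightarrow> 3 \<Rightarrow> 3 \<Rightarrow> 3 \<Rightarrow> 3^2^2" where
  "mat22 \<alpha> \<beta> \<gamma> \<delta> = vector [vector [\<alpha>, \<beta>], vector [\<gamma>, \<delta>]]"

lemma mat22_nth [simp]:
  "mat22 \<alpha> \<beta> \<gamma> \<delta> $ 1 $ 1 = \<alpha>" "mat22 \<alpha> \<beta> \<gamma> \<delta> $ 1 $ 2 = \<beta>"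
  "mat22 \<alpha> \<beta> \<gamma> \<delta> $ 2 $ 1 = \<gamma>" "mat22 \<alpha> \<beta> \<gamma> \<delta> $ 2 $ 2 = \<delta>"
  by (simp_all add: mat22_def)

lemma mat22_inject: "mat22 \<alpha> \<beta> \<gamma> \<delta> = mat22 \<alpha>' \<beta>' \<gamma>' \<delta>' \<longleftrightarrow> \<alpha> = \<alpha>' \<and> \<beta> = \<beta>' \<and> \<gamma> = \<gamma>' \<and> \<delta> = \<delta>'"
  by (metis mat22_nth)

lemma mat22_eta: "A = mat22 (A $ 1 $ 1) (A $ 1 $ 2) (A $ 2 $ 1) (A $ 2 $ 2)"
  by (simp add: vec_eq_iff forall_2)

lemma det_mat22: "det (mat22 \<alpha> \<beta> \<gamma> \<delta>) = \<alpha> * \<delta> - \<beta> * \<gamma>"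
  by (simp add: det_2)

lemma mat22_mult: "mat22 \<alpha> \<beta> \<gamma> \<delta> ** mat22 \<alpha>' \<beta>' \<gamma>' \<delta>' =
    mat22 (\<alpha> * \<alpha>' + \<beta> * \<gamma>') (\<alpha> * \<beta>' + \<beta> * \<delta>') (\<gamma> * \<alpha>' + \<delta> * \<gamma>') (\<gamma> * \<beta>' + \<delta> * \<delta>')"
  by (simp add: vec_eq_iff forall_2 matrix_matrix_mult_def sum_2)

lemma mat_mat22: "mat 1 = mat22 1 0 0 1"
  by (simp add: vec_eq_iff forall_2 mat_def)

lemma SL2_Z3_carrier: "A \<in> carrier SL2_Z3 \<longleftrightarrow> (\<exists>\<alpha> \<beta> \<gamma> \<delta>. A = mat22 \<alpha> \<beta> \<gamma> \<delta> \<and> \<alpha> * \<delta> - \<beta> * \<gamma> = 1)"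
  by (metis (mono_tags, lifting) SL2_Z3_def det_mat22 mem_Collect_eq mat22_eta partial_object.select_convs(1))

lemma group_SL2_Z3: "group SL2_Z3"
proof (rule groupI)
  fix A assume "A \<in> carrier SL2_Z3"
  then obtain \<alpha> \<beta> \<gamma> \<delta> where A: "A = mat22 \<alpha> \<beta> \<gamma> \<delta>" "\<alpha> * \<delta> - \<beta> * \<gamma> = 1"
    using SL2_Z3_carrier by blast
  then have "mat22 \<delta> (- \<beta>) (- \<gamma>) \<alpha> \<in> carrier SL2_Z3"
    unfolding SL2_Z3_carrier by (metis minus_mult_minus mult.commute)
  moreover have "mat22 \<delta> (- \<beta>) (- \<gamma>) \<alpha> ** A = mat 1"
    using A by (simp add: mat22_mult mat_mat22 mat22_inject algebra_simps)
  ultimately show "\<exists>B\<in>carrier SL2_Z3. B \<otimes>\<^bsub>SL2_Z3\<^esub> A = \<one>\<^bsub>SL2_Z3\<^esub>"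
    by (auto simp: SL2_Z3_def)
qed (auto simp: SL2_Z3_def det_mul matrix_mul_assoc)

text \<open>The rules are left multiplication by S with rows (1, 1), (0, 1) and by F with rows (0,
  -1), (1, 0). The predicate supplies the induction by which statements about the two generators
  extend to all of the special linear group.\<close>

inductive sl2_word :: "3 \<Rightarrow> 3 \<Rightarrow> 3 \<Rightarrow> 3 \<Rightarrow> bool" where
  one: "sl2_word 1 0 0 1"
| scale: "sl2_word \<alpha> \<beta> \<gamma> \<delta> \<Longrightarrow> sl2_word (\<alpha> + \<gamma>) (\<beta> + \<delta>) \<gamma> \<delta>"
| fourier: "sl2_word \<alpha> \<beta> \<gamma> \<delta> \<Longrightarrow> sl2_word (- \<gamma>) (- \<delta>) \<alpha> \<beta>"

lemma sl2_word_det: "sl2_word \<alpha> \<beta> \<gamma> \<delta> \<Longrightarrow> \<alpha> * \<delta> - \<beta> * \<gamma> = 1"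
  by (induction rule: sl2_word.induct) (simp_all add: algebra_simps)

text \<open>Row reduction: if \<gamma> \<noteq> 0 then \<alpha> is a multiple of \<gamma> and is
  cleared by powers of S; F then turns a matrix with \<alpha> = 0 into a triangular one, and two
  applications of F give the sign.\<close>

lemma sl2_word_complete:
  assumes "\<alpha> * \<delta> - \<beta> * \<gamma> = 1"
  shows "sl2_word \<alpha> \<beta> \<gamma> \<delta>"
proof -
  have upper: "sl2_word 1 \<beta> 0 1" for \<beta>
  proof -
    have "sl2_word 1 1 0 1" using sl2_word.scale[OF sl2_word.one] by simp
    moreover from sl2_word.scale[OF this] have "sl2_word 1 2 0 1" by simp
    ultimately show ?thesis using sl2_word.one by (cases \<beta> rule: cases_3) simp_all
  qed
  have upper': "sl2_word 2 \<beta> 0 2" for \<beta>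
  proof -
    have neg: "(-1::3) = 2" by simp
    have "sl2_word (-1) \<beta> 0 (-1)"
      using sl2_word.fourier[OF sl2_word.fourier[OF upper[of "- \<beta>"]]] by simp
    then show ?thesis unfolding neg .
  qed
  have lower: "sl2_word 0 \<beta> \<gamma> \<delta>" if "- (\<beta> * \<gamma>) = 1" for \<beta> \<gamma> \<delta>
  proof -
    have neg: "(-1::3) = 2" "(-2::3) = 1" by simp_all
    have "sl2_word 0 2 1 \<delta>" "sl2_word 0 1 2 \<delta>"
      using sl2_word.fourier[OF upper[of \<delta>]] sl2_word.fourier[OF upper'[of \<delta>]]
      unfolding neg by simp_all
    then show ?thesis
      using that by (cases \<beta> rule: cases_3; cases \<gamma> rule: cases_3) simp_all
  qed
  show ?thesis
  proof (cases "\<gamma> = 0")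
    case True
    then show ?thesis using assms upper[of \<beta>] upper'[of \<beta>]
      by (cases \<alpha> rule: cases_3; cases \<delta> rule: cases_3) simp_all
  next
    case False
    then consider "\<alpha> = 0" | "\<alpha> = \<gamma>" | "\<alpha> = \<gamma> + \<gamma>"
      by (cases \<alpha> rule: cases_3; cases \<gamma> rule: cases_3) (simp_all add: numerals_mod_3)
    then show ?thesis
    proof cases
      case 1
      then show ?thesis using lower assms by simp
    next
      case 2
      then have "- ((\<beta> - \<delta>) * \<gamma>) = 1" using assms by (simp add: algebra_simps)
      from sl2_word.scale[OF lower[OF this, of \<delta>]] show ?thesis using 2 by simp
    next
      case 3
      then have "- ((\<beta> - \<delta> - \<delta>) * \<gamma>) = 1" using assms by (simp add: algebra_simps)
      from sl2_word.scale[OF sl2_word.scale[OF lower[OF this, of \<delta>]]] show ?thesis using 3 by simp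
    qed
  qed
qed

text \<open>Sorted by the lower left entry: 6 triangular matrices, and 18 with \<gamma> \<noteq> 0,
  where \<alpha> and \<delta> are free and \<beta> = (\<alpha>\<delta> - 1)\<gamma> because \<gamma>
  is its own inverse.\<close>

lemma card_SL2_Z3: "card (carrier SL2_Z3) = 24"
proof -
  define U where "U = (\<lambda>(\<alpha>, \<beta>). mat22 \<alpha> \<beta> 0 \<alpha>) ` ({1, 2} \<times> {0, 1, 2})"
  define L where "L = (\<lambda>(\<alpha>, \<gamma>, \<delta>). mat22 \<alpha> ((\<alpha> * \<delta> - 1) * \<gamma>) \<gamma> \<delta>) ` ({0, 1, 2} \<times> {1, 2} \<times> {0, 1, 2})"
  have "carrier SL2_Z3 = U \<union> L"
  proof (intro Set.set_eqI iffI)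
    fix A assume "A \<in> carrier SL2_Z3"
    then obtain \<alpha> \<beta> \<gamma> \<delta> where A: "A = mat22 \<alpha> \<beta> \<gamma> \<delta>" "\<alpha> * \<delta> - \<beta> * \<gamma> = 1"
      using SL2_Z3_carrier by blast
    show "A \<in> U \<union> L"
      using A unfolding U_def L_def image_iff
      by (cases \<alpha> rule: cases_3; cases \<beta> rule: cases_3; cases \<gamma> rule: cases_3; cases \<delta> rule: cases_3)
         (simp_all add: mat22_inject numerals_mod_3)
  next
    fix A assume "A \<in> U \<union> L"
    then show "A \<in> carrier SL2_Z3"
      unfolding U_def L_def by (auto simp: SL2_Z3_def det_mat22)
  qed
  moreover have "card U = 6"
    unfolding U_def by (subst card_image) (auto simp: inj_on_def mat22_inject)
  moreover have "card L = 18"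
    unfolding L_def by (subst card_image) (auto simp: inj_on_def mat22_inject)
  moreover have "U \<inter> L = {}" by (auto simp: U_def L_def mat22_inject)
  moreover have "finite U" "finite L" by (simp_all add: U_def L_def)
  ultimately show ?thesis by (simp add: card_Un_disjoint)
qed

section \<open>The permutation action on M and the generated group\<close>

context cube_root
begin

definition act :: "3^2^2 \<Rightarrow> 'k \<times> 'k \<Rightarrow> 'k \<times> 'k" where
  "act A = restrict (act4 (A $ 1 $ 1) (A $ 1 $ 2) (A $ 2 $ 1) (A $ 2 $ 2)) paramM"

lemma act_mat22: "u \<in> paramM \<Longrightarrow> act (mat22 \<alpha> \<beta> \<gamma> \<delta>) u = act4 \<alpha> \<beta> \<gamma> \<delta> u"
  by (simp add: act_def)

lemma act4_one: "act4 1 0 0 1 u = u"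
  by (cases u) (simp add: act4_def dilate_def)

lemma act4_paramM:
  assumes "sl2_word \<alpha> \<beta> \<gamma> \<delta>" and u: "u \<in> paramM"
  shows "act4 \<alpha> \<beta> \<gamma> \<delta> u \<in> paramM"
  using assms(1)
proof (induction rule: sl2_word.induct)
  case one
  then show ?case using u by (simp add: act4_one)
next
  case (scale \<alpha> \<beta> \<gamma> \<delta>)
  then show ?case by (simp add: act4_scale sl2_word_det dilate_paramM cube)
next
  case (fourier \<alpha> \<beta> \<gamma> \<delta>)
  then show ?case using u by (simp add: act4_fourier sl2_word_det fourier_paramM)
qed

text \<open>Induction on the word of the left factor: multiplying it by a generator multiplies the
  product by the same generator, and \<open>act4_scale\<close> or \<open>act4_fourier\<close>
  applies to both sides.\<close>

lemma act4_mult: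
  assumes "sl2_word \<alpha> \<beta> \<gamma> \<delta>" and w: "sl2_word \<alpha>' \<beta>' \<gamma>' \<delta>'" and u: "u \<in> paramM"
  shows "act4 (\<alpha> * \<alpha>' + \<beta> * \<gamma>') (\<alpha> * \<beta>' + \<beta> * \<delta>') (\<gamma> * \<alpha>' + \<delta> * \<gamma>') (\<gamma> * \<beta>' + \<delta> * \<delta>') u
    = act4 \<alpha> \<beta> \<gamma> \<delta> (act4 \<alpha>' \<beta>' \<gamma>' \<delta>' u)"
  using assms(1)
proof (induction rule: sl2_word.induct)
  case one
  then show ?case by (simp add: act4_one)
next
  case (scale \<alpha> \<beta> \<gamma> \<delta>)
  have "(\<alpha> * \<alpha>' + \<beta> * \<gamma>') * (\<gamma> * \<beta>' + \<delta> * \<delta>') - (\<alpha> * \<beta>' + \<beta> * \<delta>') * (\<gamma> * \<alpha>' + \<delta> * \<gamma>')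
     = (\<alpha> * \<delta> - \<beta> * \<gamma>) * (\<alpha>' * \<delta>' - \<beta>' * \<gamma>')"
    by (simp add: algebra_simps)
  also have "\<dots> = 1" using scale w by (simp add: sl2_word_det)
  finally show ?case
    using act4_scale[of "\<alpha> * \<alpha>' + \<beta> * \<gamma>'" "\<gamma> * \<beta>' + \<delta> * \<delta>'" "\<alpha> * \<beta>' + \<beta> * \<delta>'" "\<gamma> * \<alpha>' + \<delta> * \<gamma>'" u]
      scale by (simp add: act4_scale sl2_word_det algebra_simps)
next
  case (fourier \<alpha> \<beta> \<gamma> \<delta>)
  have "(\<alpha> * \<alpha>' + \<beta> * \<gamma>') * (\<gamma> * \<beta>' + \<delta> * \<delta>') - (\<alpha> * \<beta>' + \<beta> * \<delta>') * (\<gamma> * \<alpha>' + \<delta> * \<gamma>')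
     = (\<alpha> * \<delta> - \<beta> * \<gamma>) * (\<alpha>' * \<delta>' - \<beta>' * \<gamma>')"
    by (simp add: algebra_simps)
  also have "\<dots> = 1" using fourier w by (simp add: sl2_word_det)
  finally show ?case
    using act4_fourier[of "\<alpha> * \<alpha>' + \<beta> * \<gamma>'" "\<gamma> * \<beta>' + \<delta> * \<delta>'" "\<alpha> * \<beta>' + \<beta> * \<delta>'" "\<gamma> * \<alpha>' + \<delta> * \<gamma>'" u]
      fourier u act4_fourier[of \<alpha> \<delta> \<beta> \<gamma> "act4 \<alpha>' \<beta>' \<gamma>' \<delta>' u"] act4_paramM[OF w u]
    by (simp add: sl2_word_det algebra_simps)
qed

lemma carrier_SL2_Z3_word:
  assumes "A \<in> carrier SL2_Z3"
  obtains \<alpha> \<beta> \<gamma> \<delta> where "A = mat22 \<alpha> \<beta> \<gamma> \<delta>" "sl2_word \<alpha> \<beta> \<gamma> \<delta>"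
  using assms SL2_Z3_carrier sl2_word_complete by blast

lemma act_paramM:
  assumes "A \<in> carrier SL2_Z3" "u \<in> paramM"
  shows "act A u \<in> paramM"
  using assms(1) by (rule carrier_SL2_Z3_word) (simp add: act_mat22 act4_paramM assms(2))

lemma act_mult:
  assumes "A \<in> carrier SL2_Z3" "B \<in> carrier SL2_Z3"
  shows "act (A ** B) = compose paramM (act A) (act B)"
proof
  fix u
  obtain \<alpha> \<beta> \<gamma> \<delta> where A: "A = mat22 \<alpha> \<beta> \<gamma> \<delta>" "sl2_word \<alpha> \<beta> \<gamma> \<delta>"
    using assms(1) by (rule carrier_SL2_Z3_word)
  obtain \<alpha>' \<beta>' \<gamma>' \<delta>' where B: "B = mat22 \<alpha>' \<beta>' \<gamma>' \<delta>'" "sl2_word \<alpha>' \<beta>' \<gamma>' \<delta>'"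
    using assms(2) by (rule carrier_SL2_Z3_word)
  show "act (A ** B) u = compose paramM (act A) (act B) u"
  proof (cases "u \<in> paramM")
    case True
    then show ?thesis
      using A B by (simp add: compose_eq mat22_mult act_mat22 act4_mult act4_paramM)
  next
    case False
    then show ?thesis by (simp add: act_def compose_def)
  qed
qed

lemma act_one: "act (mat 1) = (\<lambda>u\<in>paramM. u)"
  by (auto simp: fun_eq_iff act_def mat_mat22 act4_one)

lemma act_Bij:
  assumes A: "A \<in> carrier SL2_Z3"
  shows "act A \<in> Bij paramM"
proof -
  interpret group SL2_Z3 by (rule group_SL2_Z3)
  define B where "B = inv\<^bsub>SL2_Z3\<^esub> A"
  have B: "B \<in> carrier SL2_Z3" using A by (simp add: B_def)
  have AB: "A ** B = mat 1" "B ** A = mat 1"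
    using r_inv[OF A] l_inv[OF A] unfolding B_def[symmetric] by (simp_all add: SL2_Z3_def)
  have inv: "act A (act B u) = u" "act B (act A u) = u" if "u \<in> paramM" for u
    using act_mult[OF A B] act_mult[OF B A] AB act_one that
    by (metis compose_eq restrict_apply')+
  have "bij_betw (act A) paramM paramM"
    by (rule bij_betw_byWitness[where f' = "act B"]) (auto simp: inv act_paramM A B)
  then show ?thesis by (simp add: Bij_def act_def)
qed

lemma act_hom: "act \<in> hom SL2_Z3 (BijGroup paramM)"
proof (rule homI)
  fix A B assume "A \<in> carrier SL2_Z3" "B \<in> carrier SL2_Z3"
  then show "act (A \<otimes>\<^bsub>SL2_Z3\<^esub> B) = act A \<otimes>\<^bsub>BijGroup paramM\<^esub> act B"
    using act_mult act_Bij by (simp add: BijGroup_def SL2_Z3_def)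
qed (simp add: BijGroup_def act_Bij)

definition SL_S :: "3^2^2" where "SL_S = mat22 1 1 0 1"
definition SL_F :: "3^2^2" where "SL_F = mat22 0 (-1) 1 0"

lemma SL_gen_carrier: "SL_S \<in> carrier SL2_Z3" "SL_F \<in> carrier SL2_Z3"
  by (simp_all add: SL_S_def SL_F_def SL2_Z3_def det_mat22)

lemma act_SL_S: "act SL_S = scale_map \<theta>"
  by (auto simp: fun_eq_iff act_def SL_S_def scale_map_def act4_def dilate_def restrict_def)

lemma act_SL_F: "act SL_F = fourier_map \<theta>"
  by (auto simp: fun_eq_iff act_def SL_F_def fourier_map_def act4_def rot_def restrict_def)

lemma generators_Bij: "scale_map \<theta> \<in> Bij paramM" "fourier_map \<theta> \<in> Bij paramM"
  using act_Bij[OF SL_gen_carrier(1)] act_Bij[OF SL_gen_carrier(2)] by (simp_all add: act_SL_S act_SL_F)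

text \<open>The image of a homomorphism is a subgroup, and this one contains both generators;
  conversely the word of a matrix spells its image in the generators.\<close>

lemma carrier_sklyanin_group: "carrier (sklyanin_group \<theta>) = act ` carrier SL2_Z3"
proof -
  interpret B: group "BijGroup paramM :: ('k \<times> 'k \<Rightarrow> 'k \<times> 'k) monoid" by (rule group_BijGroup)
  interpret h: group_hom SL2_Z3 "BijGroup paramM" act
    using act_hom group_SL2_Z3 by (simp add: group_hom_def group_hom_axioms_def B.group_axioms)
  have gens: "{scale_map \<theta>, fourier_map \<theta>} \<subseteq> carrier (BijGroup paramM)"
    using generators_Bij by (simp add: BijGroup_def)
  have car: "carrier (sklyanin_group \<theta>) = generate (BijGroup paramM) {scale_map \<theta>, fourier_map \<theta>}"
    using gens by (simp add: sklyanin_group_def carrier_subgroup_generated Int_absorb1)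
  have "generate (BijGroup paramM) {scale_map \<theta>, fourier_map \<theta>} \<subseteq> act ` carrier SL2_Z3"
  proof (rule B.generate_subgroup_incl)
    show "{scale_map \<theta>, fourier_map \<theta>} \<subseteq> act ` carrier SL2_Z3"
      using SL_gen_carrier act_SL_S act_SL_F by (metis empty_subsetI image_eqI insert_subset)
  qed (rule h.img_is_subgroup)
  moreover have "act (mat22 \<alpha> \<beta> \<gamma> \<delta>) \<in> generate (BijGroup paramM) {scale_map \<theta>, fourier_map \<theta>}"
    if "sl2_word \<alpha> \<beta> \<gamma> \<delta>" for \<alpha> \<beta> \<gamma> \<delta>
    using that
  proof (induction rule: sl2_word.induct)
    case one
    have "act (mat22 1 0 0 1) = \<one>\<^bsub>BijGroup paramM\<^esub>"
      by (simp add: BijGroup_def act_one flip: mat_mat22)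
    then show ?case by (simp add: generate.one)
  next
    case (scale \<alpha> \<beta> \<gamma> \<delta>)
    have "mat22 (\<alpha> + \<gamma>) (\<beta> + \<delta>) \<gamma> \<delta> = SL_S \<otimes>\<^bsub>SL2_Z3\<^esub> mat22 \<alpha> \<beta> \<gamma> \<delta>"
      by (simp add: SL_S_def SL2_Z3_def mat22_mult)
    moreover have "mat22 \<alpha> \<beta> \<gamma> \<delta> \<in> carrier SL2_Z3"
      using scale sl2_word_det SL2_Z3_carrier by blast
    ultimately show ?case
      using scale SL_gen_carrier by (simp add: act_SL_S generate.eng generate.incl)
  next
    case (fourier \<alpha> \<beta> \<gamma> \<delta>)
    have "mat22 (- \<gamma>) (- \<delta>) \<alpha> \<beta> = SL_F \<otimes>\<^bsub>SL2_Z3\<^esub> mat22 \<alpha> \<beta> \<gamma> \<delta>"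
      by (simp add: SL_F_def SL2_Z3_def mat22_mult)
    moreover have "mat22 \<alpha> \<beta> \<gamma> \<delta> \<in> carrier SL2_Z3"
      using fourier sl2_word_det SL2_Z3_carrier by blast
    ultimately show ?case
      using fourier SL_gen_carrier by (simp add: act_SL_F generate.eng generate.incl)
  qed
  then have "act ` carrier SL2_Z3 \<subseteq> generate (BijGroup paramM) {scale_map \<theta>, fourier_map \<theta>}"
    by (auto elim!: carrier_SL2_Z3_word)
  ultimately show ?thesis using car by blast
qed

lemma group_action_sklyanin_group: "group_action (sklyanin_group \<theta>) paramM (\<lambda>g. g)"
proof -
  interpret B: group "BijGroup paramM :: ('k \<times> 'k \<Rightarrow> 'k \<times> 'k) monoid" by (rule group_BijGroup)
  have "(\<lambda>g. g) \<in> hom (sklyanin_group \<theta>) (BijGroup paramM)"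
    by (auto simp: hom_def sklyanin_group_def dest: B.carrier_subgroup_generated_subset[THEN subsetD])
  then show ?thesis
    by (simp add: group_action_def group_hom_def group_hom_axioms_def B.group_axioms sklyanin_group_def
        B.group_subgroup_generated)
qed

lemma orbit_sklyanin_group:
  "orbit (sklyanin_group \<theta>) (\<lambda>g. g) u = (\<lambda>A. act A u) ` carrier SL2_Z3"
  unfolding orbit_def carrier_sklyanin_group by auto

end

section \<open>The explicit list of pairs\<close>

lemma permutations_of_0_1_2:
  assumes "{j, k, m} = {0, 1, 2 :: nat}"
  shows "(j, k, m) \<in> {(0, 1, 2), (0, 2, 1), (1, 0, 2), (1, 2, 0), (2, 0, 1), (2, 1, 0)}"
proof -
  have "j \<in> {0, 1, 2}" "k \<in> {0, 1, 2}" "m \<in> {0, 1, 2}" using assms by blast+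
  moreover have "card {j, k, m} = 3" using assms by simp
  then have "distinct [j, k, m]" by (intro card_distinct) simp
  ultimately show ?thesis by auto
qed

context cube_root
begin

lemma equivalent_params_alt:
  "equivalent_params u v \<longleftrightarrow> (\<exists>\<epsilon>. \<epsilon> ^ 3 = 1 \<and> (v = dilate \<epsilon> u \<or> v = dilate \<epsilon> (prod.swap u))) \<or>
     (\<exists>\<kappa> \<eta> \<omega>. \<kappa> ^ 3 = 1 \<and> \<eta> ^ 3 = 1 \<and> \<omega> ^ 3 = 1 \<and> \<omega> \<noteq> (1::'k) \<and> v = rot \<kappa> \<eta> \<omega> u)"
  by (cases u; cases v) (simp add: equivalent_params_def dilate_def rot_def)

text \<open>Dilations, with or without the swap, come from triangular matrices, and fractional maps
  from matrices with \<gamma> = 1 or \<gamma> = 2 according to \<omega> = \<theta> or \<omega> =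
  \<theta>^2.\<close>

lemma equivalent_params_iff_act:
  assumes u: "u \<in> paramM"
  shows "equivalent_params u v \<longleftrightarrow> v \<in> (\<lambda>A. act A u) ` carrier SL2_Z3"
proof
  have act: "act4 \<alpha> \<beta> \<gamma> \<delta> u \<in> (\<lambda>A. act A u) ` carrier SL2_Z3" if "\<alpha> * \<delta> - \<beta> * \<gamma> = 1" for \<alpha> \<beta> \<gamma> \<delta>
    using that u SL2_Z3_carrier by (metis act_mat22 image_eqI)
  assume "equivalent_params u v"
  then consider (dilate) \<epsilon> where "\<epsilon> ^ 3 = 1" "v = dilate \<epsilon> u"
    | (swap) \<epsilon> where "\<epsilon> ^ 3 = 1" "v = dilate \<epsilon> (prod.swap u)"
    | (rot) \<kappa> \<eta> \<omega> where "\<kappa> ^ 3 = 1" "\<eta> ^ 3 = 1" "\<omega> ^ 3 = 1" "\<omega> \<noteq> 1" "v = rot \<kappa> \<eta> \<omega> u"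
    unfolding equivalent_params_alt by blast
  then show "v \<in> (\<lambda>A. act A u) ` carrier SL2_Z3"
  proof cases
    case dilate
    then obtain j where "\<epsilon> = zeta j" using zeta_surj by blast
    then show ?thesis using act[of 1 1 j 0] dilate by (simp add: act4_def)
  next
    case swap
    then obtain j where j: "\<epsilon> = zeta j" using zeta_surj by blast
    \<comment> \<open>The diagonal entry 2 = -1 gives the swap; the entry 2 j compensates for it,
      since 2 (2 j) = j.\<close>
    have "act4 2 (2 * j) 0 2 u = v" using swap j by (simp add: act4_def numerals_mod_3)
    then show ?thesis using act[of 2 2 "2 * j" 0] by simp
  next
    case rot
    then obtain k n where kn: "\<kappa> = zeta k" "\<eta> = zeta n" using zeta_surj by metis
    consider "\<omega> = \<theta>" | "\<omega> = \<theta> ^ 2" using primitive_cases[OF rot(3,4)] by blast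
    then show ?thesis
    proof cases
      case 1
      then have "act4 k (k * - n - 1) 1 (- n) u = v" using rot kn by (simp add: act4_def)
      then show ?thesis using act[of k "- n" "k * - n - 1" 1] by simp
    next
      case 2
      have f: "2 * (2 * k) = k" "- 2 * n = n" by (cases k rule: cases_3; simp) (cases n rule: cases_3; simp)
      \<comment> \<open>The entries solve \<gamma>\<alpha> = k, -\<gamma>\<delta> = n and
        determinant 1 for \<gamma> = 2.\<close>
      have "act4 (2 * k) ((2 * k * n - 1) * 2) 2 n u = rot (zeta (2 * (2 * k))) (zeta (- 2 * n)) (zeta 2) u"
        by (simp add: act4_def)
      also have "\<dots> = v" unfolding f using rot kn 2 by simp
      finally have "act4 (2 * k) ((2 * k * n - 1) * 2) 2 n u = v" .
      moreover have "2 * k * n - (2 * k * n - 1) * 2 * 2 = 1"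
        by (cases k rule: cases_3; cases n rule: cases_3; simp)
      ultimately show ?thesis using act[of "2 * k" n "(2 * k * n - 1) * 2" 2] by simp
    qed
  qed
next
  assume "v \<in> (\<lambda>A. act A u) ` carrier SL2_Z3"
  then obtain \<alpha> \<beta> \<gamma> \<delta> where v: "v = act4 \<alpha> \<beta> \<gamma> \<delta> u"
    using u by (auto elim!: carrier_SL2_Z3_word simp: act_mat22)
  show "equivalent_params u v"
  proof (cases "\<gamma> = 0")
    case True
    then show ?thesis unfolding equivalent_params_alt v act4_def using zeta_cube by auto
  next
    case False
    then have "zeta \<gamma> \<noteq> 1" using zeta_inject[of \<gamma> 0] by simp
    then show ?thesis unfolding equivalent_params_alt v act4_def if_not_P[OF False] using zeta_cube by blast
  qed
qed

lemma theta_power_surj: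
  assumes "x ^ 3 = (1::'k)"
  obtains j :: nat where "j \<in> {0, 1, 2}" "x = \<theta> ^ j"
  using cube_root_cases[OF assms] power_0 power_one_right by (metis insertCI)

lemma theta_power_cube: "(\<theta> ^ j) ^ 3 = 1"
  using cube by (metis power_commutes power_mult power_one mult.commute)

text \<open>In a fractional map with \<kappa> = \<theta>^m the coefficients \<kappa>\<omega> and
  \<kappa>\<omega>^2 are the two cube roots of unity other than \<kappa>, so the three exponents
  form a permutation. The constant term is \<kappa>\<eta>, whence its exponent m + n.\<close>

lemma equivalent_params_pairs:
  "{v. equivalent_params u v} = pairs_i \<theta> u \<union> pairs_ii \<theta> u \<union> pairs_iii \<theta> u"
proof -
  obtain a b where u: "u = (a, b)" by fastforce
  have t3: "\<theta> * \<theta> ^ 2 = 1" "\<theta> ^ 2 * \<theta> = 1" "\<theta> ^ 2 * \<theta> ^ 2 = \<theta>"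
    using cube by Groebner_Basis.algebra+
  note t3 = t3 cube theta4
  show ?thesis
  proof (intro Set.set_eqI iffI)
    fix v assume "v \<in> {v. equivalent_params u v}"
    then consider (dilate) \<epsilon> where "\<epsilon> ^ 3 = 1" "v = dilate \<epsilon> u"
      | (swap) \<epsilon> where "\<epsilon> ^ 3 = 1" "v = dilate \<epsilon> (prod.swap u)"
      | (rot) \<kappa> \<eta> \<omega> where "\<kappa> ^ 3 = 1" "\<eta> ^ 3 = 1" "\<omega> ^ 3 = 1" "\<omega> \<noteq> 1" "v = rot \<kappa> \<eta> \<omega> u"
      unfolding equivalent_params_alt by blast
    then show "v \<in> pairs_i \<theta> u \<union> pairs_ii \<theta> u \<union> pairs_iii \<theta> u"
    proof cases
      case dilate
      then show ?thesis by (auto simp: u pairs_i_def dilate_def elim!: theta_power_surj)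
    next
      case swap
      then show ?thesis by (auto simp: u pairs_ii_def dilate_def elim!: theta_power_surj)
    next
      case rot
      obtain n :: nat where n: "n \<in> {0, 1, 2}" "\<eta> = \<theta> ^ n" using rot(2) theta_power_surj by blast
      obtain m :: nat where m: "m \<in> {0, 1, 2}" "\<kappa> = \<theta> ^ m" using rot(1) theta_power_surj by blast
      have "\<exists>j k :: nat. {j, k, m} = {0, 1, 2} \<and> \<kappa> * \<omega> = \<theta> ^ j \<and> \<kappa> * \<omega> ^ 2 = \<theta> ^ k"
      proof (cases rule: primitive_cases[OF rot(3,4)])
        case 1
        consider "m = 0" | "m = 1" | "m = 2" using m(1) by auto
        then show ?thesis
        proof cases
          case 1
          then show ?thesis using m \<open>\<omega> = \<theta>\<close> by (intro exI[of _ 1] exI[of _ 2]) auto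
        next
          case 2
          then show ?thesis using m \<open>\<omega> = \<theta>\<close> t3
            by (intro exI[of _ 2] exI[of _ 0]) (auto simp: power2_eq_square)
        next
          case 3
          then show ?thesis using m \<open>\<omega> = \<theta>\<close> t3 by (intro exI[of _ 0] exI[of _ 1]) auto
        qed
      next
        case 2
        consider "m = 0" | "m = 1" | "m = 2" using m(1) by auto
        then show ?thesis
        proof cases
          case 1
          then show ?thesis using m \<open>\<omega> = \<theta> ^ 2\<close> t3 by (intro exI[of _ 2] exI[of _ 1]) auto
        next
          case 2
          then show ?thesis using m \<open>\<omega> = \<theta> ^ 2\<close> t3
            by (intro exI[of _ 0] exI[of _ 2]) (auto simp: power2_eq_square)
        next
          case 3
          then show ?thesis using m \<open>\<omega> = \<theta> ^ 2\<close> t3 by (intro exI[of _ 1] exI[of _ 0]) auto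
        qed
      qed
      then obtain j k :: nat where jk: "{j, k, m} = {0, 1, 2}" "\<kappa> * \<omega> = \<theta> ^ j" "\<kappa> * \<omega> ^ 2 = \<theta> ^ k"
        by blast
      have "\<kappa> * \<eta> = \<theta> ^ (m + n)" by (simp add: m n power_add)
      then have "\<kappa> * (\<omega> * a + \<omega> ^ 2 * b + \<eta>) = \<theta> ^ j * a + \<theta> ^ k * b + \<theta> ^ (m + n)"
        "\<kappa> * (\<omega> ^ 2 * a + \<omega> * b + \<eta>) = \<theta> ^ k * a + \<theta> ^ j * b + \<theta> ^ (m + n)"
        by (simp_all add: distrib_left flip: jk mult.assoc)
      then have "v = ((\<theta> ^ j * a + \<theta> ^ k * b + \<theta> ^ (m + n)) / (a + b + \<theta> ^ n),
          (\<theta> ^ k * a + \<theta> ^ j * b + \<theta> ^ (m + n)) / (a + b + \<theta> ^ n))"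
        unfolding rot(5) u rot_def by (simp add: n(2))
      then have "v \<in> pairs_iii \<theta> u"
        unfolding u pairs_iii_def prod.case mem_Collect_eq using n(1) jk(1) by blast
      then show ?thesis by blast
    qed
  next
    fix v assume "v \<in> pairs_i \<theta> u \<union> pairs_ii \<theta> u \<union> pairs_iii \<theta> u"
    then consider "v \<in> pairs_i \<theta> u" | "v \<in> pairs_ii \<theta> u" | "v \<in> pairs_iii \<theta> u" by blast
    then show "v \<in> {v. equivalent_params u v}"
    proof cases
      case 1
      then obtain j :: nat where "v = dilate (\<theta> ^ j) u" by (auto simp: u pairs_i_def dilate_def)
      then show ?thesis unfolding equivalent_params_alt using theta_power_cube by blast
    next
      case 2
      then obtain j :: nat where "v = dilate (\<theta> ^ j) (prod.swap u)" by (auto simp: u pairs_ii_def dilate_def)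
      then show ?thesis unfolding equivalent_params_alt using theta_power_cube by blast
    next
      case 3
      then obtain j k m n :: nat where n: "n \<in> {0, 1, 2}" and p: "{j, k, m} = {0, 1, 2}"
        and v: "v = ((\<theta> ^ j * a + \<theta> ^ k * b + \<theta> ^ (m + n)) / (a + b + \<theta> ^ n),
          (\<theta> ^ k * a + \<theta> ^ j * b + \<theta> ^ (m + n)) / (a + b + \<theta> ^ n))"
        unfolding u pairs_iii_def prod.case mem_Collect_eq by blast
      have "\<exists>\<omega>. \<omega> ^ 3 = 1 \<and> \<omega> \<noteq> 1 \<and> \<theta> ^ j = \<theta> ^ m * \<omega> \<and> \<theta> ^ k = \<theta> ^ m * \<omega> ^ 2"
      proof -
        have "\<theta> ^ j = \<theta> ^ m * \<theta> \<and> \<theta> ^ k = \<theta> ^ m * \<theta> ^ 2 \<or>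
            \<theta> ^ j = \<theta> ^ m * \<theta> ^ 2 \<and> \<theta> ^ k = \<theta> ^ m * (\<theta> ^ 2) ^ 2"
        proof -
          have "(\<theta> ^ 2) ^ 2 = \<theta>" "\<theta> * (\<theta> ^ 2) ^ 2 = \<theta> ^ 2" "\<theta> ^ 2 * (\<theta> ^ 2) ^ 2 = 1"
            using cube by Groebner_Basis.algebra+
          moreover have "\<theta> * \<theta> = \<theta> ^ 2" by (simp add: power2_eq_square)
          ultimately show ?thesis
            using permutations_of_0_1_2[OF p] t3(1-3)
            by (elim insertE emptyE) (simp_all only: prod.inject power_0 power_one_right mult_1 simp_thms)
        qed
        then show ?thesis
          using theta_ne cube cube_root.cube[OF cube_root_pow2] by metis
      qed
      then obtain \<omega> where w: "\<omega> ^ 3 = 1" "\<omega> \<noteq> 1" "\<theta> ^ j = \<theta> ^ m * \<omega>" "\<theta> ^ k = \<theta> ^ m * \<omega> ^ 2" by blast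
      have "v = rot (\<theta> ^ m) (\<theta> ^ n) \<omega> u"
        unfolding v u rot_def w by (simp add: power_add algebra_simps)
      then show ?thesis unfolding equivalent_params_alt using w theta_power_cube by blast
    qed
  qed
qed

section \<open>Stabilisers, faithfulness and counting\<close>

lemma act_free:
  assumes A: "A \<in> carrier SL2_Z3" and u: "(a, b) \<in> paramM" "a \<noteq> b" and fixed: "act A (a, b) = (a, b)"
  shows "A = mat 1"
proof -
  obtain \<alpha> \<beta> \<gamma> \<delta> where A: "A = mat22 \<alpha> \<beta> \<gamma> \<delta>" "sl2_word \<alpha> \<beta> \<gamma> \<delta>"
    using A by (rule carrier_SL2_Z3_word)
  have fix4: "act4 \<alpha> \<beta> \<gamma> \<delta> (a, b) = (a, b)" using fixed A u by (simp add: act_mat22)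
  note det = sl2_word_det[OF A(2)]
  have u0: "a \<noteq> 0 \<or> b \<noteq> 0" using u by auto
  show ?thesis
  proof (cases "\<gamma> = 0")
    case True
    define \<epsilon> where "\<epsilon> = zeta (\<alpha> * \<beta>)"
    have e3: "\<epsilon> ^ 3 = 1" by (simp add: \<epsilon>_def zeta_cube)
    have "\<alpha> = 1"
    proof (rule ccontr)
      assume "\<alpha> \<noteq> 1"
      then have "\<epsilon> * b = a" "\<epsilon> * a = b" using fix4 True by (simp_all add: act4_def dilate_def \<epsilon>_def)
      moreover from this have "\<epsilon> ^ 3 * a = b" by (simp add: power3_eq_cube mult.assoc)
      ultimately show False using u e3 by simp
    qed
    then have "\<epsilon> * a = a" "\<epsilon> * b = b" using fix4 True by (simp_all add: act4_def dilate_def \<epsilon>_def)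
    then have "\<epsilon> = 1" using u0 by auto
    then have "\<beta> = 0" using zeta_inject[of \<beta> 0] \<open>\<alpha> = 1\<close> by (simp add: \<epsilon>_def)
    then show ?thesis using A det True \<open>\<alpha> = 1\<close> by (simp add: mat_mat22)
  next
    case False
    define \<kappa> \<eta> \<omega> where "\<kappa> = zeta (\<gamma> * \<alpha>)" and "\<eta> = zeta (- \<gamma> * \<delta>)" and "\<omega> = zeta \<gamma>"
    have r: "\<kappa> \<noteq> 0" "\<eta> ^ 3 = 1" "\<omega> ^ 3 = 1"
      unfolding \<kappa>_def \<eta>_def \<omega>_def by (simp_all only: zeta_cube zeta_ne_0 not_False_eq_True)
    define D where "D = a + b + \<eta>"
    have D: "D \<noteq> 0" unfolding D_def using u r paramM_denom by blast
    have "rot \<kappa> \<eta> \<omega> (a, b) = (a, b)" using fix4 False by (simp add: act4_def \<kappa>_def \<eta>_def \<omega>_def)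
    then have "\<kappa> * (\<omega> * a + \<omega> ^ 2 * b + \<eta>) / D = a" "\<kappa> * (\<omega> ^ 2 * a + \<omega> * b + \<eta>) / D = b"
      unfolding rot_def D_def by simp_all
    then have *: "\<kappa> * (\<omega> * a + \<omega> ^ 2 * b + \<eta>) = a * D" "\<kappa> * (\<omega> ^ 2 * a + \<omega> * b + \<eta>) = b * D"
      using D by (simp_all add: divide_eq_eq)
    \<comment> \<open>Subtracting the two fixed point equations determines D, since a \<noteq> b.
      Putting D back into the first equation gives \<omega>^2 (a + b) = -\<eta>, so (a + b)^3 = -1,
      which M excludes.\<close>
    have "(a - b) * (\<kappa> * (\<omega> - \<omega> ^ 2) - D) =
        (\<kappa> * (\<omega> * a + \<omega> ^ 2 * b + \<eta>) - a * D) - (\<kappa> * (\<omega> ^ 2 * a + \<omega> * b + \<eta>) - b * D)"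
      by (simp add: algebra_simps)
    then have "(a - b) * (\<kappa> * (\<omega> - \<omega> ^ 2) - D) = 0" unfolding * by simp
    then have "D = \<kappa> * (\<omega> - \<omega> ^ 2)" using u by simp
    moreover have "\<kappa> * (\<omega> ^ 2 * (a + b) + \<eta>) =
        (\<kappa> * (\<omega> * a + \<omega> ^ 2 * b + \<eta>) - a * D) + a * (D - \<kappa> * (\<omega> - \<omega> ^ 2))"
      by (simp add: algebra_simps)
    ultimately have "\<kappa> * (\<omega> ^ 2 * (a + b) + \<eta>) = 0" using *(1) by simp
    then have "\<omega> ^ 2 * (a + b) = - \<eta>" using r by (simp add: eq_neg_iff_add_eq_0)
    then have "(\<omega> ^ 2) ^ 3 * (a + b) ^ 3 = - (\<eta> ^ 3)" by (metis power_mult_distrib power_minus_odd odd_numeral)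
    moreover have "(\<omega> ^ 2) ^ 3 = 1" using r(3) by Groebner_Basis.algebra
    ultimately have "(a + b) ^ 3 + 1 = 0" using r by simp
    then show ?thesis using u by (simp add: paramM_def)
  qed
qed

lemma act_inj:
  assumes u: "(a, b) \<in> paramM" "a \<noteq> b"
  shows "inj_on (\<lambda>A. act A (a, b)) (carrier SL2_Z3)"
proof (rule inj_onI)
  interpret group SL2_Z3 by (rule group_SL2_Z3)
  fix A B assume AB: "A \<in> carrier SL2_Z3" "B \<in> carrier SL2_Z3" "act A (a, b) = act B (a, b)"
  define C where "C = inv\<^bsub>SL2_Z3\<^esub> B"
  have C: "C \<in> carrier SL2_Z3" using AB by (simp add: C_def)
  have CB: "C ** B = mat 1" using l_inv[OF AB(2)] unfolding C_def[symmetric] by (simp add: SL2_Z3_def)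
  have CA: "C ** A \<in> carrier SL2_Z3" using m_closed[OF C AB(1)] by (simp add: SL2_Z3_def)
  have "act (C ** A) (a, b) = act (C ** B) (a, b)"
    using act_mult[OF C AB(1)] act_mult[OF C AB(2)] AB(3) u by (simp add: compose_eq)
  then have "C ** A = mat 1" using act_free[OF CA u] CB act_one u by simp
  then have "C \<otimes>\<^bsub>SL2_Z3\<^esub> A = C \<otimes>\<^bsub>SL2_Z3\<^esub> B" using CB by (simp add: SL2_Z3_def)
  then show "A = B" using AB C by simp
qed

lemma axis_point:
  assumes "c \<noteq> 0" "c ^ 3 + 1 \<noteq> (0::'k)"
  shows "(c, 0) \<in> paramM"
  using assms by (simp add: paramM_def)

text \<open>If every nonzero c satisfied c^3 = -1, then 1 = -1 and all nonzero cubes would be 1;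
  then (a + b)^3 + 1 \<noteq> 0 forces a = b, and no point of M is left. Axis points serve because
  their coordinates differ.\<close>

lemma paramM_nonempty_axis:
  assumes "(paramM :: ('k \<times> 'k) set) \<noteq> {}"
  obtains c :: 'k where "c \<noteq> 0" "(c, 0) \<in> paramM"
proof (rule ccontr)
  assume "\<not> thesis"
  then have *: "c = 0 \<or> c ^ 3 + 1 = 0" for c :: 'k using axis_point that by blast
  obtain a b :: 'k where ab: "(a, b) \<in> paramM" using assms by fastforce
  have two: "(1::'k) = - 1" using *[of 1] by (simp add: eq_neg_iff_add_eq_0)
  have "a + b = 0" using ab *[of "a + b"] by (auto simp: paramM_def)
  then have "a = - b" by (simp add: eq_neg_iff_add_eq_0)
  also have "\<dots> = b" using two by (metis mult_1 mult_minus_left)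
  finally have "a = b" .
  then have "a \<noteq> 0" "a ^ 3 - 1 \<noteq> 0" using ab by (auto simp: paramM_def)
  moreover have "a ^ 3 - 1 = a ^ 3 + 1"
  proof -
    have "a ^ 3 + 1 = a ^ 3 + - 1" by (rule arg_cong[OF two])
    then show ?thesis by simp
  qed
  ultimately show False using *[of a] by simp
qed

text \<open>Only the four roots of c (c^3 + 1) are unsuitable.\<close>

lemma infinite_axis:
  assumes "infinite (UNIV :: 'k set)"
  obtains c :: 'k where "c \<noteq> 0" "(c, 0) \<in> paramM"
proof (rule ccontr)
  assume "\<not> thesis"
  then have *: "c = 0 \<or> c ^ 3 + 1 = 0" for c :: 'k using axis_point that by blast
  have "c \<in> {0, - 1, - \<theta>, - (\<theta> ^ 2)}" for c :: 'k
  proof (cases "c = 0")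
    case False
    then have "1 = - (c ^ 3)" using *[of c] by (simp add: add_eq_0_iff)
    then have "(- c) ^ 3 = 1" by simp
    then show ?thesis by (metis cube_root_cases insertCI minus_minus)
  qed simp
  then have "UNIV \<subseteq> {0, - 1, - \<theta>, - (\<theta> ^ 2)}" by blast
  then show False using assms finite_subset by blast
qed

text \<open>A single point with trivial stabiliser makes the action faithful.\<close>

lemma act_iso:
  assumes "(paramM :: ('k \<times> 'k) set) \<noteq> {}"
  shows "act \<in> iso SL2_Z3 (sklyanin_group \<theta>)"
proof -
  obtain c :: 'k where c: "c \<noteq> 0" "(c, 0) \<in> paramM" using paramM_nonempty_axis[OF assms] .
  have "inj_on act (carrier SL2_Z3)"
    using act_inj[OF c(2,1)] by (auto simp: inj_on_def)
  moreover have "act \<in> hom SL2_Z3 (sklyanin_group \<theta>)"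
    using act_hom carrier_sklyanin_group by (auto simp: hom_def sklyanin_group_def)
  ultimately show ?thesis
    by (simp add: iso_def bij_betw_def carrier_sklyanin_group)
qed

lemma order_sklyanin_group:
  assumes "(paramM :: ('k \<times> 'k) set) \<noteq> {}"
  shows "order (sklyanin_group \<theta>) = 24" "sklyanin_group \<theta> \<cong> SL2_Z3"
proof -
  show "order (sklyanin_group \<theta>) = 24"
    using bij_betw_same_card[of act "carrier SL2_Z3"] act_iso[OF assms] card_SL2_Z3
    by (simp add: iso_def order_def)
  show "sklyanin_group \<theta> \<cong> SL2_Z3"
    using group.iso_set_sym[OF group_SL2_Z3 act_iso[OF assms]] unfolding is_iso_def by blast
qed

lemma card_equivalent_params:
  fixes a b :: 'k
  assumes u: "(a, b) \<in> paramM" "a \<noteq> b"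
  shows "card {v. equivalent_params (a, b) v} = 24"
  using act_inj[OF u] card_SL2_Z3 by (simp add: equivalent_params_iff_act[OF u(1)] card_image)

lemma equivalent_params_paramM:
  fixes u v :: "'k \<times> 'k"
  assumes "u \<in> paramM" "equivalent_params u v"
  shows "v \<in> paramM"
proof -
  obtain A where "A \<in> carrier SL2_Z3" "v = act A u"
    using assms(2) unfolding equivalent_params_iff_act[OF assms(1)] by blast
  then show ?thesis using act_paramM assms(1) by blast
qed

lemma pairs_finite_card:
  "finite (pairs_i \<theta> u)" "card (pairs_i \<theta> u) \<le> 3"
  "finite (pairs_ii \<theta> u)" "card (pairs_ii \<theta> u) \<le> 3"
  "finite (pairs_iii \<theta> u)" "card (pairs_iii \<theta> u) \<le> 18"
proof -
  obtain a b where u: "u = (a, b)" by fastforce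
  have card3: "card ({0, 1, 2} :: nat set) = 3" by simp
  have i: "pairs_i \<theta> u = (\<lambda>j::nat. (\<theta> ^ j * a, \<theta> ^ j * b)) ` {0, 1, 2}"
    unfolding pairs_i_def u prod.case by blast
  have ii: "pairs_ii \<theta> u = (\<lambda>j::nat. (\<theta> ^ j * b, \<theta> ^ j * a)) ` {0, 1, 2}"
    unfolding pairs_ii_def u prod.case by blast
  show "finite (pairs_i \<theta> u)" "finite (pairs_ii \<theta> u)" by (simp_all add: i ii)
  show "card (pairs_i \<theta> u) \<le> 3" "card (pairs_ii \<theta> u) \<le> 3"
    unfolding i ii using card_image_le[of "{0, 1, 2} :: nat set"] card3 by (metis finite.intros)+
  define P where "P = {(0::nat, 1::nat, 2::nat), (0, 2, 1), (1, 0, 2), (1, 2, 0), (2, 0, 1), (2, 1, 0)}"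
  have cP: "card P = 6" "finite P" by (simp_all add: P_def)
  let ?f = "\<lambda>((j, k, m), n::nat). ((\<theta> ^ j * a + \<theta> ^ k * b + \<theta> ^ (m + n)) / (a + b + \<theta> ^ n),
       (\<theta> ^ k * a + \<theta> ^ j * b + \<theta> ^ (m + n)) / (a + b + \<theta> ^ n))"
  have sub: "pairs_iii \<theta> u \<subseteq> ?f ` (P \<times> {0, 1, 2})"
  proof (rule subsetI)
    fix v assume "v \<in> pairs_iii \<theta> u"
    then obtain j k m n :: nat where n: "n \<in> {0, 1, 2}" and p: "{j, k, m} = {0, 1, 2}"
      and v: "v = ((\<theta> ^ j * a + \<theta> ^ k * b + \<theta> ^ (m + n)) / (a + b + \<theta> ^ n),
        (\<theta> ^ k * a + \<theta> ^ j * b + \<theta> ^ (m + n)) / (a + b + \<theta> ^ n))"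
      unfolding u pairs_iii_def prod.case mem_Collect_eq by blast
    have "((j, k, m), n) \<in> P \<times> {0, 1, 2}" using n permutations_of_0_1_2[OF p] unfolding P_def by blast
    then show "v \<in> ?f ` (P \<times> {0, 1, 2})"
      unfolding v by (rule rev_image_eqI) simp
  qed
  have fin: "finite (P \<times> {0, 1, 2 :: nat})" using cP by simp
  show "finite (pairs_iii \<theta> u)" using sub fin finite_surj by blast
  have "card (pairs_iii \<theta> u) \<le> card (?f ` (P \<times> {0, 1, 2}))"
    using sub fin by (meson card_mono finite_imageI)
  also have "\<dots> \<le> card (P \<times> {0, 1, 2 :: nat})" using fin by (rule card_image_le)
  also have "\<dots> = 18" by (simp add: card_cartesian_product cP)
  finally show "card (pairs_iii \<theta> u) \<le> 18" .
qed

text \<open>The bounds 3, 3 and 18 add up to 24, the size of the union, so each of them is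
  attained.\<close>

lemma card_pairs:
  assumes u: "(a, b) \<in> paramM" "a \<noteq> b"
  shows "card (pairs_i \<theta> (a, b)) = 3" "card (pairs_ii \<theta> (a, b)) = 3" "card (pairs_iii \<theta> (a, b)) = 18"
proof -
  have "24 \<le> card (pairs_i \<theta> (a, b)) + card (pairs_ii \<theta> (a, b)) + card (pairs_iii \<theta> (a, b))"
    using card_equivalent_params[OF u] card_Un_le[of "pairs_i \<theta> (a, b) \<union> pairs_ii \<theta> (a, b)" "pairs_iii \<theta> (a, b)"]
      card_Un_le[of "pairs_i \<theta> (a, b)" "pairs_ii \<theta> (a, b)"]
    unfolding equivalent_params_pairs by linarith
  then show "card (pairs_i \<theta> (a, b)) = 3" "card (pairs_ii \<theta> (a, b)) = 3" "card (pairs_iii \<theta> (a, b)) = 18"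
    using pairs_finite_card[of "(a, b)"] by linarith+
qed

lemma generic_on_paramM:
  assumes inf: "infinite (UNIV :: 'k set)"
    and P: "\<And>a b. (a, b) \<in> paramM \<Longrightarrow> a \<noteq> b \<Longrightarrow> P (a, b :: 'k)"
  shows "generic_on paramM P"
  unfolding generic_on_def
proof (intro exI conjI ballI)
  \<comment> \<open>The polynomial a - b: b is the outer variable, its constant coefficient is a and
    its linear coefficient is -1.\<close>
  let ?F = "[:[:0, 1:], [:- 1:]:] :: 'k poly poly"
  have "poly2 ?F (a, b) = a - b" for a b by (simp add: poly2_def)
  then have "{(a, b). a = b} = {u. \<forall>F\<in>{?F}. poly2 F u = 0}" by auto
  then show "zariski_closed {(a, b :: 'k). a = b}" unfolding zariski_closed_def by blast
  obtain c :: 'k where "c \<noteq> 0" "(c, 0) \<in> paramM" using infinite_axis[OF inf] .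
  then show "paramM - {(a, b :: 'k). a = b} \<noteq> {}" by blast
qed (use P in auto)

end

section \<open>Isomorphisms that realise the two generators\<close>

context cube_root
begin

text \<open>The substitution z \<mapsto> \<theta> z fixes the cubes and multiplies every monomial
  with three distinct letters by \<theta>.\<close>

lemma scale_isomorphic: "sklyanin_isomorphic (a, b, 1) (\<theta> * a, \<theta> * b, 1)"
proof -
  define diag :: "'k \<Rightarrow> letter \<Rightarrow> letter \<Rightarrow> 'k" where
    "diag t i j = (if i = j then if i = Lz then t else 1 else 0)" for t i j
  have inv: "mat_mat (diag t) (diag t') = delta" if "t * t' = 1" for t t'
    using that by (intro ext, rename_tac i j, case_tac i; case_tac j)
      (simp_all add: mat_mat_def sum_letter diag_def delta_def)
  have t: "\<theta> * \<theta> ^ 2 = 1" "\<theta> ^ 2 * \<theta> = 1" using cube by Groebner_Basis.algebra+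
  have c: "\<theta> * \<theta> * \<theta> = 1" using cube by (simp add: power3_eq_cube)
  have "trilin a b (\<lambda>i. diag \<theta> i p) (\<lambda>i. diag \<theta> i q) (\<lambda>i. diag \<theta> i r) = 1 * potential (\<theta> * a) (\<theta> * b) p q r" for p q r
    using c by (cases p; cases q; cases r) (simp_all add: trilin_def potential_def diag_def delta_def mult_ac)
  then show ?thesis using sklyanin_isomorphic_trilin[OF inv[OF t(1)] inv[OF t(2)], of 1] by simp
qed

text \<open>The substitution is the discrete Fourier transform, inverted by its conjugate divided by
  3. The factor l = 3 (a + b + 1) is the coefficient of x^3 in the transformed potential.\<close>

lemma fourier_isomorphic:
  assumes M: "(a, b) \<in> paramM"
  shows "sklyanin_isomorphic (a, b, 1) (fst (rot 1 1 \<theta> (a, b)), snd (rot 1 1 \<theta> (a, b)), 1)"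
proof -
  define dft :: "'k \<Rightarrow> letter \<Rightarrow> letter \<Rightarrow> 'k" where
    "dft t i j = (if i = Lx \<or> j = Lx then 1 else if i = j then t ^ 2 else t)" for t i j
  have inv: "mat_mat (dft \<theta>) (\<lambda>i j. dft (\<theta> ^ 2) i j / 3) = delta" "mat_mat (\<lambda>i j. dft (\<theta> ^ 2) i j / 3) (dft \<theta>) = delta"
    unfolding mat_mat_def sum_letter
    by (intro ext, rename_tac i j, case_tac i; case_tac j;
      use three_ne_0 in \<open>simp add: dft_def delta_def theta_reduce power2_eq_square field_simps\<close>)+
  define l where "l = 3 * (a + b + 1)"
  have d: "a + b + 1 \<noteq> 0" using paramM_denom[OF M, of 1] by simp
  then have l: "l \<noteq> 0" using three_ne_0 unfolding l_def by (metis mult_eq_0_iff)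
  define a' b' where "a' = fst (rot 1 1 \<theta> (a, b))" and "b' = snd (rot 1 1 \<theta> (a, b))"
  have cancel: "3 * D * (x / D) = 3 * x" if "D \<noteq> 0" for D x :: 'k using that by simp
  have lab: "l * a' = 3 * (\<theta> * a + \<theta> ^ 2 * b + 1)" "l * b' = 3 * (\<theta> ^ 2 * a + \<theta> * b + 1)"
    unfolding a'_def b'_def rot_def l_def prod.case fst_conv snd_conv mult_1 power_one
    by (rule cancel[OF d])+
  \<comment> \<open>Clears the denominators of a' and b': the potential is affine in its parameters,
    and the second summand raises the coefficient of the cubes from 1 to l.\<close>
  have scaled: "l * potential a' b' p q r = potential (l * a') (l * b') p q r + (l - 1) * potential 0 0 p q r" for p q r
    by (simp add: potential_def trilin_def algebra_simps)
  have "trilin a b (\<lambda>i. dft \<theta> i p) (\<lambda>i. dft \<theta> i q) (\<lambda>i. dft \<theta> i r) = l * potential a' b' p q r" for p q r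
    unfolding scaled lab
    unfolding l_def
    by (cases p; cases q; cases r)
      (simp_all add: trilin_def potential_def dft_def delta_def theta_reduce power2_eq_square algebra_simps)
  then show ?thesis using sklyanin_isomorphic_trilin[OF inv l] unfolding a'_def b'_def by blast
qed

lemma act4_isomorphic:
  assumes "sl2_word \<alpha> \<beta> \<gamma> \<delta>" and u: "u \<in> paramM"
  shows "sklyanin_isomorphic (fst u, snd u, 1) (fst (act4 \<alpha> \<beta> \<gamma> \<delta> u), snd (act4 \<alpha> \<beta> \<gamma> \<delta> u), 1)"
  using assms(1)
proof (induction rule: sl2_word.induct)
  case one
  then show ?case by (simp add: act4_one sklyanin_isomorphic_refl)
next
  case (scale \<alpha> \<beta> \<gamma> \<delta>)
  show ?case
    unfolding act4_scale[OF sl2_word_det[OF scale.hyps]]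
    using sklyanin_isomorphic_trans[OF scale.IH scale_isomorphic]
    by (simp add: dilate_def case_prod_beta)
next
  case (fourier \<alpha> \<beta> \<gamma> \<delta>)
  have "(fst (act4 \<alpha> \<beta> \<gamma> \<delta> u), snd (act4 \<alpha> \<beta> \<gamma> \<delta> u)) \<in> paramM"
    using act4_paramM[OF fourier.hyps u] by simp
  from sklyanin_isomorphic_trans[OF fourier.IH fourier_isomorphic[OF this]] show ?case
    unfolding act4_fourier[OF sl2_word_det[OF fourier.hyps] u] by simp
qed

lemma sklyanin_isomorphic_iff:
  assumes M: "(a, b) \<in> paramM" and M': "(a', b') \<in> paramM"
  shows "sklyanin_isomorphic (a, b, 1) (a', b', 1) \<longleftrightarrow> equivalent_params (a, b) (a', b' :: 'k)"
proof
  assume "sklyanin_isomorphic (a, b, 1) (a', b', 1)"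
  moreover have "(a', b') \<noteq> (0, 0)" "(a' ^ 3 - 1, b' ^ 3 - 1) \<noteq> (0, 0)" "(a + b) ^ 3 + 1 \<noteq> 0"
    using M M' by (simp_all add: paramM_def)
  ultimately show "equivalent_params (a, b) (a', b')"
    using trilin_if_isomorphic equivalent_params_if_trilin by metis
next
  assume "equivalent_params (a, b) (a', b')"
  then obtain \<alpha> \<beta> \<gamma> \<delta> where "sl2_word \<alpha> \<beta> \<gamma> \<delta>" "(a', b') = act4 \<alpha> \<beta> \<gamma> \<delta> (a, b)"
    unfolding equivalent_params_iff_act[OF M] by (auto elim!: carrier_SL2_Z3_word simp: act_mat22 M)
  then show "sklyanin_isomorphic (a, b, 1) (a', b', 1)"
    using act4_isomorphic[OF _ M] by (metis fst_conv snd_conv)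
qed

lemma isomorphic_params_eq:
  assumes M: "(a, b) \<in> paramM"
  shows "{(a', b') \<in> paramM. sklyanin_isomorphic (a, b, 1) (a', b', 1 :: 'k)} = {v. equivalent_params (a, b) v}"
  using sklyanin_isomorphic_iff[OF M] equivalent_params_paramM[OF M] by auto

end

theorem lemma5p6:
  fixes \<theta> :: "'k::field"
  assumes "CHAR('k) \<noteq> 3" and "\<theta>^3 = 1" and "1 \<noteq> \<theta>"
  shows
    "scale_map \<theta> \<in> Bij paramM \<and> fourier_map \<theta> \<in> Bij paramM \<and>
     group_action (sklyanin_group \<theta>) paramM (\<lambda>g. g) \<and>
     (\<forall>(a, b) \<in> paramM. \<forall>(a', b') \<in> paramM.
        sklyanin_isomorphic (a, b, 1) (a', b', 1) \<longleftrightarrow>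
        (a', b') \<in> orbit (sklyanin_group \<theta>) (\<lambda>g. g) (a, b)) \<and>
     finite (carrier (sklyanin_group \<theta>)) \<and>
     ((paramM :: ('k \<times> 'k) set) \<noteq> {} \<longrightarrow>
        order (sklyanin_group \<theta>) = 24 \<and> sklyanin_group \<theta> \<cong> SL2_Z3) \<and>
     (infinite (UNIV :: 'k set) \<longrightarrow>
        generic_on (paramM :: ('k \<times> 'k) set) (\<lambda>(a, b).
          card {(a', b') \<in> paramM. (a', b') \<noteq> (a, b) \<and>
            sklyanin_isomorphic (a, b, 1) (a', b', 1)} = 23)) \<and>
     (\<forall>(a, b) \<in> paramM.
        {(a', b') \<in> paramM. sklyanin_isomorphic (a, b, 1) (a', b', 1)} =
        pairs_i \<theta> (a, b) \<union> pairs_ii \<theta> (a, b) \<union> pairs_iii \<theta> (a, b)) \<and>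
     (infinite (UNIV :: 'k set) \<longrightarrow>
        generic_on paramM (\<lambda>(a, b).
          card (pairs_i \<theta> (a, b)) = 3 \<and> card (pairs_ii \<theta> (a, b)) = 3 \<and>
          card (pairs_iii \<theta> (a, b)) = 18))"
proof -
  interpret cube_root \<theta> using assms by unfold_locales
  have orbit: "sklyanin_isomorphic (a, b, 1) (a', b', 1) \<longleftrightarrow>
      (a', b') \<in> orbit (sklyanin_group \<theta>) (\<lambda>g. g) (a, b)"
    if "(a, b) \<in> paramM" "(a', b') \<in> paramM" for a b a' b' :: 'k
    using sklyanin_isomorphic_iff[OF that] equivalent_params_iff_act[OF that(1)]
    by (simp add: orbit_sklyanin_group)
  have fin: "finite (carrier (sklyanin_group \<theta>))"
    unfolding carrier_sklyanin_group using card_SL2_Z3 by (intro finite_imageI card_ge_0_finite) simp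
  have count: "card {(a', b') \<in> paramM. (a', b') \<noteq> (a, b) \<and> sklyanin_isomorphic (a, b, 1) (a', b', 1)} = 23"
    if ab: "(a, b) \<in> paramM" "a \<noteq> b" for a b :: 'k
  proof -
    have "{(a', b') \<in> paramM. (a', b') \<noteq> (a, b) \<and> sklyanin_isomorphic (a, b, 1) (a', b', 1)} =
        {v. equivalent_params (a, b) v} - {(a, b)}"
      unfolding isomorphic_params_eq[OF ab(1), symmetric] by auto
    \<comment> \<open>The removed point must lie in the set for its size to drop from 24 to
      23.\<close>
    moreover have "equivalent_params (a, b) (a, b)"
      by (rule iffD1[OF sklyanin_isomorphic_iff[OF ab(1) ab(1)] sklyanin_isomorphic_refl])
    ultimately show ?thesis using card_equivalent_params[OF ab] by simp
  qed
  have list: "{(a', b') \<in> paramM. sklyanin_isomorphic (a, b, 1) (a', b', 1)} =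
      pairs_i \<theta> (a, b) \<union> pairs_ii \<theta> (a, b) \<union> pairs_iii \<theta> (a, b)"
    if "(a, b) \<in> paramM" for a b :: 'k
    using isomorphic_params_eq[OF that] equivalent_params_pairs by simp
  show ?thesis
  proof (intro conjI impI)
    show "\<forall>(a, b) \<in> paramM. \<forall>(a', b') \<in> paramM.
        sklyanin_isomorphic (a, b, 1) (a', b', 1) \<longleftrightarrow>
        (a', b') \<in> orbit (sklyanin_group \<theta>) (\<lambda>g. g) (a, b)"
      using orbit by auto
    show "\<forall>(a, b) \<in> paramM.
        {(a', b') \<in> paramM. sklyanin_isomorphic (a, b, 1) (a', b', 1)} =
        pairs_i \<theta> (a, b) \<union> pairs_ii \<theta> (a, b) \<union> pairs_iii \<theta> (a, b)"
      by (rule ballI, rename_tac u, case_tac u, hypsubst, unfold prod.case, rule list)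
    assume "infinite (UNIV :: 'k set)"
    then show "generic_on (paramM :: ('k \<times> 'k) set) (\<lambda>(a, b).
          card {(a', b') \<in> paramM. (a', b') \<noteq> (a, b) \<and>
            sklyanin_isomorphic (a, b, 1) (a', b', 1)} = 23)"
      by (rule generic_on_paramM) (unfold prod.case, rule count)
  next
    assume "infinite (UNIV :: 'k set)"
    then show "generic_on paramM (\<lambda>(a, b).
          card (pairs_i \<theta> (a, b)) = 3 \<and> card (pairs_ii \<theta> (a, b)) = 3 \<and>
          card (pairs_iii \<theta> (a, b)) = 18)"
      by (rule generic_on_paramM) (simp add: card_pairs)
  qed (use generators_Bij group_action_sklyanin_group fin order_sklyanin_group in blast)+
qed

end
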